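(* Let $\Delta>0$ and let $(Y(t))_{t\in\mathbb{R}^2}$ be a causal CARMA$(2,1)$ random field with companion matrices $A_1,A_2$, each having distinct eigenvalues, driven by a homogeneous Lévy basis $\Lambda$ on $\mathbb{R}^2$ with mean zero and finite second moment with variance $\kappa_2=1$. Let $\lambda_{i1},\lambda_{i2}$ be the eigenvalues of $A_i$, $i=1,2$. Assume that $b_0\ge0$, that all eigenvalues $\lambda$ of $A_1,A_2$ satisfy $-\pi/\Delta\le\mathrm{Im}(\lambda)<\pi/\Delta$, that all coefficients $d_i^*(\lambda_i)$ ($\lambda_i$ an eigenvalue of $A_i$, $i=1,2$) are nonzero, and that additionally $\lambda_{11}\lambda_{12}\ne\lambda_{21}\lambda_{22}$. Then the parameter vector $\theta=(b_0,b_1,\lambda_{11},\lambda_{12},\lambda_{21},\lambda_{22})$ is uniquely determined (up to the order in which the eigenvalues of each $A_i$ are listed) by $$\{\psi(j\Delta\mathbf e_i)\colon i=1,2;\ j=0,\dots,5\}.$$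
   Context: Homogeneous Lévy basis: an infinitely divisible, independently scattered random measure $\Lambda$ on $\mathbb{R}^d$ with $\mathbb{E}[e^{\mathrm{i}u\Lambda(B)}]=\exp\{\mathrm{Leb}(B)(\mathrm{i}\beta u-\tfrac12\sigma^2u^2+\int_{\mathbb{R}}(e^{\mathrm{i}uz}-1-\mathrm{i}uz\mathbf 1_{\{|z|<1\}})\,\nu(dz))\}$ for bounded Borel sets $B$; its characteristic triplet is $(\beta,\sigma^2,\nu)$. It has finite second moment iff $\int z^2\nu(dz)<\infty$, and then its variance is $\kappa_2=\sigma^2+\int z^2\nu(dz)$. Stochastic integrals are in the sense of Rajput and Rosinski. Causal CARMA$(p,q)$ random field: let $0\le q<p$ be integers, $b=(b_0,\dots,b_{p-1})^\top\in\mathbb{R}^p$ with $b_q\ne0$ and $b_i=0$ for $i>q$, $\mathbf e_p=(0,\dots,0,1)^\top\in\mathbb{R}^p$, and for $i=1,\dots,d$ let $A_i\in\mathbb{R}^{p\times p}$ be the companion matrix (ones on the superdiagonal, last row $(-a_{i,p},\dots,-a_{i,1})$, other entries $0$) of a monic real polynomial $a_i(z)=z^p+a_{i,1}z^{p-1}+\dots+a_{i,p}$ all of whose roots have strictly negative real parts. With $\Lambda$ a homogeneous Lévy basis with $\int\log(|z|)^d\mathbf 1_{\{|z|>1\}}\nu(dz)<\infty$, $$Y(t)=\int_{-\infty}^{t_1}\cdots\int_{-\infty}^{t_d}b^\top e^{A_1(t_1-s_1)}\cdots e^{A_d(t_d-s_d)}\mathbf e_p\,\Lambda(ds),\quad t\in\mathbb{R}^d.$$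 The variogram is $\psi(t)=\mathrm{Var}[Y(t)-Y(0)]$. The coefficients $d_i^*(\lambda_i)\in\mathbb{C}$ are those in the representation $\psi(\tau\mathbf e_i)=2\kappa_2\sum_{\lambda_i}d_i^*(\lambda_i)(1-e^{\lambda_i|\tau|})$, $\tau\in\mathbb{R}$, where $\mathbf e_i$ is the $i$-th unit vector of $\mathbb{R}^d$ and the sum runs over the distinct eigenvalues $\lambda_i$ of $A_i$. "Uniquely determined" means: two fields satisfying all the hypotheses (with the same $\Delta$) and having the same listed variogram ordinates have the same parameter vector.
   Formalization: If b_0=0, then Y and -Y satisfy all hypotheses with the same variogram but parameters (0,b_1) and (0,-b_1), so the claim fails there; the formal conclusion determines b_1 only up to sign when b_0=0, and is the stated one when b_0>0. *)

theory Defs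
  imports "HOL-Probability.Probability"
begin

section \<open>Homogeneous Levy bases\<close>

definition bounded_borel :: "'s::euclidean_space set set" where
  "bounded_borel = {B \<in> sets borel. bounded B}"

text \<open>The law of the sum of \<open>n\<close> i.i.d. variables with common law \<open>\<rho>\<close> is the push-forward
  of the \<open>n\<close>-fold product measure under summation.\<close>

definition infinitely_divisible :: "real measure \<Rightarrow> bool" where
  "infinitely_divisible \<mu> \<longleftrightarrow>
     (\<forall>n::nat. n \<ge> 1 \<longrightarrow> (\<exists>\<rho>. real_distribution \<rho> \<and>
        \<mu> = distr (\<Pi>\<^sub>M i\<in>{..<n}. \<rho>) borel (\<lambda>x. \<Sum>i<n. x i)))"

definition levy_measure :: "real measure \<Rightarrow> bool" where
  "levy_measure \<nu> \<longleftrightarrow> sets \<nu> = sets borel \<and> emeasure \<nu> {0} = 0 \<and>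
     (\<integral>\<^sup>+ z. ennreal (min 1 (z\<^sup>2)) \<partial>\<nu>) < \<infinity>"

definition levy_khintchine_exponent ::
    "real \<Rightarrow> real \<Rightarrow> real measure \<Rightarrow> real \<Rightarrow> complex" where
  "levy_khintchine_exponent \<beta> \<sigma>2 \<nu> u =
     \<i> * complex_of_real (\<beta> * u) - complex_of_real (\<sigma>2 * u\<^sup>2 / 2)
     + (CLINT z|\<nu>. iexp (u * z) - 1
          - \<i> * complex_of_real (u * z * indicator {z. \<bar>z\<bar> < 1} z))"

text \<open>The parameter \<open>\<sigma>2\<close> is the Gaussian variance (the middle entry of the characteristic triplet),
  not its square root. The random measure is only indexed by bounded Borel sets: the values
  of \<open>\<Lambda>\<close> elsewhere are irrelevant.\<close>

locale homogeneous_levy_basis = prob_space M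
  for M :: "'w measure" +
  fixes \<Lambda> :: "'s::euclidean_space set \<Rightarrow> 'w \<Rightarrow> real"
    and \<beta> \<sigma>2 :: real and \<nu> :: "real measure"
  assumes gaussian_variance: "\<sigma>2 \<ge> 0"
    and jump_measure: "levy_measure \<nu>"
    and random_variable_basis: "\<And>B. B \<in> bounded_borel \<Longrightarrow> random_variable borel (\<Lambda> B)"
    and infinitely_divisible_basis:
      "\<And>B. B \<in> bounded_borel \<Longrightarrow> infinitely_divisible (distr M borel (\<Lambda> B))"
    and independently_scattered:
      "\<And>A :: nat \<Rightarrow> 's set. \<lbrakk>range A \<subseteq> bounded_borel; disjoint_family A\<rbrakk>
         \<Longrightarrow> indep_vars (\<lambda>_. borel) (\<lambda>n. \<Lambda> (A n)) UNIV"
    and countably_additive_basis: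
      "\<And>A :: nat \<Rightarrow> 's set. \<lbrakk>range A \<subseteq> bounded_borel; disjoint_family A;
           (\<Union>n. A n) \<in> bounded_borel\<rbrakk>
         \<Longrightarrow> AE \<omega> in M. (\<lambda>n. \<Lambda> (A n) \<omega>) sums \<Lambda> (\<Union>n. A n) \<omega>"
    and characteristic_function:
      "\<And>B u. B \<in> bounded_borel \<Longrightarrow>
         (CLINT \<omega>|M. iexp (u * \<Lambda> B \<omega>)) =
           exp (complex_of_real (measure lborel B) * levy_khintchine_exponent \<beta> \<sigma>2 \<nu> u)"

definition basis_mean_zero ::
    "'w measure \<Rightarrow> ('s::euclidean_space set \<Rightarrow> 'w \<Rightarrow> real) \<Rightarrow> bool" where
  "basis_mean_zero M \<Lambda> \<longleftrightarrow>
     (\<forall>B\<in>bounded_borel. integrable M (\<Lambda> B) \<and> (\<integral>\<omega>. \<Lambda> B \<omega> \<partial>M) = 0)"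

definition basis_finite_second_moment ::
    "'w measure \<Rightarrow> ('s::euclidean_space set \<Rightarrow> 'w \<Rightarrow> real) \<Rightarrow> bool" where
  "basis_finite_second_moment M \<Lambda> \<longleftrightarrow>
     (\<forall>B\<in>bounded_borel. integrable M (\<lambda>\<omega>. (\<Lambda> B \<omega>)\<^sup>2))"

definition basis_variance :: "real \<Rightarrow> real measure \<Rightarrow> real" where
  "basis_variance \<sigma>2 \<nu> = \<sigma>2 + (\<integral>z. z\<^sup>2 \<partial>\<nu>)"

section \<open>Stochastic integrals in the sense of Rajput and Rosinski\<close>

definition tendsto_in_probability ::
    "'w measure \<Rightarrow> (nat \<Rightarrow> 'w \<Rightarrow> real) \<Rightarrow> ('w \<Rightarrow> real) \<Rightarrow> bool" where
  "tendsto_in_probability M X Z \<longleftrightarrow>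
     (\<forall>\<epsilon>>0. (\<lambda>n. measure M {\<omega> \<in> space M. \<bar>X n \<omega> - Z \<omega>\<bar> > \<epsilon>}) \<longlonglongrightarrow> 0)"

definition simple_integrand :: "('s::euclidean_space \<Rightarrow> real) \<Rightarrow> bool" where
  "simple_integrand f \<longleftrightarrow> simple_function borel f \<and> bounded {s. f s \<noteq> 0}"

text \<open>For a simple function in its canonical form \<open>f = (\<Sum>y. y * indicator (f -` {y}))\<close>
  the integral over \<open>A\<close> is the finite sum of the \<open>y * \<Lambda> (A \<inter> f -` {y})\<close>, \<open>y \<noteq> 0\<close>.\<close>

definition simple_stochastic_integral ::
    "('s::euclidean_space set \<Rightarrow> 'w \<Rightarrow> real) \<Rightarrow> ('s \<Rightarrow> real) \<Rightarrow> 's set \<Rightarrow> 'w \<Rightarrow> real" where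
  "simple_stochastic_integral \<Lambda> f A \<omega> = (\<Sum>y \<in> range f - {0}. y * \<Lambda> (A \<inter> f -` {y}) \<omega>)"

text \<open>The exceptional null sets refer to the control measure of the basis, which is a constant
  multiple of Lebesgue measure for a homogeneous basis (a positive one unless \<open>\<Lambda>\<close> vanishes).\<close>

definition integral_approximation ::
    "'w measure \<Rightarrow> ('s::euclidean_space set \<Rightarrow> 'w \<Rightarrow> real) \<Rightarrow> ('s \<Rightarrow> real)
       \<Rightarrow> (nat \<Rightarrow> 's \<Rightarrow> real) \<Rightarrow> bool" where
  "integral_approximation M \<Lambda> f F \<longleftrightarrow>
     (\<forall>n. simple_integrand (F n)) \<and>
     (AE s in lborel. (\<lambda>n. F n s) \<longlonglongrightarrow> f s) \<and>
     (\<forall>A\<in>sets borel. \<exists>Z\<in>borel_measurable M.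
        tendsto_in_probability M (\<lambda>n. simple_stochastic_integral \<Lambda> (F n) A) Z)"

text \<open>\<open>has_stochastic_integral M \<Lambda> f A Z\<close>: the function \<open>f\<close> is \<open>\<Lambda>\<close>-integrable, and \<open>Z\<close> is
  a version of its integral over \<open>A\<close> (which is defined up to almost sure equality only).\<close>

definition has_stochastic_integral ::
    "'w measure \<Rightarrow> ('s::euclidean_space set \<Rightarrow> 'w \<Rightarrow> real) \<Rightarrow> ('s \<Rightarrow> real)
       \<Rightarrow> 's set \<Rightarrow> ('w \<Rightarrow> real) \<Rightarrow> bool" where
  "has_stochastic_integral M \<Lambda> f A Z \<longleftrightarrow>
     f \<in> borel_measurable borel \<and> Z \<in> borel_measurable M \<and>
     (\<exists>F. integral_approximation M \<Lambda> f F \<and>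
        tendsto_in_probability M (\<lambda>n. simple_stochastic_integral \<Lambda> (F n) A) Z)"

section \<open>Matrices\<close>

text \<open>The power series of the matrix exponential; the library has \<open>exp\<close> on Banach algebras only,
  and square matrices are not an instance.\<close>

definition matrix_exp :: "real^'n^'n \<Rightarrow> real^'n^'n" where
  "matrix_exp A = (\<Sum>k. (1 / fact k) *\<^sub>R (((**) A ^^ k) (mat 1)))"

definition eigenvalues :: "real^'n^'n \<Rightarrow> complex set" where
  "eigenvalues A =
     {l. \<exists>v. v \<noteq> 0 \<and> (\<chi> i j. complex_of_real (A $ i $ j)) *v v = l *s v}"

text \<open>For \<open>a(z) = z\<^sup>2 + a\<^sub>1 z + a\<^sub>2\<close> the last row is \<open>(- a\<^sub>2, - a\<^sub>1)\<close>.\<close>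

definition companion_matrix2 :: "real poly \<Rightarrow> real^2^2" where
  "companion_matrix2 a = vector [vector [0, 1], vector [- coeff a 0, - coeff a 1]]"

section \<open>Causal CARMA(2,1) random fields on the plane\<close>

definition CARMA_kernel :: "real^2 \<Rightarrow> (2 \<Rightarrow> real^2^2) \<Rightarrow> real^2 \<Rightarrow> real" where
  "CARMA_kernel b A x =
     b \<bullet> ((matrix_exp ((x $ 1) *\<^sub>R A 1) ** matrix_exp ((x $ 2) *\<^sub>R A 2)) *v axis 2 1)"

text \<open>Here \<open>a 1\<close> and \<open>a 2\<close> are the autoregressive polynomials of the two coordinate directions.
  The moving average order being 1 means \<open>b1 \<noteq> 0\<close>. The iterated integral
  over \<open>s\<^sub>1 \<le> t\<^sub>1\<close> and \<open>s\<^sub>2 \<le> t\<^sub>2\<close> is written with the indicator of this quadrant.\<close>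

definition causal_CARMA_2_1 ::
    "'w measure \<Rightarrow> ((real^2) set \<Rightarrow> 'w \<Rightarrow> real) \<Rightarrow> real \<Rightarrow> real \<Rightarrow> real measure \<Rightarrow>
       real \<Rightarrow> real \<Rightarrow> (2 \<Rightarrow> real poly) \<Rightarrow> (real^2 \<Rightarrow> 'w \<Rightarrow> real) \<Rightarrow> bool" where
  "causal_CARMA_2_1 M \<Lambda> \<beta> \<sigma>2 \<nu> b0 b1 a Y \<longleftrightarrow>
     homogeneous_levy_basis M \<Lambda> \<beta> \<sigma>2 \<nu> \<and>
     (\<integral>\<^sup>+ z. ennreal ((ln \<bar>z\<bar>)\<^sup>2 * indicator {z. \<bar>z\<bar> > 1} z) \<partial>\<nu>) < \<infinity> \<and>
     b1 \<noteq> 0 \<and>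
     (\<forall>i. degree (a i) = 2 \<and> lead_coeff (a i) = 1 \<and>
        (\<forall>z::complex. poly (map_poly complex_of_real (a i)) z = 0 \<longrightarrow> Re z < 0)) \<and>
     (\<forall>t. has_stochastic_integral M \<Lambda>
        (\<lambda>s. indicator {s. s $ 1 \<le> t $ 1 \<and> s $ 2 \<le> t $ 2} s *
          CARMA_kernel (vector [b0, b1]) (\<lambda>i. companion_matrix2 (a i)) (t - s)) UNIV (Y t))"

definition variogram :: "'w measure \<Rightarrow> (real^2 \<Rightarrow> 'w \<Rightarrow> real) \<Rightarrow> real^2 \<Rightarrow> real" where
  "variogram M Y t = prob_space.variance M (\<lambda>\<omega>. Y t \<omega> - Y 0 \<omega>)"

text \<open>\<open>d i l\<close> is the coefficient belonging to the eigenvalue \<open>l\<close> of \<open>A i\<close>. The exponential functions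
  of distinct eigenvalues being linearly independent, the coefficients are unique
  on the eigenvalues.\<close>

definition variogram_coefficients ::
    "(real^2 \<Rightarrow> real) \<Rightarrow> real \<Rightarrow> (2 \<Rightarrow> real^2^2) \<Rightarrow> (2 \<Rightarrow> complex \<Rightarrow> complex) \<Rightarrow> bool" where
  "variogram_coefficients \<psi> \<kappa>2 A d \<longleftrightarrow>
     (\<forall>i. \<forall>\<tau>::real. complex_of_real (\<psi> (\<tau> *\<^sub>R axis i 1)) =
        2 * complex_of_real \<kappa>2 *
          (\<Sum>l\<in>eigenvalues (A i). d i l * (1 - exp (l * complex_of_real \<bar>\<tau>\<bar>))))"

text \<open>All hypotheses on a single field; \<open>l i 1\<close> and \<open>l i 2\<close> list the eigenvalues of the companion
  matrix of direction \<open>i\<close>. The condition \<open>b0 \<ge> 0\<close> selects one of the two fields \<open>Y\<close> and \<open>- Y\<close>,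
  which have the same variogram and the parameters \<open>(b0, b1)\<close> and \<open>(- b0, - b1)\<close>, only if
  \<open>b0 \<noteq> 0\<close>; for \<open>b0 = 0\<close> both are admissible.\<close>

definition admissible_CARMA_2_1 ::
    "real \<Rightarrow> 'w measure \<Rightarrow> ((real^2) set \<Rightarrow> 'w \<Rightarrow> real) \<Rightarrow> real \<Rightarrow> real \<Rightarrow> real measure \<Rightarrow>
       real \<Rightarrow> real \<Rightarrow> (2 \<Rightarrow> real poly) \<Rightarrow> (real^2 \<Rightarrow> 'w \<Rightarrow> real) \<Rightarrow>
       (2 \<Rightarrow> 2 \<Rightarrow> complex) \<Rightarrow> (2 \<Rightarrow> complex \<Rightarrow> complex) \<Rightarrow> bool" where
  "admissible_CARMA_2_1 \<Delta> M \<Lambda> \<beta> \<sigma>2 \<nu> b0 b1 a Y l d \<longleftrightarrow>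
     causal_CARMA_2_1 M \<Lambda> \<beta> \<sigma>2 \<nu> b0 b1 a Y \<and>
     basis_mean_zero M \<Lambda> \<and> basis_finite_second_moment M \<Lambda> \<and> basis_variance \<sigma>2 \<nu> = 1 \<and>
     (\<forall>i. eigenvalues (companion_matrix2 (a i)) = {l i 1, l i 2} \<and> l i 1 \<noteq> l i 2) \<and>
     b0 \<ge> 0 \<and>
     (\<forall>i j. - pi / \<Delta> \<le> Im (l i j) \<and> Im (l i j) < pi / \<Delta>) \<and>
     variogram_coefficients (variogram M Y) (basis_variance \<sigma>2 \<nu>)
       (\<lambda>i. companion_matrix2 (a i)) d \<and>
     (\<forall>i j. d i (l i j) \<noteq> 0) \<and>
     l 1 1 * l 1 2 \<noteq> l 2 1 * l 2 2"

end

theory Submission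
  imports Defs "HOL-Real_Asymp.Real_Asymp"
begin

text \<open>The variogram ordinates on each axis determine, by Prony's argument, the eigenvalues and the
  coefficients, hence the whole variogram on both axes. On the other hand the variogram is
  the squared \<open>L\<^sup>2\<close>-norm of the increment of the kernel \<open>g\<close>. Write \<open>z\<^sup>2 + c1 z + c0\<close> and \<open>z\<^sup>2 + d1 z + d0\<close> for
  the autoregressive polynomials. The slope of the variogram at the origin gives
  \<open>b0\<^sup>2 + d0 b1\<^sup>2\<close> along the first axis and \<open>b0\<^sup>2 + c0 b1\<^sup>2\<close> along the second one, so \<open>b0\<^sup>2\<close> and \<open>b1\<^sup>2\<close> are known
  because \<open>c0 \<noteq> d0\<close>; the limit at infinity, twice the variance of the field, then gives \<open>b0 b1\<close>.

  The variance of the stochastic integral is obtained from characteristic functions alone. Let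
  \<open>q = - Re \<psi>\<close> for the Levy-Khintchine exponent \<open>\<psi>\<close>. If integrals of simple functions \<open>F n\<close> converge in
  probability, then \<open>\<integral>q (u (F n - F m))\<close> tends to \<open>0\<close>; Fatou's lemma replaces \<open>F m\<close> by the limit \<open>f\<close>, so that
  \<open>\<bar>E exp (i u Z)\<bar> = exp (- \<integral>q (u f))\<close> for whichever approximating sequence defines \<open>Z\<close>.
  The expansion of this at \<open>u = 0\<close> is the variance of \<open>Z\<close>.\<close>

section \<open>Prony's argument\<close>

text \<open>Each \<open>Y t\<close> comes with its own approximating sequence, whose integrands
  converge only almost everywhere and whose integrals converge only in probability. No isometry in
  the mean square is given, and nothing dominates the sequence. Taking the modulus of characteristic
  functions discards drift and compensator and leaves the integral of \<open>q (u * f)\<close>, for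
  which weighted subadditivity of \<open>q\<close> is a sufficient substitute for a norm. In the
  plane the obstacle is that the kernel is not a product. It is a bilinear form in the pairs
  \<open>(h, dh)\<close> of the two directions, where \<open>h\<close> is the impulse response and
  \<open>dh\<close> its derivative. These two are orthogonal on the half-line, because the primitive
  \<open>h^2 / 2\<close> of their product vanishes at 0 and at infinity. Along an axis the variogram
  is therefore a sum of two one-dimensional variograms without a mixed term. The slope at the origin
  sees only the jumps of the one-dimensional kernels at 0, and this is why it contains squares of
  \<open>b0\<close> and \<open>b1\<close> and never their product.\<close>

lemma exponential_coefficients_zero:
  fixes w e :: "complex \<Rightarrow> complex"
  assumes fin: "finite S" and card: "card S \<le> 4"
    and inj: "inj_on e S" and ne1: "\<And>x. x \<in> S \<Longrightarrow> e x \<noteq> 1"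
    and eq: "\<And>j::nat. j \<le> 5 \<Longrightarrow> (\<Sum>x\<in>S. w x * (1 - e x ^ j)) = 0"
    and x0: "x0 \<in> S"
  shows "w x0 = 0"
proof -
  \<comment> \<open>Test polynomial: it vanishes at 1, which removes the constant part of every
    term, and at all nodes except \<open>e x0\<close>. Its degree is at most \<open>card S\<close>,
    so its coefficients combine only available equations.\<close>
  define p where "p = [:-1, 1:] * (\<Prod>x\<in>S - {x0}. [:- e x, 1:])"
  have "degree p \<le> degree [:-1, 1::complex:] + degree (\<Prod>x\<in>S - {x0}. [:- e x, 1:])"
    unfolding p_def by (rule degree_mult_le)
  also have "degree (\<Prod>x\<in>S - {x0}. [:- e x, 1:]) \<le> (\<Sum>x\<in>S - {x0}. degree [:- e x, 1:])"
    using degree_prod_sum_le[of "S - {x0}" "\<lambda>x. [:- e x, 1:]"] fin by simp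
  also have "\<dots> = card S - 1"
    using fin x0 by simp
  finally have deg: "degree p \<le> 5"
    using card by simp
  have "(\<Sum>x\<in>S. w x * (poly p 1 - poly p (e x))) =
      (\<Sum>j\<le>degree p. coeff p j * (\<Sum>x\<in>S. w x * (1 - e x ^ j)))"
    unfolding poly_altdef sum_distrib_left sum_subtractf[symmetric]
    by (subst sum.swap) (simp add: algebra_simps sum_distrib_left)
  also have "\<dots> = 0"
    using eq deg by simp
  finally have *: "(\<Sum>x\<in>S. w x * (poly p 1 - poly p (e x))) = 0" .
  have p1: "poly p 1 = 0"
    by (simp add: p_def)
  have "(\<Sum>x\<in>S. w x * poly p (e x)) = 0"
    using * by (simp add: sum_negf p1)
  moreover have "(\<Sum>x\<in>S. w x * poly p (e x)) = w x0 * poly p (e x0)"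
  proof -
    have "poly p (e x) = 0" if "x \<in> S - {x0}" for x
      unfolding p_def using that fin by (auto simp: poly_prod)
    then show ?thesis
      using fin x0 by (simp add: sum.remove[of S x0])
  qed
  moreover have "poly p (e x0) \<noteq> 0"
    unfolding p_def using fin x0 ne1[of x0] inj
    by (auto simp: poly_prod inj_on_def)
  ultimately show ?thesis by simp
qed

text \<open>The strip is half-open and its height \<open>2 * pi / \<Delta>\<close> is the period of
  \<open>exp (x * \<Delta>)\<close>, so the imaginary parts of two of its points differ by less than
  a full period.\<close>

lemma exp_inj_on_strip:
  assumes "\<Delta> > 0" and x: "- pi / \<Delta> \<le> Im x" "Im x < pi / \<Delta>"
    and y: "- pi / \<Delta> \<le> Im y" "Im y < pi / \<Delta>"
    and eq: "exp (x * complex_of_real \<Delta>) = exp (y * complex_of_real \<Delta>)"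
  shows "x = y"
proof -
  obtain n :: int where n: "x * of_real \<Delta> = y * of_real \<Delta> + complex_of_real (of_int (2 * n) * pi) * \<i>"
    using eq unfolding exp_eq by auto
  have "Im x * \<Delta> = Im y * \<Delta> + 2 * of_int n * pi"
    using arg_cong[OF n, of Im] by simp
  moreover have "- pi \<le> Im x * \<Delta>" "Im x * \<Delta> < pi" "- pi \<le> Im y * \<Delta>" "Im y * \<Delta> < pi"
    using x y \<open>\<Delta> > 0\<close> by (auto simp: field_simps)
  ultimately have "\<bar>2 * of_int n * pi\<bar> < 2 * pi" by linarith
  then have "\<bar>real_of_int n\<bar> * (2 * pi) < 1 * (2 * pi)" by (simp add: abs_mult)
  then have "\<bar>real_of_int n\<bar> < 1" by (subst (asm) mult_less_cancel_right_pos) auto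
  then have "n = 0" by linarith
  then show ?thesis using n \<open>\<Delta> > 0\<close> by simp
qed

text \<open>Five exponentials (the constant and at most four others) are linearly
  independent on six equidistant nodes.\<close>

lemma exponential_sum_unique:
  fixes d d' :: "complex \<Rightarrow> complex"
  assumes "\<Delta> > 0" and fin: "finite L" "finite L'" and card: "card L \<le> 2" "card L' \<le> 2"
    and strip: "\<And>x. x \<in> L \<union> L' \<Longrightarrow> - pi / \<Delta> \<le> Im x \<and> Im x < pi / \<Delta> \<and> Re x < 0"
    and nz: "\<And>x. x \<in> L \<Longrightarrow> d x \<noteq> 0" "\<And>x. x \<in> L' \<Longrightarrow> d' x \<noteq> 0"
    and eq: "\<And>j::nat. j \<le> 5 \<Longrightarrow>
      (\<Sum>x\<in>L. d x * (1 - exp (x * complex_of_real (real j * \<Delta>)))) =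
      (\<Sum>x\<in>L'. d' x * (1 - exp (x * complex_of_real (real j * \<Delta>))))"
  shows "L' = L \<and> (\<forall>x\<in>L. d' x = d x)"
proof -
  define S e where "S = L \<union> L'" and "e x = exp (x * complex_of_real \<Delta>)" for x
  define w where "w x = (if x \<in> L then d x else 0) - (if x \<in> L' then d' x else 0)" for x
  have e_pow: "exp (x * complex_of_real (real j * \<Delta>)) = e x ^ j" for x j
    unfolding e_def by (simp add: exp_of_nat_mult[symmetric] ac_simps)
  have w: "w x = 0" if "x \<in> S" for x
  proof (rule exponential_coefficients_zero[OF _ _ _ _ _ that])
    show "finite S" using fin by (simp add: S_def)
    show "card S \<le> 4" using card_Un_le[of L L'] card by (simp add: S_def)
    show "inj_on e S"
      unfolding inj_on_def e_def using strip exp_inj_on_strip[OF \<open>\<Delta> > 0\<close>] S_def by blast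
    \<comment> \<open>A strictly negative real part puts the node strictly inside the unit circle,
      hence away from the node 1 of the constant.\<close>
    show "e y \<noteq> 1" if "y \<in> S" for y
    proof
      assume "e y = 1"
      then have "norm (e y) = 1" by simp
      then show False
        using strip[of y] that \<open>\<Delta> > 0\<close> by (simp add: e_def S_def)
    qed
    show "(\<Sum>x\<in>S. w x * (1 - e x ^ j)) = 0" if "j \<le> 5" for j
    proof -
      have "(\<Sum>x\<in>S. w x * (1 - e x ^ j)) =
          (\<Sum>x\<in>S. if x \<in> L then d x * (1 - e x ^ j) else 0) -
          (\<Sum>x\<in>S. if x \<in> L' then d' x * (1 - e x ^ j) else 0)"
        unfolding w_def sum_subtractf[symmetric] by (intro sum.cong) (auto simp: algebra_simps)
      also have "\<dots> = (\<Sum>x\<in>L. d x * (1 - e x ^ j)) - (\<Sum>x\<in>L'. d' x * (1 - e x ^ j))"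
        using fin by (simp add: sum.inter_restrict[symmetric] S_def Int_absorb1)
      finally show ?thesis using eq[OF that] unfolding e_pow by simp
    qed
  qed
  \<comment> \<open>On an exponent occurring on one side only, \<open>w\<close> is up to sign the
    coefficient of that side, which is nonzero. So no exponent is unmatched.\<close>
  have "x \<in> L \<longleftrightarrow> x \<in> L'" for x
    using w[of x] nz[of x] by (auto simp: S_def w_def split: if_splits)
  then show ?thesis
    using w by (auto simp: S_def w_def)
qed

section \<open>Characteristic functions of simple integrals\<close>

text \<open>The drift and the compensator are purely imaginary and disappear from the real part. The
  remaining integrand is quadratic near 0 and bounded, hence integrable for a Levy measure.\<close>

definition jump_symbol :: "real \<Rightarrow> real measure \<Rightarrow> real \<Rightarrow> real" where
  "jump_symbol \<sigma>2 \<nu> u = \<sigma>2 * u\<^sup>2 / 2 + (\<integral>z. (1 - cos (u * z)) \<partial>\<nu>)"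

lemma one_minus_cos_le: "1 - cos x \<le> x\<^sup>2 / 2" for x :: real
proof -
  have "(sin (x / 2))\<^sup>2 \<le> (x / 2)\<^sup>2"
    using abs_sin_x_le_abs_x[of "x / 2"] by (simp only: abs_le_square_iff)
  then show ?thesis
    using cos_double_sin[of "x / 2"] by (simp add: power_divide)
qed

text \<open>Write \<open>1 - cos t\<close> as \<open>2 * (sin (t / 2))^2\<close> and use the
  weighted inequality between geometric and arithmetic mean. A small \<open>r\<close> keeps the
  factor of the first term near 1, at the price of a large factor on the second one, which is going
  to be an error term.\<close>

lemma one_minus_cos_add_le:
  fixes x y r :: real
  assumes "r > 0"
  shows "1 - cos (x + y) \<le> (1 + r) * (1 - cos x) + (1 + 1 / r) * (1 - cos y)"
proof -
  have sq: "1 - cos t = 2 * (sin (t / 2))\<^sup>2" for t :: real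
    using cos_double_sin[of "t / 2"] by simp
  have "\<bar>sin ((x + y) / 2)\<bar> \<le> \<bar>sin (x / 2)\<bar> * \<bar>cos (y / 2)\<bar> + \<bar>cos (x / 2)\<bar> * \<bar>sin (y / 2)\<bar>"
    unfolding add_divide_distrib sin_add by (simp flip: abs_mult)
  also have "\<dots> \<le> \<bar>sin (x / 2)\<bar> * 1 + 1 * \<bar>sin (y / 2)\<bar>"
    by (intro add_mono mult_mono) auto
  finally have "\<bar>sin ((x + y) / 2)\<bar> \<le> \<bar>\<bar>sin (x / 2)\<bar> + \<bar>sin (y / 2)\<bar>\<bar>" by simp
  then have "(sin ((x + y) / 2))\<^sup>2 \<le> (\<bar>sin (x / 2)\<bar> + \<bar>sin (y / 2)\<bar>)\<^sup>2"
    by (simp only: abs_le_square_iff)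
  also have "\<dots> \<le> (1 + r) * (sin (x / 2))\<^sup>2 + (1 + 1 / r) * (sin (y / 2))\<^sup>2"
  proof -
    have "0 \<le> (r * \<bar>sin (x / 2)\<bar> - \<bar>sin (y / 2)\<bar>)\<^sup>2 / r" using assms by simp
    also have "\<dots> = r * \<bar>sin (x / 2)\<bar>\<^sup>2 + \<bar>sin (y / 2)\<bar>\<^sup>2 / r - 2 * \<bar>sin (x / 2)\<bar> * \<bar>sin (y / 2)\<bar>"
      using assms by (simp add: power2_eq_square field_simps)
    finally show ?thesis by (simp add: power2_sum algebra_simps)
  qed
  finally show ?thesis by (simp add: sq algebra_simps)
qed

lemma square_add_le:
  fixes x y r :: real
  assumes "r > 0"
  shows "(x + y)\<^sup>2 \<le> (1 + r) * x\<^sup>2 + (1 + 1 / r) * y\<^sup>2"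
proof -
  have "0 \<le> (r * x - y)\<^sup>2 / r" using assms by simp
  also have "\<dots> = r * x\<^sup>2 + y\<^sup>2 / r - 2 * x * y"
    using assms by (simp add: power2_eq_square field_simps)
  finally show ?thesis by (simp add: power2_sum algebra_simps)
qed

text \<open>Turns a quadratic bound near 0 and a constant bound elsewhere into domination by the
  function whose integrability characterises Levy measures.\<close>

lemma le_min_one_square:
  fixes t u z :: real
  assumes "\<bar>z\<bar> < 1 \<Longrightarrow> t \<le> (u * z)\<^sup>2 / 2" and "\<bar>z\<bar> \<ge> 1 \<Longrightarrow> t \<le> 2"
  shows "t \<le> (2 + u\<^sup>2) * min 1 (z\<^sup>2)"
proof (cases "\<bar>z\<bar> < 1")
  case True
  then have "z\<^sup>2 \<le> 1" by (simp add: abs_square_le_1)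
  have "(u * z)\<^sup>2 / 2 \<le> 2 * z\<^sup>2 + u\<^sup>2 * z\<^sup>2"
    using zero_le_power2[of "u * z"] zero_le_power2[of z]
    unfolding power_mult_distrib by linarith
  with \<open>z\<^sup>2 \<le> 1\<close> show ?thesis using assms(1)[OF True] by (simp add: min_def distrib_right)
next
  case False
  then have "1 \<le> z\<^sup>2" using abs_le_square_iff[of 1 z] by simp
  then show ?thesis using assms(2) False zero_le_power2[of u]
    by (simp add: min_def add_increasing2 del: zero_le_power2)
qed

section \<open>Characteristic functions of linear combinations of basis values\<close>

context homogeneous_levy_basis
begin

abbreviation "q \<equiv> jump_symbol \<sigma>2 \<nu>"

lemma sets_jump_measure [measurable_cong, simp]: "sets \<nu> = sets borel"
  using jump_measure by (simp add: levy_measure_def)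

lemma space_jump_measure [simp]: "space \<nu> = UNIV"
  using sets_eq_imp_space_eq[OF sets_jump_measure] by simp

lemma integrable_min_one_square: "integrable \<nu> (\<lambda>z. min 1 (z\<^sup>2))"
  using jump_measure by (intro integrableI_nonneg) (auto simp: levy_measure_def)

lemma integrable_one_minus_cos: "integrable \<nu> (\<lambda>z. 1 - cos (u * z))"
proof (rule Bochner_Integration.integrable_bound)
  show "integrable \<nu> (\<lambda>z. (2 + u\<^sup>2) * min 1 (z\<^sup>2))"
    using integrable_min_one_square by simp
  show "AE z in \<nu>. norm (1 - cos (u * z)) \<le> norm ((2 + u\<^sup>2) * min 1 (z\<^sup>2))"
  proof (rule AE_I2)
    fix z
    have "1 - cos (u * z) \<le> (2 + u\<^sup>2) * min 1 (z\<^sup>2)"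
      using one_minus_cos_le[of "u * z"] cos_ge_minus_one[of "u * z"]
      by (intro le_min_one_square) linarith+
    then show "norm (1 - cos (u * z)) \<le> norm ((2 + u\<^sup>2) * min 1 (z\<^sup>2))"
      by (simp add: abs_mult)
  qed
qed simp

lemma Re_levy_khintchine_exponent: "Re (levy_khintchine_exponent \<beta> \<sigma>2 \<nu> u) = - q u"
proof -
  let ?f = "\<lambda>z. iexp (u * z) - 1 - \<i> * complex_of_real (u * z * indicator {z. \<bar>z\<bar> < 1} z)"
  have "integrable \<nu> ?f"
  proof (rule Bochner_Integration.integrable_bound)
    show "integrable \<nu> (\<lambda>z. (2 + u\<^sup>2) * min 1 (z\<^sup>2))"
      using integrable_min_one_square by simp
    show "?f \<in> borel_measurable \<nu>" by measurable
    show "AE z in \<nu>. norm (?f z) \<le> norm ((2 + u\<^sup>2) * min 1 (z\<^sup>2))"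
    proof (rule AE_I2)
      fix z
      have "norm (?f z) \<le> (2 + u\<^sup>2) * min 1 (z\<^sup>2)"
      proof (rule le_min_one_square)
        assume "\<bar>z\<bar> < 1"
        then show "norm (?f z) \<le> (u * z)\<^sup>2 / 2"
          using iexp_approx1[of "u * z" 1] by (simp add: algebra_simps numeral_2_eq_2)
      next
        assume "\<bar>z\<bar> \<ge> 1"
        then show "norm (?f z) \<le> 2"
          using norm_triangle_ineq4[of "iexp (u * z)" 1] by simp
      qed
      then show "norm (?f z) \<le> norm ((2 + u\<^sup>2) * min 1 (z\<^sup>2))" by simp
    qed
  qed
  then have "Re (\<integral>z. ?f z \<partial>\<nu>) = (\<integral>z. Re (?f z) \<partial>\<nu>)" by (rule integral_Re[symmetric])
  also have "\<dots> = (\<integral>z. - (1 - cos (u * z)) \<partial>\<nu>)"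
    by (intro Bochner_Integration.integral_cong) (auto simp: Re_exp)
  finally show ?thesis
    by (simp add: levy_khintchine_exponent_def jump_symbol_def del: minus_diff_eq)
qed

lemma norm_char_basis:
  assumes "B \<in> bounded_borel"
  shows "norm (CLINT \<omega>|M. iexp (u * \<Lambda> B \<omega>)) = exp (- measure lborel B * q u)"
  using characteristic_function[OF assms] by (simp add: Re_levy_khintchine_exponent)

text \<open>The constant sequence of empty sets is a disjoint family, and a series with constant
  terms converges only if they are 0.\<close>

lemma basis_empty: "AE \<omega> in M. \<Lambda> {} \<omega> = 0"
proof -
  have "AE \<omega> in M. (\<lambda>n::nat. \<Lambda> {} \<omega>) sums \<Lambda> (\<Union>n::nat. {}) \<omega>"
    by (rule countably_additive_basis) (auto simp: bounded_borel_def disjoint_family_on_def)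
  then show ?thesis
    by eventually_elim (auto dest!: sums_summable simp: summable_const_iff)
qed

lemma bounded_borel_finite_Union:
  "finite K \<Longrightarrow> (\<And>k. k \<in> K \<Longrightarrow> B k \<in> bounded_borel) \<Longrightarrow> (\<Union>k\<in>K. B k) \<in> bounded_borel"
  by (auto simp: bounded_borel_def bounded_UN)

lemma finite_family_extension:
  fixes B :: "'k \<Rightarrow> 's set"
  assumes "finite K" "\<And>k. k \<in> K \<Longrightarrow> B k \<in> bounded_borel" "disjoint_family_on B K"
  obtains A :: "nat \<Rightarrow> 's set" and h :: "'k \<Rightarrow> nat"
  where "range A \<subseteq> bounded_borel" "disjoint_family A" "inj_on h K"
    "\<And>k. k \<in> K \<Longrightarrow> A (h k) = B k" "\<And>n. n \<notin> h ` K \<Longrightarrow> A n = {}"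
proof -
  obtain h :: "'k \<Rightarrow> nat" where h: "inj_on h K"
    using finite_imp_inj_to_nat_seg[OF \<open>finite K\<close>] by blast
  define A where "A n = (if n \<in> h ` K then B (the_inv_into K h n) else {})" for n
  have 1: "A (h k) = B k" if "k \<in> K" for k
    using that h by (simp add: A_def the_inv_into_f_f)
  have 2: "A n = {}" if "n \<notin> h ` K" for n using that by (simp add: A_def)
  have "A n \<in> bounded_borel" for n
    using 1 2[of n] assms(2) by (cases "n \<in> h ` K") (auto simp: bounded_borel_def)
  moreover have "A m \<inter> A n = {}" if "m \<noteq> n" for m n
  proof (cases "m \<in> h ` K \<and> n \<in> h ` K")
    case True
    then obtain k l where kl: "k \<in> K" "l \<in> K" "m = h k" "n = h l" by auto
    then have "k \<noteq> l" using that by auto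
    then show ?thesis using 1 kl assms(3) by (auto simp: disjoint_family_on_def)
  qed (use 2 in auto)
  ultimately show ?thesis
    using that[of A h] h 1 2 by (auto simp: disjoint_family_on_def)
qed

lemma finitely_additive_basis:
  fixes B :: "'k \<Rightarrow> 's set"
  assumes K: "finite K" "\<And>k. k \<in> K \<Longrightarrow> B k \<in> bounded_borel" "disjoint_family_on B K"
  shows "AE \<omega> in M. \<Lambda> (\<Union>k\<in>K. B k) \<omega> = (\<Sum>k\<in>K. \<Lambda> (B k) \<omega>)"
proof -
  obtain A and h :: "'k \<Rightarrow> nat" where A: "range A \<subseteq> bounded_borel" "disjoint_family A" "inj_on h K"
    "\<And>k. k \<in> K \<Longrightarrow> A (h k) = B k" "\<And>n. n \<notin> h ` K \<Longrightarrow> A n = {}"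
    using finite_family_extension[OF K] by blast
  have Un: "(\<Union>n. A n) = (\<Union>k\<in>K. B k)"
  proof
    show "(\<Union>n. A n) \<subseteq> (\<Union>k\<in>K. B k)"
    proof
      fix x assume "x \<in> (\<Union>n. A n)"
      then obtain n where n: "x \<in> A n" by auto
      then have "n \<in> h ` K" using A(5)[of n] by auto
      then show "x \<in> (\<Union>k\<in>K. B k)" using n A(4) by auto
    qed
    show "(\<Union>k\<in>K. B k) \<subseteq> (\<Union>n. A n)" using A(4) by blast
  qed
  have "AE \<omega> in M. (\<lambda>n. \<Lambda> (A n) \<omega>) sums \<Lambda> (\<Union>n. A n) \<omega>"
    using A bounded_borel_finite_Union[OF K(1,2)] by (intro countably_additive_basis) (auto simp: Un)
  with basis_empty show ?thesis
  proof eventually_elim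
    fix \<omega> assume 0: "\<Lambda> {} \<omega> = 0" and s: "(\<lambda>n. \<Lambda> (A n) \<omega>) sums \<Lambda> (\<Union>n. A n) \<omega>"
    have "(\<lambda>n. \<Lambda> (A n) \<omega>) sums (\<Sum>n\<in>h ` K. \<Lambda> (A n) \<omega>)"
      using 0 A(5) K(1) by (intro sums_finite) auto
    then have "\<Lambda> (\<Union>n. A n) \<omega> = (\<Sum>n\<in>h ` K. \<Lambda> (A n) \<omega>)"
      using s sums_unique2 by blast
    then show "\<Lambda> (\<Union>k\<in>K. B k) \<omega> = (\<Sum>k\<in>K. \<Lambda> (B k) \<omega>)"
      using A(3,4) by (simp add: Un sum.reindex)
  qed
qed

text \<open>Independence over disjoint sets factorises the characteristic function. The unimodular
  part of each factor, which contains the drift, is lost in the norm.\<close>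

lemma norm_char_linear_combination:
  fixes B :: "'k \<Rightarrow> 's set"
  assumes K: "finite K" "\<And>k. k \<in> K \<Longrightarrow> B k \<in> bounded_borel" "disjoint_family_on B K"
  shows "norm (CLINT \<omega>|M. iexp (u * (\<Sum>k\<in>K. c k * \<Lambda> (B k) \<omega>))) =
    exp (- (\<Sum>k\<in>K. measure lborel (B k) * q (u * c k)))"
proof -
  obtain A and h :: "'k \<Rightarrow> nat" where A: "range A \<subseteq> bounded_borel" "disjoint_family A" "inj_on h K"
    "\<And>k. k \<in> K \<Longrightarrow> A (h k) = B k" "\<And>n. n \<notin> h ` K \<Longrightarrow> A n = {}"
    using finite_family_extension[OF K] by blast
  have [measurable]: "random_variable borel (\<Lambda> (A n))" for n
    using A(1) random_variable_basis by blast
  define c' where "c' n = c (the_inv_into K h n)" for n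
  have c': "c' (h k) = c k" if "k \<in> K" for k
    using that A(3) by (simp add: c'_def the_inv_into_f_f)
  have char: "char (distr M borel X) t = (CLINT \<omega>|M. iexp (t * X \<omega>))"
    if "random_variable borel X" for X t
    using that by (simp add: char_def integral_distr)
  have "indep_vars (\<lambda>_. borel) (\<lambda>n. \<Lambda> (A n)) (h ` K)"
    by (rule indep_vars_subset[OF independently_scattered[OF A(1,2)]]) simp
  then have "indep_vars (\<lambda>_. borel) (\<lambda>n \<omega>. c' n * \<Lambda> (A n) \<omega>) (h ` K)"
    by (rule indep_vars_compose2[where Y="\<lambda>n x. c' n * x"]) simp
  note char_distr_sum[OF this, of u]
  then have "(CLINT \<omega>|M. iexp (u * (\<Sum>n\<in>h ` K. c' n * \<Lambda> (A n) \<omega>))) =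
      (\<Prod>n\<in>h ` K. CLINT \<omega>|M. iexp (u * (c' n * \<Lambda> (A n) \<omega>)))"
    by (simp add: char)
  also have "(\<lambda>\<omega>. \<Sum>n\<in>h ` K. c' n * \<Lambda> (A n) \<omega>) = (\<lambda>\<omega>. \<Sum>k\<in>K. c k * \<Lambda> (B k) \<omega>)"
    using A(3,4) c' by (simp add: sum.reindex)
  also have "(\<Prod>n\<in>h ` K. CLINT \<omega>|M. iexp (u * (c' n * \<Lambda> (A n) \<omega>))) =
      (\<Prod>k\<in>K. CLINT \<omega>|M. iexp (u * c k * \<Lambda> (B k) \<omega>))"
    using A(3,4) c' by (simp add: prod.reindex mult.assoc)
  finally have "norm (CLINT \<omega>|M. iexp (u * (\<Sum>k\<in>K. c k * \<Lambda> (B k) \<omega>))) =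
      (\<Prod>k\<in>K. exp (- measure lborel (B k) * q (u * c k)))"
    using K(2) by (simp only: prod_norm[symmetric]) (intro prod.cong refl norm_char_basis)
  also have "\<dots> = exp (\<Sum>k\<in>K. - measure lborel (B k) * q (u * c k))"
    by (simp only: exp_sum K(1))
  finally show ?thesis by (simp add: sum_negf)
qed

end

section \<open>Integrals of simple functions over the whole space\<close>

definition simple_integral :: "('s::euclidean_space set \<Rightarrow> 'w \<Rightarrow> real) \<Rightarrow> ('s \<Rightarrow> real) \<Rightarrow> 'w \<Rightarrow> real" where
  "simple_integral \<Lambda> f = simple_stochastic_integral \<Lambda> f UNIV"

lemma simple_integrand_borel_measurable:
  "simple_integrand f \<Longrightarrow> f \<in> borel_measurable borel"
  by (auto simp: simple_integrand_def intro: borel_measurable_simple_function)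

lemma simple_integrand_finite_range: "simple_integrand f \<Longrightarrow> finite (range f)"
  by (simp add: simple_integrand_def simple_function_def)

lemma simple_integrand_vimage:
  assumes "simple_integrand f" "y \<noteq> 0"
  shows "f -` {y} \<in> bounded_borel"
proof -
  have "f -` {y} \<in> sets borel"
    by (rule measurable_sets_borel[OF simple_integrand_borel_measurable[OF assms(1)]]) simp
  moreover have "bounded (f -` {y})"
    by (rule bounded_subset[of "{s. f s \<noteq> 0}"]) (use assms in \<open>auto simp: simple_integrand_def\<close>)
  ultimately show ?thesis by (simp add: bounded_borel_def)
qed

lemma simple_integrand_diff:
  assumes "simple_integrand f" "simple_integrand g"
  shows "simple_integrand (\<lambda>s. f s - g s)"
proof -
  have "bounded {s. f s - g s \<noteq> 0}"
    by (rule bounded_subset[of "{s. f s \<noteq> 0} \<union> {s. g s \<noteq> 0}"])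
      (use assms in \<open>auto simp: simple_integrand_def\<close>)
  then show ?thesis
    using assms by (auto simp: simple_integrand_def)
qed

lemma emeasure_bounded_borel: "B \<in> bounded_borel \<Longrightarrow> emeasure lborel B < \<infinity>"
  using emeasure_bounded_finite[of B] by (simp add: bounded_borel_def)

context homogeneous_levy_basis
begin

text \<open>The integral is defined through the level sets of the integrand, and those of a
  difference are unrelated to those of its terms. Finite additivity allows any partition on whose
  blocks the integrand is constant, even if several blocks share a value; equality then holds almost
  surely.\<close>

lemma simple_integral_partition:
  fixes B :: "'k \<Rightarrow> 's set"
  assumes K: "finite K" "\<And>k. k \<in> K \<Longrightarrow> B k \<in> bounded_borel" "disjoint_family_on B K"
    and f: "\<And>k s. k \<in> K \<Longrightarrow> s \<in> B k \<Longrightarrow> f s = c k"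
    and f0: "\<And>s. s \<notin> (\<Union>k\<in>K. B k) \<Longrightarrow> f s = 0"
  shows "AE \<omega> in M. simple_integral \<Lambda> f \<omega> = (\<Sum>k\<in>K. c k * \<Lambda> (B k) \<omega>)"
proof -
  \<comment> \<open>The value assigned to an empty block need not be a value of \<open>f\<close>, so
    empty blocks have to be removed before values and blocks are matched.\<close>
  define K' where "K' = {k \<in> K. B k \<noteq> {}}"
  define R where "R = range f - {0}"
  have fin: "finite K'" using K(1) by (simp add: K'_def)
  have R: "R = c ` K' - {0}"
  proof
    show "R \<subseteq> c ` K' - {0}"
    proof
      fix y assume "y \<in> R"
      then obtain s where s: "y = f s" "y \<noteq> 0" by (auto simp: R_def)
      then obtain k where "k \<in> K" "s \<in> B k" using f0 by blast
      then show "y \<in> c ` K' - {0}" using s f by (auto simp: K'_def)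
    qed
    show "c ` K' - {0} \<subseteq> R"
    proof
      fix y assume "y \<in> c ` K' - {0}"
      then obtain k s where "y = c k" "y \<noteq> 0" "k \<in> K" "s \<in> B k" by (auto simp: K'_def)
      then show "y \<in> R" using f[of k s] rangeI[of f s] by (simp add: R_def)
    qed
  qed
  have level: "f -` {y} = (\<Union>k\<in>{k \<in> K'. c k = y}. B k)" if "y \<noteq> 0" for y
  proof (intro set_eqI iffI)
    fix s assume "s \<in> f -` {y}"
    then have "f s = y" "f s \<noteq> 0" using that by auto
    then obtain k where "k \<in> K" "s \<in> B k" using f0 by blast
    then show "s \<in> (\<Union>k\<in>{k \<in> K'. c k = y}. B k)"
      using \<open>f s = y\<close> f[of k s] by (auto simp: K'_def)
  next
    fix s assume "s \<in> (\<Union>k\<in>{k \<in> K'. c k = y}. B k)"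
    then obtain k where "k \<in> K" "s \<in> B k" "c k = y" by (auto simp: K'_def)
    then show "s \<in> f -` {y}" using f[of k s] by simp
  qed
  have "AE \<omega> in M. \<forall>y\<in>R. \<Lambda> (f -` {y}) \<omega> = (\<Sum>k\<in>{k \<in> K'. c k = y}. \<Lambda> (B k) \<omega>)"
  proof (rule AE_finite_allI)
    show "finite R" unfolding R using fin by simp
    fix y assume "y \<in> R"
    then have y: "y \<noteq> 0" by (simp add: R_def)
    show "AE \<omega> in M. \<Lambda> (f -` {y}) \<omega> = (\<Sum>k\<in>{k \<in> K'. c k = y}. \<Lambda> (B k) \<omega>)"
      unfolding level[OF y] using K fin
      by (intro finitely_additive_basis) (auto simp: K'_def disjoint_family_on_def)
  qed
  moreover have "AE \<omega> in M. \<forall>k\<in>K - K'. \<Lambda> (B k) \<omega> = 0"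
  proof -
    have empty: "B k = {}" if "k \<in> K - K'" for k using that by (auto simp: K'_def)
    show ?thesis using basis_empty by eventually_elim (simp add: empty)
  qed
  ultimately show ?thesis
  proof eventually_elim
    fix \<omega> assume 1: "\<forall>y\<in>R. \<Lambda> (f -` {y}) \<omega> = (\<Sum>k\<in>{k \<in> K'. c k = y}. \<Lambda> (B k) \<omega>)"
      and 2: "\<forall>k\<in>K - K'. \<Lambda> (B k) \<omega> = 0"
    have "simple_integral \<Lambda> f \<omega> = (\<Sum>y\<in>c ` K' - {0}. y * \<Lambda> (f -` {y}) \<omega>)"
      by (simp only: R[symmetric] R_def) (simp add: simple_integral_def simple_stochastic_integral_def)
    also have "\<dots> = (\<Sum>y\<in>c ` K' - {0}. \<Sum>k\<in>{k \<in> K'. c k = y}. c k * \<Lambda> (B k) \<omega>)"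
      using 1 unfolding R by (intro sum.cong refl) (simp add: sum_distrib_left)
    also have "\<dots> = (\<Sum>y\<in>c ` K'. \<Sum>k\<in>{k \<in> K'. c k = y}. c k * \<Lambda> (B k) \<omega>)"
      using fin by (intro sum.mono_neutral_left) auto
    also have "\<dots> = (\<Sum>k\<in>K'. c k * \<Lambda> (B k) \<omega>)"
      using fin by (rule sum.image_gen[symmetric])
    also have "\<dots> = (\<Sum>k\<in>K. c k * \<Lambda> (B k) \<omega>)"
      using 2 K(1) by (intro sum.mono_neutral_left) (auto simp: K'_def)
    finally show "simple_integral \<Lambda> f \<omega> = (\<Sum>k\<in>K. c k * \<Lambda> (B k) \<omega>)" .
  qed
qed

lemma simple_integral_measurable:
  assumes "simple_integrand f"
  shows "random_variable borel (simple_integral \<Lambda> f)"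
  unfolding simple_integral_def simple_stochastic_integral_def
  by (intro borel_measurable_sum borel_measurable_times borel_measurable_const)
    (simp add: random_variable_basis simple_integrand_vimage[OF assms])

lemma simple_integral_diff:
  assumes f: "simple_integrand f" and g: "simple_integrand g"
  shows "AE \<omega> in M. simple_integral \<Lambda> (\<lambda>s. f s - g s) \<omega> = simple_integral \<Lambda> f \<omega> - simple_integral \<Lambda> g \<omega>"
proof -
  \<comment> \<open>Common refinement of the two families of level sets. The pair
    \<open>(0, 0)\<close> is left out because its block is the only unbounded one.\<close>
  define K where "K = range f \<times> range g - {(0, 0)}"
  define B where "B = (\<lambda>(y, z). f -` {y} \<inter> g -` {z})"
  have fin: "finite K" and disj: "disjoint_family_on B K"
    using simple_integrand_finite_range[OF f] simple_integrand_finite_range[OF g]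
    by (auto simp: K_def B_def disjoint_family_on_def)
  have bb: "B k \<in> bounded_borel" if "k \<in> K" for k
  proof -
    define y z where "y = fst k" and "z = snd k"
    have k: "k = (y, z)" by (simp add: y_def z_def)
    have yz: "y \<noteq> 0 \<or> z \<noteq> 0" using that by (auto simp: K_def k)
    have "f -` {y} \<in> sets borel" "g -` {z} \<in> sets borel"
      using measurable_sets_borel[OF simple_integrand_borel_measurable[OF f], of "{y}"]
        measurable_sets_borel[OF simple_integrand_borel_measurable[OF g], of "{z}"] by auto
    moreover have "bounded (f -` {y} \<inter> g -` {z})"
      using yz simple_integrand_vimage[OF f, of y] simple_integrand_vimage[OF g, of z]
      by (auto simp: bounded_borel_def bounded_Int)
    ultimately show ?thesis by (simp add: bounded_borel_def B_def k)
  qed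
  note K = fin bb disj
  have cover: "f s = 0" "g s = 0" if "s \<notin> (\<Union>k\<in>K. B k)" for s
    using that
    by (auto simp: K_def B_def)
  have level: "s \<in> B k \<Longrightarrow> f s = fst k" "s \<in> B k \<Longrightarrow> g s = snd k" for s k
    by (auto simp: B_def split: prod.splits)
  have "AE \<omega> in M. simple_integral \<Lambda> f \<omega> = (\<Sum>k\<in>K. fst k * \<Lambda> (B k) \<omega>)"
    using level(1) cover(1) by (intro simple_integral_partition[OF K])
  moreover have "AE \<omega> in M. simple_integral \<Lambda> g \<omega> = (\<Sum>k\<in>K. snd k * \<Lambda> (B k) \<omega>)"
    using level(2) cover(2) by (intro simple_integral_partition[OF K])
  moreover have "AE \<omega> in M. simple_integral \<Lambda> (\<lambda>s. f s - g s) \<omega> = (\<Sum>k\<in>K. (fst k - snd k) * \<Lambda> (B k) \<omega>)"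
  proof (rule simple_integral_partition[OF K])
    show "f s - g s = fst k - snd k" if "s \<in> B k" for k s
      using level[OF that] by simp
    show "f s - g s = 0" if "s \<notin> (\<Union>k\<in>K. B k)" for s
      using cover[OF that] by simp
  qed
  ultimately show ?thesis
    by eventually_elim (simp add: sum_subtractf left_diff_distrib)
qed

lemma jump_symbol_0 [simp]: "q 0 = 0"
  by (simp add: jump_symbol_def)

lemma jump_symbol_nonneg: "0 \<le> q u"
  unfolding jump_symbol_def using gaussian_variance by (intro add_nonneg_nonneg integral_nonneg) auto

lemma norm_char_simple_integral:
  assumes f: "simple_integrand f"
  shows "(\<integral>\<^sup>+ s. ennreal (q (u * f s)) \<partial>lborel) < \<infinity>"
    and "norm (CLINT \<omega>|M. iexp (u * simple_integral \<Lambda> f \<omega>)) =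
      exp (- enn2real (\<integral>\<^sup>+ s. ennreal (q (u * f s)) \<partial>lborel))"
proof -
  \<comment> \<open>The level set of 0 has infinite measure and lies outside the domain of the
    basis; it contributes nothing to the integral because \<open>q 0 = 0\<close>.\<close>
  define K where "K = range f - {0}"
  have K: "finite K" "\<And>k. k \<in> K \<Longrightarrow> f -` {k} \<in> bounded_borel" "disjoint_family_on (\<lambda>k. f -` {k}) K"
    using simple_integrand_finite_range[OF f] simple_integrand_vimage[OF f]
    by (auto simp: K_def disjoint_family_on_def)
  have level_sets [measurable]: "f -` {k} \<in> sets borel" if "k \<in> K" for k
    using K(2)[OF that] by (simp add: bounded_borel_def)
  have "ennreal (q (u * f s)) = (\<Sum>k\<in>K. ennreal (q (u * k)) * indicator (f -` {k}) s)" for s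
  proof (cases "f s = 0")
    case True
    then have "(\<Sum>k\<in>K. ennreal (q (u * k)) * indicator (f -` {k}) s) = 0"
      by (intro sum.neutral) (auto simp: K_def)
    then show ?thesis using True by simp
  next
    case False
    then show ?thesis
      using K(1) by (subst sum.remove[of _ "f s"]) (auto simp: K_def indicator_def intro!: sum.neutral)
  qed
  then have "(\<lambda>s. ennreal (q (u * f s))) = (\<lambda>s. \<Sum>k\<in>K. ennreal (q (u * k)) * indicator (f -` {k}) s)"
    by (rule ext)
  then have "(\<integral>\<^sup>+ s. ennreal (q (u * f s)) \<partial>lborel) = (\<integral>\<^sup>+ s. (\<Sum>k\<in>K. ennreal (q (u * k)) * indicator (f -` {k}) s) \<partial>lborel)"
    by simp
  also have "\<dots> = (\<Sum>k\<in>K. \<integral>\<^sup>+ s. ennreal (q (u * k)) * indicator (f -` {k}) s \<partial>lborel)"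
    using level_sets by (intro nn_integral_sum) simp
  also have "\<dots> = (\<Sum>k\<in>K. ennreal (q (u * k)) * emeasure lborel (f -` {k}))"
    using level_sets by (intro sum.cong refl nn_integral_cmult_indicator) simp
  also have "\<dots> = (\<Sum>k\<in>K. ennreal (measure lborel (f -` {k}) * q (u * k)))"
    using emeasure_bounded_borel[OF K(2)]
    by (intro sum.cong refl) (simp add: emeasure_eq_ennreal_measure ennreal_mult'' mult.commute less_top)
  also have "\<dots> = ennreal (\<Sum>k\<in>K. measure lborel (f -` {k}) * q (u * k))"
    by (simp add: jump_symbol_nonneg)
  finally have *: "(\<integral>\<^sup>+ s. ennreal (q (u * f s)) \<partial>lborel) = ennreal (\<Sum>k\<in>K. measure lborel (f -` {k}) * q (u * k))" .
  then show "(\<integral>\<^sup>+ s. ennreal (q (u * f s)) \<partial>lborel) < \<infinity>" by simp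
  have "(\<lambda>\<omega>. \<Sum>k\<in>K. k * \<Lambda> (f -` {k}) \<omega>) = simple_integral \<Lambda> f"
    by (simp add: simple_integral_def simple_stochastic_integral_def K_def fun_eq_iff)
  then show "norm (CLINT \<omega>|M. iexp (u * simple_integral \<Lambda> f \<omega>)) =
      exp (- enn2real (\<integral>\<^sup>+ s. ennreal (q (u * f s)) \<partial>lborel))"
    using norm_char_linear_combination[OF K, of u "\<lambda>k. k"]
    by (simp add: * sum_nonneg jump_symbol_nonneg fun_eq_iff)
qed

end

section \<open>Second moments from characteristic functions\<close>

text \<open>Second order expansion of the cosine along \<open>1 / Suc n\<close>; a sequence is what
  Fatou's lemma and dominated convergence require.\<close>

lemma one_minus_cos_scaled_limit:
  fixes x :: real
  shows "(\<lambda>n. (real (Suc n))\<^sup>2 * (1 - cos (x / real (Suc n)))) \<longlonglongrightarrow> x\<^sup>2 / 2"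
proof (cases "x = 0")
  case False
  have lim: "((\<lambda>t::real. (1 - cos t) / t\<^sup>2) \<longlongrightarrow> 1 / 2) (at 0)"
    by real_asymp
  have "filterlim (\<lambda>n. x / real (Suc n)) (at 0) sequentially"
    using False by (intro filterlim_atI LIMSEQ_Suc lim_const_over_n) auto
  from filterlim_compose[OF lim this]
  have "(\<lambda>n. x\<^sup>2 * ((1 - cos (x / real (Suc n))) / (x / real (Suc n))\<^sup>2)) \<longlonglongrightarrow> x\<^sup>2 * (1 / 2)"
    by (intro tendsto_mult tendsto_const)
  moreover have "x\<^sup>2 * ((1 - cos (x / real (Suc n))) / (x / real (Suc n))\<^sup>2) =
      (real (Suc n))\<^sup>2 * (1 - cos (x / real (Suc n)))" for n
    using False by (simp add: power_divide del: of_nat_Suc)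
  ultimately show ?thesis by (simp del: of_nat_Suc)
qed simp

lemma one_minus_cos_scaled_le:
  fixes x :: real
  shows "(real (Suc n))\<^sup>2 * (1 - cos (x / real (Suc n))) \<le> x\<^sup>2 / 2"
proof -
  have "(real (Suc n))\<^sup>2 * (1 - cos (x / real (Suc n))) \<le> (real (Suc n))\<^sup>2 * ((x / real (Suc n))\<^sup>2 / 2)"
    by (intro mult_left_mono one_minus_cos_le) simp
  also have "\<dots> = x\<^sup>2 / 2" by (simp add: power_divide del: of_nat_Suc)
  finally show ?thesis .
qed

lemma nn_integral_Fatou_bound:
  fixes f :: "'a \<Rightarrow> real"
  assumes f: "f \<in> borel_measurable M" and u[measurable]: "\<And>n. u n \<in> borel_measurable M"
    and lim: "AE x in M. (\<lambda>n. u n x) \<longlonglongrightarrow> f x"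
    and bound: "eventually (\<lambda>n. (\<integral>\<^sup>+x. ennreal (u n x) \<partial>M) \<le> C) sequentially"
  shows "(\<integral>\<^sup>+x. ennreal (f x) \<partial>M) \<le> C"
proof -
  have "(\<integral>\<^sup>+x. ennreal (f x) \<partial>M) = (\<integral>\<^sup>+x. liminf (\<lambda>n. ennreal (u n x)) \<partial>M)"
    using lim by (intro nn_integral_cong_AE) (auto elim!: eventually_mono
      intro!: lim_imp_Liminf[symmetric] tendsto_ennrealI)
  also have "\<dots> \<le> liminf (\<lambda>n. \<integral>\<^sup>+x. ennreal (u n x) \<partial>M)"
    by (rule nn_integral_liminf) simp
  also have "\<dots> \<le> C"
    using bound by (intro Liminf_le) auto
  finally show ?thesis .
qed

context prob_space
begin

text \<open>Where the variables are \<open>\<epsilon>\<close>-close the exponential is Lipschitz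
  with constant \<open>\<bar>u\<bar>\<close>; elsewhere two unimodular numbers differ by at most
  2.\<close>

lemma char_diff_le:
  assumes [measurable]: "random_variable borel X" "random_variable borel Y" and "\<epsilon> > 0"
  shows "norm ((CLINT \<omega>|M. iexp (u * X \<omega>)) - (CLINT \<omega>|M. iexp (u * Y \<omega>))) \<le>
    \<bar>u\<bar> * \<epsilon> + 2 * prob {\<omega> \<in> space M. \<bar>X \<omega> - Y \<omega>\<bar> > \<epsilon>}"
proof -
  let ?A = "{\<omega> \<in> space M. \<bar>X \<omega> - Y \<omega>\<bar> > \<epsilon>}"
  have int: "complex_integrable M (\<lambda>\<omega>. iexp (u * W \<omega>))" if [measurable]: "random_variable borel W" for W
    by (rule integrable_const_bound[where B=1]) auto
  have "norm ((CLINT \<omega>|M. iexp (u * X \<omega>)) - (CLINT \<omega>|M. iexp (u * Y \<omega>))) =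
      norm (CLINT \<omega>|M. iexp (u * X \<omega>) - iexp (u * Y \<omega>))"
    using int by (subst Bochner_Integration.integral_diff) auto
  also have "\<dots> \<le> (\<integral>\<omega>. norm (iexp (u * X \<omega>) - iexp (u * Y \<omega>)) \<partial>M)"
    by (rule integral_norm_bound)
  also have "\<dots> \<le> (\<integral>\<omega>. \<bar>u\<bar> * \<epsilon> + 2 * indicator ?A \<omega> \<partial>M)"
  proof (rule integral_mono)
    show "integrable M (\<lambda>\<omega>. norm (iexp (u * X \<omega>) - iexp (u * Y \<omega>)))"
      using int by (intro integrable_norm Bochner_Integration.integrable_diff) auto
    fix \<omega> assume "\<omega> \<in> space M"
    have "iexp (u * X \<omega>) - iexp (u * Y \<omega>) = iexp (u * Y \<omega>) * (iexp (u * (X \<omega> - Y \<omega>)) - 1)"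
      by (simp add: algebra_simps flip: exp_add)
    then have eq: "norm (iexp (u * X \<omega>) - iexp (u * Y \<omega>)) = norm (iexp (u * (X \<omega> - Y \<omega>)) - 1)"
      by (simp only: norm_mult norm_exp_i_times mult_1_left)
    show "norm (iexp (u * X \<omega>) - iexp (u * Y \<omega>)) \<le> \<bar>u\<bar> * \<epsilon> + 2 * indicator ?A \<omega>"
    proof (cases "\<bar>X \<omega> - Y \<omega>\<bar> > \<epsilon>")
      case True
      have "norm (iexp (u * X \<omega>) - iexp (u * Y \<omega>)) \<le> 1 + 1"
        using norm_triangle_ineq4[of "iexp (u * X \<omega>)" "iexp (u * Y \<omega>)"] by simp
      moreover have "0 \<le> \<bar>u\<bar> * \<epsilon>" using \<open>\<epsilon> > 0\<close> by simp
      ultimately show ?thesis using True \<open>\<omega> \<in> space M\<close> by simp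
    next
      case False
      have "norm (iexp (u * (X \<omega> - Y \<omega>)) - 1) \<le> \<bar>u * (X \<omega> - Y \<omega>)\<bar>"
        using iexp_approx1[of "u * (X \<omega> - Y \<omega>)" 0] by simp
      also have "\<dots> \<le> \<bar>u\<bar> * \<epsilon>" using False by (simp add: abs_mult mult_left_mono)
      finally have "norm (iexp (u * X \<omega>) - iexp (u * Y \<omega>)) \<le> \<bar>u\<bar> * \<epsilon>" unfolding eq .
      then show ?thesis using False by simp
    qed
  qed (intro Bochner_Integration.integrable_add integrable_mult_right integrable_const
      integrable_real_indicator; simp add: emeasure_eq_measure)
  also have "\<dots> = \<bar>u\<bar> * \<epsilon> + 2 * prob ?A"
    by (subst Bochner_Integration.integral_add)
      (simp_all add: prob_space emeasure_eq_measure)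
  finally show ?thesis .
qed

lemma char_tendsto_1:
  assumes X: "\<And>n. random_variable borel (X n)" and Z: "random_variable borel Z"
    and lim: "tendsto_in_probability M X Z" and "\<epsilon> > 0"
  obtains N where "\<And>n m. n \<ge> N \<Longrightarrow> m \<ge> N \<Longrightarrow> norm ((CLINT \<omega>|M. iexp (u * (X n \<omega> - X m \<omega>))) - 1) < \<epsilon>"
    "\<And>n. n \<ge> N \<Longrightarrow> norm ((CLINT \<omega>|M. iexp (u * X n \<omega>)) - (CLINT \<omega>|M. iexp (u * Z \<omega>))) < \<epsilon>"
proof -
  note [measurable] = X Z
  \<comment> \<open>With probabilities below \<open>\<epsilon> / 8\<close>, one comparison costs
    less than \<open>3 * \<epsilon> / 8\<close>, and two in a row stay below
    \<open>\<epsilon>\<close>. The summand 1 covers \<open>u = 0\<close>.\<close>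
  define \<delta> where "\<delta> = \<epsilon> / (8 * (\<bar>u\<bar> + 1))"
  have "\<delta> > 0" using \<open>\<epsilon> > 0\<close> by (simp add: \<delta>_def add_nonneg_pos)
  have u\<delta>: "\<bar>u\<bar> * \<delta> \<le> \<epsilon> / 8"
    using \<open>\<epsilon> > 0\<close> by (simp add: \<delta>_def field_simps mult_left_mono)
  have "(\<lambda>n. prob {\<omega> \<in> space M. \<bar>X n \<omega> - Z \<omega>\<bar> > \<delta>}) \<longlonglongrightarrow> 0"
    using lim \<open>\<delta> > 0\<close> by (simp add: tendsto_in_probability_def)
  then have "eventually (\<lambda>n. prob {\<omega> \<in> space M. \<bar>X n \<omega> - Z \<omega>\<bar> > \<delta>} < \<epsilon> / 8) sequentially"
    using \<open>\<epsilon> > 0\<close> by (intro order_tendstoD) auto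
  then obtain N where N: "\<And>n. n \<ge> N \<Longrightarrow> prob {\<omega> \<in> space M. \<bar>X n \<omega> - Z \<omega>\<bar> > \<delta>} < \<epsilon> / 8"
    by (auto simp: eventually_sequentially)
  show ?thesis
  proof (rule that)
    fix n assume n: "n \<ge> N"
    show "norm ((CLINT \<omega>|M. iexp (u * X n \<omega>)) - (CLINT \<omega>|M. iexp (u * Z \<omega>))) < \<epsilon>"
      using char_diff_le[OF X Z \<open>\<delta> > 0\<close>, where u=u, of n] N[OF n] u\<delta> \<open>\<epsilon> > 0\<close> by linarith
    fix m assume m: "m \<ge> N"
    \<comment> \<open>\<open>X n - X m\<close> is compared with \<open>Z - X m\<close>, and this
      with 0, so that each comparison changes a single term.\<close>
    have d1: "norm ((CLINT \<omega>|M. iexp (u * (X n \<omega> - X m \<omega>))) - (CLINT \<omega>|M. iexp (u * (Z \<omega> - X m \<omega>)))) \<le>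
        \<bar>u\<bar> * \<delta> + 2 * prob {\<omega> \<in> space M. \<bar>X n \<omega> - Z \<omega>\<bar> > \<delta>}"
      using char_diff_le[OF _ _ \<open>\<delta> > 0\<close>, where X="\<lambda>\<omega>. X n \<omega> - X m \<omega>" and Y="\<lambda>\<omega>. Z \<omega> - X m \<omega>" and u=u] by simp
    have d2: "norm ((CLINT \<omega>|M. iexp (u * (Z \<omega> - X m \<omega>))) - (CLINT \<omega>|M. iexp (u * 0))) \<le>
        \<bar>u\<bar> * \<delta> + 2 * prob {\<omega> \<in> space M. \<bar>X m \<omega> - Z \<omega>\<bar> > \<delta>}"
      using char_diff_le[OF _ _ \<open>\<delta> > 0\<close>, where X="\<lambda>\<omega>. Z \<omega> - X m \<omega>" and Y="\<lambda>_. 0" and u=u]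
      by (simp add: abs_minus_commute)
    have "(CLINT \<omega>|M. iexp (u * 0)) = 1" by (simp add: prob_space)
    note norm_diff_triangle_le[OF d1 d2, unfolded this]
    then show "norm ((CLINT \<omega>|M. iexp (u * (X n \<omega> - X m \<omega>))) - 1) < \<epsilon>"
      using u\<delta> N[OF n] N[OF m] \<open>\<epsilon> > 0\<close> by linarith
  qed
qed

text \<open>The second moment of the symmetrisation \<open>Z - Z'\<close> is read off from its characteristic function
  \<open>\<bar>\<phi>\<bar>\<^sup>2\<close>; no moment of \<open>Z\<close> need be assumed.\<close>

lemma variance_eq_char_limit:
  assumes Z[measurable]: "random_variable borel Z"
    and char: "\<And>n. norm (CLINT \<omega>|M. iexp (1 / real (Suc n) * Z \<omega>)) = exp (- a n)"
    and lim: "(\<lambda>n. (real (Suc n))\<^sup>2 * a n) \<longlonglongrightarrow> c / 2"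
  shows "variance Z = c"
proof -
  interpret N: pair_prob_space M M ..
  let ?N = "M \<Otimes>\<^sub>M M"
  define W where "W p = Z (fst p) - Z (snd p)" for p
  have [measurable]: "W \<in> borel_measurable ?N" unfolding W_def by measurable
  define k where "k n = 1 / real (Suc n)" for n
  have int: "integrable M (\<lambda>\<omega>. cos (t * Z \<omega>))" "integrable M (\<lambda>\<omega>. sin (t * Z \<omega>))" for t
    by (auto intro!: integrable_const_bound[where B=1])
  have sym: "(\<integral>p. cos (t * W p) \<partial>?N) = (norm (CLINT \<omega>|M. iexp (t * Z \<omega>)))\<^sup>2" for t
  proof -
    have intN: "integrable ?N (\<lambda>p. cos (t * W p))"
      by (auto intro!: N.integrable_const_bound[where B=1])
    have "complex_integrable M (\<lambda>\<omega>. iexp (t * Z \<omega>))"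
      by (rule integrable_const_bound[where B=1]) auto
    then have ReIm: "Re (CLINT \<omega>|M. iexp (t * Z \<omega>)) = (\<integral>\<omega>. cos (t * Z \<omega>) \<partial>M)"
      "Im (CLINT \<omega>|M. iexp (t * Z \<omega>)) = (\<integral>\<omega>. sin (t * Z \<omega>) \<partial>M)"
      by (simp_all add: integral_Re[symmetric] integral_Im[symmetric] Re_exp Im_exp
          del: integral_Re integral_Im)
    have "(\<integral>p. cos (t * W p) \<partial>?N) = (\<integral>x. \<integral>y. cos (t * W (x, y)) \<partial>M \<partial>M)"
      using N.integral_fst'[OF intN] by simp
    also have "\<dots> = (\<integral>x. \<integral>y. cos (t * Z x) * cos (t * Z y) + sin (t * Z x) * sin (t * Z y) \<partial>M \<partial>M)"
      by (simp add: W_def right_diff_distrib cos_diff)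
    also have "\<dots> = (\<integral>\<omega>. cos (t * Z \<omega>) \<partial>M)\<^sup>2 + (\<integral>\<omega>. sin (t * Z \<omega>) \<partial>M)\<^sup>2"
      using int by (simp add: power2_eq_square)
    finally show ?thesis unfolding cmod_power2 ReIm .
  qed
  \<comment> \<open>\<open>g n\<close> stays below \<open>W^2 / 2\<close> and converges to it, while
    its expectation is an explicit function of \<open>a n\<close>.\<close>
  define g where "g n p = (real (Suc n))\<^sup>2 * (1 - cos (W p / real (Suc n)))" for n p
  have [measurable]: "g n \<in> borel_measurable ?N" for n unfolding g_def by measurable
  have g_nonneg: "0 \<le> g n p" for n p by (simp add: g_def)
  have g_int: "integrable ?N (g n)" for n
    unfolding g_def
    by (intro integrable_mult_right Bochner_Integration.integrable_diff N.integrable_const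
        N.integrable_const_bound[where B=1]) auto
  have Eg: "(\<integral>p. g n p \<partial>?N) = (real (Suc n))\<^sup>2 * (1 - exp (- 2 * a n))" for n
  proof -
    have "integrable ?N (\<lambda>p. cos (W p / real (Suc n)))"
      by (auto intro!: N.integrable_const_bound[where B=1])
    then have "(\<integral>p. g n p \<partial>?N) = (real (Suc n))\<^sup>2 * (1 - (\<integral>p. cos (1 / real (Suc n) * W p) \<partial>?N))"
      by (simp add: g_def N.prob_space del: of_nat_Suc)
    also have "\<dots> = (real (Suc n))\<^sup>2 * (1 - (exp (- a n))\<^sup>2)"
      unfolding sym char ..
    finally show ?thesis by (simp add: power2_eq_square flip: exp_add)
  qed
  \<comment> \<open>Squeezes \<open>1 - exp (- 2 * a n)\<close> between
    \<open>2 * a n * (1 - a n)\<close> and \<open>2 * a n\<close>. The scaled limit forces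
    \<open>a n\<close> to tend to 0, so both bounds have the same limit after scaling.\<close>
  have Eg_lim: "(\<lambda>n. \<integral>p. g n p \<partial>?N) \<longlonglongrightarrow> c"
  proof (rule tendsto_sandwich)
    let ?x = "\<lambda>n. (real (Suc n))\<^sup>2 * a n"
    have "(\<lambda>n. ?x n * inverse ((real (Suc n))\<^sup>2)) \<longlonglongrightarrow> c / 2 * 0"
      by (intro tendsto_mult lim) real_asymp
    moreover have "?x n * inverse ((real (Suc n))\<^sup>2) = a n" for n
      by (simp add: field_simps del: of_nat_Suc)
    ultimately have a0: "a \<longlonglongrightarrow> 0" by (simp del: of_nat_Suc)
    have "(\<lambda>n. 2 * ?x n * (1 - a n)) \<longlonglongrightarrow> 2 * (c / 2) * (1 - 0)"
      by (intro tendsto_intros lim a0)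
    then show "(\<lambda>n. 2 * ?x n * (1 - a n)) \<longlonglongrightarrow> c" by simp
    have "(\<lambda>n. 2 * ?x n) \<longlonglongrightarrow> 2 * (c / 2)"
      by (intro tendsto_intros lim)
    then show "(\<lambda>n. 2 * ?x n) \<longlonglongrightarrow> c" by simp
    have a_nonneg: "0 \<le> a n" for n
    proof -
      have "norm (CLINT \<omega>|M. iexp (1 / real (Suc n) * Z \<omega>)) \<le> (\<integral>\<omega>. 1 \<partial>M)"
        by (rule order_trans[OF integral_norm_bound]) (simp add: prob_space)
      then have "exp (- a n) \<le> 1" unfolding char by (simp add: prob_space)
      then show ?thesis by simp
    qed
    show "eventually (\<lambda>n. (\<integral>p. g n p \<partial>?N) \<le> 2 * ?x n) sequentially"
    proof (intro always_eventually allI)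
      fix n
      have "1 - exp (- 2 * a n) \<le> 2 * a n"
        using exp_ge_add_one_self[of "- 2 * a n"] by simp
      then show "(\<integral>p. g n p \<partial>?N) \<le> 2 * ?x n"
        unfolding Eg using mult_left_mono[of "1 - exp (- 2 * a n)" "2 * a n" "(real (Suc n))\<^sup>2"]
        by (simp add: mult.left_commute del: of_nat_Suc)
    qed
    show "eventually (\<lambda>n. 2 * ?x n * (1 - a n) \<le> (\<integral>p. g n p \<partial>?N)) sequentially"
    proof (intro always_eventually allI)
      fix n
      have "exp (- 2 * a n) * (1 + 2 * a n + (2 * a n)\<^sup>2 / 2) \<le> exp (- 2 * a n) * exp (2 * a n)"
        using exp_lower_Taylor_quadratic[of "2 * a n"] a_nonneg[of n] by (intro mult_left_mono) auto
      then have "exp (- 2 * a n) * (1 + 2 * a n + (2 * a n)\<^sup>2 / 2) \<le> 1"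
        by (simp flip: exp_add)
      then have e1: "exp (- 2 * a n) * (1 + 2 * a n + 2 * (a n)\<^sup>2) \<le> 1"
        by (simp add: power_mult_distrib)
      have "2 * a n * (1 - a n) \<le> 1 - exp (- 2 * a n)"
      proof -
        have pos: "0 < 1 + 2 * a n + 2 * (a n)\<^sup>2"
          using a_nonneg[of n] by (simp add: add_pos_nonneg)
        \<comment> \<open>Sophie Germain's identity: the product is at least 1, so the proposed
          lower bound survives multiplication by the quadratic Taylor polynomial of
          \<open>exp (2 * a n)\<close>.\<close>
        have *: "(1 - 2 * a n * (1 - a n)) * (1 + 2 * a n + 2 * (a n)\<^sup>2) = 1 + 4 * (a n) ^ 4"
          by (simp add: algebra_simps power2_eq_square power4_eq_xxxx)
        have "exp (- 2 * a n) * (1 + 2 * a n + 2 * (a n)\<^sup>2) \<le>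
            (1 - 2 * a n * (1 - a n)) * (1 + 2 * a n + 2 * (a n)\<^sup>2)"
        proof -
          have "0 \<le> 4 * (a n) ^ 4" by simp
          then show ?thesis using e1 * by linarith
        qed
        then have "exp (- 2 * a n) \<le> 1 - 2 * a n * (1 - a n)"
          using pos mult_le_cancel_right_pos by blast
        then show ?thesis by simp
      qed
      then show "2 * ?x n * (1 - a n) \<le> (\<integral>p. g n p \<partial>?N)"
        unfolding Eg using mult_left_mono[of "2 * a n * (1 - a n)" "1 - exp (- 2 * a n)" "(real (Suc n))\<^sup>2"]
        by (simp add: ac_simps del: of_nat_Suc)
    qed
  qed
  have g_lim: "(\<lambda>n. g n p) \<longlonglongrightarrow> (W p)\<^sup>2 / 2" for p
    unfolding g_def by (rule one_minus_cos_scaled_limit)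
  \<comment> \<open>Fatou's lemma first shows that \<open>W\<close> is square integrable. Only then
    is \<open>W^2 / 2\<close> available as the dominating function that identifies the
    limit.\<close>
  have "(\<integral>\<^sup>+p. ennreal ((W p)\<^sup>2 / 2) \<partial>?N) \<le> ennreal (c + 1)"
  proof (rule nn_integral_Fatou_bound[where u=g])
    have "eventually (\<lambda>n. (\<integral>p. g n p \<partial>?N) < c + 1) sequentially"
      using Eg_lim by (rule order_tendstoD) simp
    then show "eventually (\<lambda>n. (\<integral>\<^sup>+p. ennreal (g n p) \<partial>?N) \<le> ennreal (c + 1)) sequentially"
      by eventually_elim (simp add: nn_integral_eq_integral[OF g_int] g_nonneg ennreal_leI)
  qed (auto simp: g_lim)
  then have W_int2: "integrable ?N (\<lambda>p. (W p)\<^sup>2 / 2)"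
    by (intro integrableI_nonneg) (auto simp: le_less_trans)
  have "integrable ?N (\<lambda>p. 2 * ((W p)\<^sup>2 / 2))"
    using W_int2 by (intro integrable_mult_right)
  then have W_int: "integrable ?N (\<lambda>p. (W p)\<^sup>2)"
    by (simp only: times_divide_eq_right nonzero_mult_div_cancel_left[OF zero_neq_numeral[symmetric]])
  have "(\<lambda>n. \<integral>p. g n p \<partial>?N) \<longlonglongrightarrow> (\<integral>p. (W p)\<^sup>2 / 2 \<partial>?N)"
  proof (rule integral_dominated_convergence[OF _ _ W_int2])
    show "AE p in ?N. norm (g n p) \<le> (W p)\<^sup>2 / 2" for n
    proof (rule AE_I2)
      fix p
      have "norm (g n p) = g n p" using g_nonneg[of n p] by simp
      then show "norm (g n p) \<le> (W p)\<^sup>2 / 2"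
        using one_minus_cos_scaled_le[of n "W p"] by (simp only: g_def)
    qed
  qed (use g_lim in auto)
  then have EW: "(\<integral>p. (W p)\<^sup>2 / 2 \<partial>?N) = c"
    using Eg_lim LIMSEQ_unique by blast
  \<comment> \<open>Fubini's theorem yields one frozen value \<open>Z x\<close> for which
    \<open>Z x - Z y\<close> is square integrable in \<open>y\<close>; the second moment of
    \<open>Z\<close> follows by adding a constant.\<close>
  have "AE x in M. integrable M (\<lambda>y. (W (x, y))\<^sup>2)"
    using N.AE_integrable_fst'[OF W_int] .
  then have "\<exists>x. integrable M (\<lambda>y. (W (x, y))\<^sup>2)"
    using eventually_happens'[OF ae_filter_bot] by blast
  then obtain x where x: "integrable M (\<lambda>y. (Z x - Z y)\<^sup>2)" by (auto simp: W_def)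
  have Z2: "integrable M (\<lambda>y. (Z y)\<^sup>2)"
  proof (rule Bochner_Integration.integrable_bound)
    show "integrable M (\<lambda>y. 2 * (Z x - Z y)\<^sup>2 + 2 * (Z x)\<^sup>2)" using x by simp
    show "AE y in M. norm ((Z y)\<^sup>2) \<le> norm (2 * (Z x - Z y)\<^sup>2 + 2 * (Z x)\<^sup>2)"
    proof (rule AE_I2)
      fix y
      have "(Z y)\<^sup>2 \<le> 2 * (Z x - Z y)\<^sup>2 + 2 * (Z x)\<^sup>2"
        using square_add_le[of 1 "Z x" "Z y - Z x"] by (simp add: power2_commute)
      then show "norm ((Z y)\<^sup>2) \<le> norm (2 * (Z x - Z y)\<^sup>2 + 2 * (Z x)\<^sup>2)" by simp
    qed
  qed simp
  have Z1: "integrable M Z"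
    by (rule square_integrable_imp_integrable[OF Z Z2])
  have "c = (\<integral>p. (W p)\<^sup>2 / 2 \<partial>?N)" using EW by simp
  also have "\<dots> = (\<integral>x. \<integral>y. (Z x - Z y)\<^sup>2 / 2 \<partial>M \<partial>M)"
    using N.integral_fst'[OF W_int2] by (simp add: W_def)
  also have "\<dots> = (\<integral>x. (Z x)\<^sup>2 / 2 + expectation (\<lambda>y. (Z y)\<^sup>2) / 2 - Z x * expectation Z \<partial>M)"
    using Z1 Z2 by (simp add: power2_diff add_divide_distrib diff_divide_distrib prob_space)
  also have "\<dots> = expectation (\<lambda>y. (Z y)\<^sup>2) - (expectation Z)\<^sup>2"
    using Z1 Z2 by (simp add: prob_space power2_eq_square)
  also have "\<dots> = variance Z"
    using variance_eq[OF Z1 Z2] by simp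
  finally show ?thesis by simp
qed

end

text \<open>A finite variance keeps the characteristic function within a quadratic distance of 1
  near the origin, so \<open>q\<close> grows at most quadratically there. Fatou's lemma passes this
  on to the jump measure.\<close>

lemma (in homogeneous_levy_basis) integrable_jump_square:
  assumes "basis_finite_second_moment M \<Lambda>"
  shows "integrable \<nu> (\<lambda>z. z\<^sup>2)"
proof -
  \<comment> \<open>The unit cube has measure 1, so the exponent appears without a factor.\<close>
  define B :: "'s set" where "B = cbox 0 One"
  have B: "B \<in> bounded_borel" "measure lborel B = 1"
    by (auto simp: B_def bounded_borel_def)
  let ?X = "\<Lambda> B"
  have X[measurable]: "random_variable borel ?X" using B random_variable_basis by blast
  have X2: "integrable M (\<lambda>\<omega>. (?X \<omega>)\<^sup>2)"
    using assms B(1) by (simp add: basis_finite_second_moment_def)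
  have X1: "integrable M ?X"
    by (rule square_integrable_imp_integrable[OF X X2])
  define m where "m = expectation ?X"
  define V where "V = expectation (\<lambda>\<omega>. (?X \<omega> - m)\<^sup>2)"
  have XV: "integrable M (\<lambda>\<omega>. (?X \<omega> - m)\<^sup>2)"
    using X1 X2 by (simp add: power2_diff)
  have V_nonneg: "0 \<le> V" by (simp add: V_def)
  have char_ge: "1 - u\<^sup>2 * V / 2 \<le> exp (- q u)" for u
  proof -
    have int: "complex_integrable M (\<lambda>\<omega>. iexp (u * (?X \<omega> - m)))"
      by (rule integrable_const_bound[where B=1]) auto
    have cos: "integrable M (\<lambda>\<omega>. cos (u * (?X \<omega> - m)))"
      by (rule integrable_const_bound[where B=1]) auto
    have "1 - u\<^sup>2 * V / 2 = expectation (\<lambda>\<omega>. 1 - u\<^sup>2 / 2 * (?X \<omega> - m)\<^sup>2)"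
      using XV by (simp add: V_def prob_space)
    also have "\<dots> \<le> expectation (\<lambda>\<omega>. cos (u * (?X \<omega> - m)))"
    proof (rule integral_mono)
      show "integrable M (\<lambda>\<omega>. 1 - u\<^sup>2 / 2 * (?X \<omega> - m)\<^sup>2)"
        using XV by (intro Bochner_Integration.integrable_diff integrable_const integrable_mult_right)
      show "1 - u\<^sup>2 / 2 * (?X \<omega> - m)\<^sup>2 \<le> cos (u * (?X \<omega> - m))" for \<omega>
        using one_minus_cos_le[of "u * (?X \<omega> - m)"] unfolding power_mult_distrib by simp
    qed (rule cos)
    also have "\<dots> = expectation (\<lambda>\<omega>. Re (iexp (u * (?X \<omega> - m))))"
      by (simp add: Re_exp)
    also have "\<dots> = Re (CLINT \<omega>|M. iexp (u * (?X \<omega> - m)))"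
      using int by (rule integral_Re)
    also have "\<dots> \<le> norm (CLINT \<omega>|M. iexp (u * (?X \<omega> - m)))"
      by (rule complex_Re_le_cmod)
    \<comment> \<open>Centring multiplies the characteristic function by a unimodular constant and
      leaves its modulus unchanged.\<close>
    also have "(CLINT \<omega>|M. iexp (u * (?X \<omega> - m))) = (CLINT \<omega>|M. iexp (- u * m) * iexp (u * ?X \<omega>))"
      by (simp add: right_diff_distrib exp_diff exp_minus field_simps)
    also have "\<dots> = iexp (- u * m) * (CLINT \<omega>|M. iexp (u * ?X \<omega>))"
      by simp
    also have "norm \<dots> = exp (- q u)"
      unfolding norm_mult norm_exp_i_times using norm_char_basis[OF B(1), of u] B(2) by simp
    finally show ?thesis .
  qed
  \<comment> \<open>Multiplying the lower bound of \<open>exp (- q u)\<close> by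
    \<open>1 + q u\<close>, which is at most \<open>exp (q u)\<close>, gives
    \<open>q u \<le> u^2 * V / 2 * (1 + q u)\<close>. For \<open>u^2 * V \<le> 1\<close> at most
    half of \<open>q u\<close> stands on the right and is absorbed.\<close>
  have q_le: "q u \<le> u\<^sup>2 * V" if "u\<^sup>2 * V \<le> 1" for u
  proof -
    have "(1 - u\<^sup>2 * V / 2) * (1 + q u) \<le> exp (- q u) * exp (q u)"
      using char_ge[of u] exp_ge_add_one_self[of "q u"] jump_symbol_nonneg[of u] that
      by (intro mult_mono) auto
    also have "\<dots> = 1" by (simp flip: exp_add)
    finally have 1: "q u \<le> u\<^sup>2 * V / 2 + u\<^sup>2 * V / 2 * q u" by (simp add: algebra_simps)
    have "u\<^sup>2 * V / 2 * q u \<le> 1 / 2 * q u"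
      using that jump_symbol_nonneg by (intro mult_right_mono) auto
    then show ?thesis using 1 by simp
  qed
  have "(\<integral>\<^sup>+z. ennreal (z\<^sup>2 / 2) \<partial>\<nu>) \<le> ennreal V"
  proof (rule nn_integral_Fatou_bound)
    let ?u = "\<lambda>n z. (real (Suc n))\<^sup>2 * (1 - cos (z / real (Suc n)))"
    show "AE z in \<nu>. (\<lambda>n. ?u n z) \<longlonglongrightarrow> z\<^sup>2 / 2"
      by (intro AE_I2 one_minus_cos_scaled_limit)
    have "(\<lambda>n. (1 / real (Suc n))\<^sup>2 * V) \<longlonglongrightarrow> 0" by real_asymp
    then have "eventually (\<lambda>n. (1 / real (Suc n))\<^sup>2 * V < 1) sequentially"
      by (rule order_tendstoD) simp
    then show "eventually (\<lambda>n. (\<integral>\<^sup>+z. ennreal (?u n z) \<partial>\<nu>) \<le> ennreal V) sequentially"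
    proof eventually_elim
      fix n assume n: "(1 / real (Suc n))\<^sup>2 * V < 1"
      have "(\<integral>z. 1 - cos (1 / real (Suc n) * z) \<partial>\<nu>) \<le> q (1 / real (Suc n))"
        unfolding jump_symbol_def using gaussian_variance by simp
      also have "\<dots> \<le> (1 / real (Suc n))\<^sup>2 * V" using q_le n by simp
      finally have "(real (Suc n))\<^sup>2 * (\<integral>z. 1 - cos (1 / real (Suc n) * z) \<partial>\<nu>) \<le>
          (real (Suc n))\<^sup>2 * ((1 / real (Suc n))\<^sup>2 * V)"
        by (rule mult_left_mono) simp
      also have "\<dots> = V" by (simp add: power_divide del: of_nat_Suc)
      finally have le: "(real (Suc n))\<^sup>2 * (\<integral>z. 1 - cos (1 / real (Suc n) * z) \<partial>\<nu>) \<le> V" .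
      have "(\<integral>\<^sup>+z. ennreal (?u n z) \<partial>\<nu>) = ennreal (\<integral>z. ?u n z \<partial>\<nu>)"
        using integrable_one_minus_cos[of "1 / real (Suc n)"]
        by (intro nn_integral_eq_integral AE_I2 integrable_mult_right) auto
      then show "(\<integral>\<^sup>+z. ennreal (?u n z) \<partial>\<nu>) \<le> ennreal V"
        using le by (simp add: ennreal_leI del: of_nat_Suc)
    qed
  qed auto
  then have "integrable \<nu> (\<lambda>z. z\<^sup>2 / 2)"
    by (intro integrableI_nonneg) (auto simp: le_less_trans)
  then have "integrable \<nu> (\<lambda>z. 2 * (z\<^sup>2 / 2))"
    by (rule integrable_mult_right)
  then show ?thesis by simp
qed

section \<open>Growth, near-subadditivity and continuity of the symbol\<close>

locale square_integrable_levy_basis = homogeneous_levy_basis +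
  assumes jump_square: "integrable \<nu> (\<lambda>z. z\<^sup>2)"
begin

abbreviation "\<kappa> \<equiv> basis_variance \<sigma>2 \<nu>"

lemma jump_symbol_le: "q x \<le> \<kappa> * x\<^sup>2 / 2"
proof -
  have "(\<integral>z. 1 - cos (x * z) \<partial>\<nu>) \<le> (\<integral>z. x\<^sup>2 / 2 * z\<^sup>2 \<partial>\<nu>)"
    using integrable_one_minus_cos jump_square one_minus_cos_le[of "x * _"]
    by (intro integral_mono) (auto simp: power_mult_distrib)
  then show ?thesis
    by (simp add: jump_symbol_def basis_variance_def algebra_simps)
qed

lemma basis_variance_nonneg: "0 \<le> \<kappa>"
  using gaussian_variance by (simp add: basis_variance_def)

lemma jump_symbol_uminus: "q (- x) = q x"
  by (simp add: jump_symbol_def)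

lemma jump_symbol_add_le:
  assumes "r > 0"
  shows "q (x + y) \<le> (1 + r) * q x + (1 + 1 / r) * q y"
proof -
  have "(\<integral>z. 1 - cos ((x + y) * z) \<partial>\<nu>) \<le>
      (\<integral>z. (1 + r) * (1 - cos (x * z)) + (1 + 1 / r) * (1 - cos (y * z)) \<partial>\<nu>)"
  proof (intro integral_mono Bochner_Integration.integrable_add integrable_mult_right integrable_one_minus_cos)
    show "1 - cos ((x + y) * z) \<le> (1 + r) * (1 - cos (x * z)) + (1 + 1 / r) * (1 - cos (y * z))" for z
      using one_minus_cos_add_le[OF assms, of "x * z" "y * z"] by (simp only: distrib_right)
  qed
  also have "\<dots> = (1 + r) * (\<integral>z. 1 - cos (x * z) \<partial>\<nu>) + (1 + 1 / r) * (\<integral>z. 1 - cos (y * z) \<partial>\<nu>)"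
    by (subst Bochner_Integration.integral_add)
      (intro integrable_mult_right integrable_one_minus_cos | simp)+
  finally have 1: "(\<integral>z. 1 - cos ((x + y) * z) \<partial>\<nu>) \<le> \<dots>" .
  have "\<sigma>2 / 2 * (x + y)\<^sup>2 \<le> \<sigma>2 / 2 * ((1 + r) * x\<^sup>2 + (1 + 1 / r) * y\<^sup>2)"
    using gaussian_variance square_add_le[OF assms] by (intro mult_left_mono) auto
  also have "\<dots> = (1 + r) * (\<sigma>2 * x\<^sup>2 / 2) + (1 + 1 / r) * (\<sigma>2 * y\<^sup>2 / 2)"
    using assms by (simp add: field_simps)
  finally have "\<sigma>2 * (x + y)\<^sup>2 / 2 \<le> (1 + r) * (\<sigma>2 * x\<^sup>2 / 2) + (1 + 1 / r) * (\<sigma>2 * y\<^sup>2 / 2)" by simp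
  then show ?thesis
    using 1 unfolding jump_symbol_def distrib_left[of "1 + r"] distrib_left[of "1 + 1 / r"] by linarith
qed

text \<open>The bound is deliberately asymmetric: apart from \<open>q (x - y)\<close> only
  \<open>q y\<close> occurs. With \<open>y\<close> from the limit integrand its integral is a fixed
  number, so \<open>r\<close> can be chosen independently of the approximating sequence.\<close>

lemma jump_symbol_diff_le:
  assumes "r > 0"
  shows "\<bar>q x - q y\<bar> \<le> r * q y + (1 + 1 / r) * q (x - y)"
proof -
  have "q x \<le> (1 + r) * q y + (1 + 1 / r) * q (x - y)"
    using jump_symbol_add_le[OF assms, of y "x - y"] by simp
  moreover have "q y \<le> r * q y + q x + (1 + 1 / r) * q (x - y)"
  proof -
    have "q y \<le> (1 + r) * q x + (1 + 1 / r) * q (y - x)"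
      using jump_symbol_add_le[OF assms, of x "y - x"] by simp
    \<comment> \<open>Dividing by \<open>1 + r\<close> frees \<open>q x\<close> from its factor; the
      part of \<open>q y\<close> lost by this is at most \<open>r * q y\<close>.\<close>
    then have "q y / (1 + r) \<le> ((1 + r) * q x + (1 + 1 / r) * q (x - y)) / (1 + r)"
      using assms jump_symbol_uminus[of "x - y"] by (intro divide_right_mono) auto
    also have "\<dots> = q x + q (x - y) / r"
    proof -
      have "((1 + r) * s + (1 + 1 / r) * t) / (1 + r) = s + t / r" for s t
      proof -
        have "1 + r \<noteq> 0" "r \<noteq> 0" using assms by simp_all
        then have "(1 + r) * s + (1 + 1 / r) * t = (s + t / r) * (1 + r)"
          by (simp add: field_simps)
        then show ?thesis using \<open>1 + r \<noteq> 0\<close> by (simp only: nonzero_mult_div_cancel_right not_False_eq_True)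
      qed
      then show ?thesis .
    qed
    finally have 1: "q y / (1 + r) \<le> q x + q (x - y) / r" .
    have "q y - q y / (1 + r) = r / (1 + r) * q y"
      using assms by (simp add: field_simps)
    also have "\<dots> \<le> r * q y"
      using assms jump_symbol_nonneg by (intro mult_right_mono) (auto simp: field_simps)
    finally show ?thesis
      using 1 jump_symbol_nonneg[of "x - y"] by (simp add: distrib_right)
  qed
  ultimately show ?thesis by (simp add: distrib_right abs_le_iff)
qed

lemma jump_symbol_tendsto:
  assumes "X \<longlonglongrightarrow> x"
  shows "(\<lambda>n. q (X n)) \<longlonglongrightarrow> q x"
proof -
  obtain C where C: "\<bar>X n\<bar> \<le> C" for n
    using convergent_imp_bounded[OF assms] by (auto simp: bounded_iff)
  have "(\<lambda>n. \<integral>z. 1 - cos (X n * z) \<partial>\<nu>) \<longlonglongrightarrow> (\<integral>z. 1 - cos (x * z) \<partial>\<nu>)"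
  proof (rule integral_dominated_convergence)
    show "integrable \<nu> (\<lambda>z. C\<^sup>2 / 2 * z\<^sup>2)" using jump_square by simp
    show "AE z in \<nu>. (\<lambda>n. 1 - cos (X n * z)) \<longlonglongrightarrow> 1 - cos (x * z)"
      using assms by (auto intro!: tendsto_intros)
    show "AE z in \<nu>. norm (1 - cos (X n * z)) \<le> C\<^sup>2 / 2 * z\<^sup>2" for n
    proof (rule AE_I2)
      fix z
      have "1 - cos (X n * z) \<le> (X n)\<^sup>2 * z\<^sup>2 / 2"
        using one_minus_cos_le[of "X n * z"] by (simp add: power_mult_distrib)
      moreover have "(X n)\<^sup>2 * z\<^sup>2 \<le> C\<^sup>2 * z\<^sup>2"
        using C[of n] by (intro mult_right_mono power2_mono) auto
      ultimately show "norm (1 - cos (X n * z)) \<le> C\<^sup>2 / 2 * z\<^sup>2" by simp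
    qed
  qed auto
  then show ?thesis
    unfolding jump_symbol_def using assms by (intro tendsto_intros) auto
qed

lemma jump_symbol_measurable [measurable]: "q \<in> borel_measurable borel"
proof (rule borel_measurable_continuous_onI)
  show "continuous_on UNIV q"
    by (auto simp: continuous_on_sequentially comp_def intro: jump_symbol_tendsto)
qed

lemma jump_symbol_scaled_limit:
  "(\<lambda>n. (real (Suc n))\<^sup>2 * q (x / real (Suc n))) \<longlonglongrightarrow> \<kappa> * x\<^sup>2 / 2"
proof -
  have "(\<lambda>n. \<integral>z. (real (Suc n))\<^sup>2 * (1 - cos (x * z / real (Suc n))) \<partial>\<nu>) \<longlonglongrightarrow> (\<integral>z. (x * z)\<^sup>2 / 2 \<partial>\<nu>)"
  proof (rule integral_dominated_convergence)
    show "integrable \<nu> (\<lambda>z. (x * z)\<^sup>2 / 2)" using jump_square by (simp add: power_mult_distrib)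
    show "AE z in \<nu>. (\<lambda>n. (real (Suc n))\<^sup>2 * (1 - cos (x * z / real (Suc n)))) \<longlonglongrightarrow> (x * z)\<^sup>2 / 2"
      by (intro AE_I2 one_minus_cos_scaled_limit)
    show "AE z in \<nu>. norm ((real (Suc n))\<^sup>2 * (1 - cos (x * z / real (Suc n)))) \<le> (x * z)\<^sup>2 / 2" for n
      using one_minus_cos_scaled_le by (intro AE_I2) (simp del: of_nat_Suc)
  qed auto
  then have "(\<lambda>n. \<sigma>2 * x\<^sup>2 / 2 + (real (Suc n))\<^sup>2 * (\<integral>z. 1 - cos (x / real (Suc n) * z) \<partial>\<nu>))
      \<longlonglongrightarrow> \<sigma>2 * x\<^sup>2 / 2 + (\<integral>z. x\<^sup>2 / 2 * z\<^sup>2 \<partial>\<nu>)"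
    by (intro tendsto_intros) (simp add: power_mult_distrib del: of_nat_Suc)
  then show ?thesis
    by (simp add: jump_symbol_def basis_variance_def power_divide add_divide_distrib algebra_simps del: of_nat_Suc)
qed

end

context prob_space
begin

text \<open>The sequence \<open>V\<close> is a separate parameter because the simple integral of a
  difference agrees with the difference of the integrals only almost surely.\<close>

lemma tendsto_in_probability_diff:
  assumes X[measurable]: "\<And>n. random_variable borel (X n)" and Y[measurable]: "\<And>n. random_variable borel (Y n)"
    and [measurable]: "random_variable borel Z" "random_variable borel W"
    and V[measurable]: "\<And>n. random_variable borel (V n)"
    and V_eq: "\<And>n. AE \<omega> in M. V n \<omega> = X n \<omega> - Y n \<omega>"
    and XZ: "tendsto_in_probability M X Z" and YW: "tendsto_in_probability M Y W"
  shows "tendsto_in_probability M V (\<lambda>\<omega>. Z \<omega> - W \<omega>)"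
  unfolding tendsto_in_probability_def
proof (intro allI impI)
  fix \<epsilon> :: real assume "\<epsilon> > 0"
  let ?A = "\<lambda>n. {\<omega> \<in> space M. \<bar>X n \<omega> - Z \<omega>\<bar> > \<epsilon> / 2}"
  let ?B = "\<lambda>n. {\<omega> \<in> space M. \<bar>Y n \<omega> - W \<omega>\<bar> > \<epsilon> / 2}"
  let ?C = "\<lambda>n. {\<omega> \<in> space M. \<bar>V n \<omega> - (Z \<omega> - W \<omega>)\<bar> > \<epsilon>}"
  have AB: "(\<lambda>n. prob (?A n) + prob (?B n)) \<longlonglongrightarrow> 0 + 0"
    using XZ YW half_gt_zero[OF \<open>\<epsilon> > 0\<close>] unfolding tendsto_in_probability_def
    by (intro tendsto_add) blast+
  have le: "prob (?C n) \<le> prob (?A n) + prob (?B n)" for n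
  proof -
    have "prob (?C n) \<le> prob (?A n \<union> ?B n)"
    proof (rule finite_measure_mono_AE)
      show "AE \<omega> in M. \<omega> \<in> ?C n \<longrightarrow> \<omega> \<in> ?A n \<union> ?B n"
        using V_eq[of n] by eventually_elim (auto simp: abs_if split: if_splits)
    qed auto
    also have "\<dots> \<le> prob (?A n) + prob (?B n)" by (rule measure_Un_le) auto
    finally show ?thesis .
  qed
  show "(\<lambda>n. prob (?C n)) \<longlonglongrightarrow> 0"
  proof (rule tendsto_sandwich)
    show "eventually (\<lambda>n. 0 \<le> prob (?C n)) sequentially" by simp
    show "eventually (\<lambda>n. prob (?C n) \<le> prob (?A n) + prob (?B n)) sequentially"
      using le by (intro always_eventually allI)
    show "(\<lambda>n. prob (?A n) + prob (?B n)) \<longlonglongrightarrow> 0" using AB by (simp only: add_0_left)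
  qed (rule tendsto_const)
qed

end

section \<open>Characteristic function and variance of general stochastic integrals\<close>

context square_integrable_levy_basis
begin

lemma integrable_jump_symbol_comp:
  assumes [measurable]: "f \<in> borel_measurable borel" and f2: "integrable lborel (\<lambda>s. (f s)\<^sup>2)"
  shows "integrable lborel (\<lambda>s. q (u * f s))"
proof (rule Bochner_Integration.integrable_bound)
  show "integrable lborel (\<lambda>s. \<kappa> * u\<^sup>2 / 2 * (f s)\<^sup>2)" using f2 by simp
  show "AE s in lborel. norm (q (u * f s)) \<le> norm (\<kappa> * u\<^sup>2 / 2 * (f s)\<^sup>2)"
    using jump_symbol_le[of "u * f _"] jump_symbol_nonneg basis_variance_nonneg
    by (intro AE_I2) (simp add: power_mult_distrib mult.assoc)
qed simp

text \<open>A sequence converging in probability is Cauchy in probability, so the characteristic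
  functions of its differences approach 1. Their moduli are exponentials of minus the integrals in
  question.\<close>

lemma jump_symbol_simple_diff_tendsto_0:
  assumes F: "\<And>n. simple_integrand (F n)" and Z: "random_variable borel Z"
    and lim: "tendsto_in_probability M (\<lambda>n. simple_integral \<Lambda> (F n)) Z" and "\<delta> > 0"
  obtains N where "\<And>n m. n \<ge> N \<Longrightarrow> m \<ge> N \<Longrightarrow>
    (\<integral>\<^sup>+ s. ennreal (q (u * (F n s - F m s))) \<partial>lborel) \<le> ennreal \<delta>"
proof -
  let ?X = "\<lambda>n. simple_integral \<Lambda> (F n)"
  have X[measurable]: "random_variable borel (?X n)" for n
    using F by (rule simple_integral_measurable)
  \<comment> \<open>A distance to 1 below this threshold means modulus above
    \<open>exp (- \<delta>)\<close>, that is, an integral below \<open>\<delta>\<close>.\<close>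
  have "0 < 1 - exp (- \<delta>)" using \<open>\<delta> > 0\<close> by simp
  then obtain N where N: "\<And>n m. n \<ge> N \<Longrightarrow> m \<ge> N \<Longrightarrow>
      norm ((CLINT \<omega>|M. iexp (u * (?X n \<omega> - ?X m \<omega>))) - 1) < 1 - exp (- \<delta>)"
    using char_tendsto_1[OF X Z lim] by metis
  show ?thesis
  proof (rule that)
    fix n m assume nm: "n \<ge> N" "m \<ge> N"
    let ?H = "\<lambda>s. F n s - F m s"
    let ?J = "\<integral>\<^sup>+ s. ennreal (q (u * ?H s)) \<partial>lborel"
    have H: "simple_integrand ?H" using F F by (rule simple_integrand_diff)
    have [measurable]: "random_variable borel (simple_integral \<Lambda> ?H)"
      using H by (rule simple_integral_measurable)
    have eq: "(CLINT \<omega>|M. iexp (u * simple_integral \<Lambda> ?H \<omega>)) = (CLINT \<omega>|M. iexp (u * (?X n \<omega> - ?X m \<omega>)))"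
    proof (rule integral_cong_AE)
      show "AE \<omega> in M. iexp (u * simple_integral \<Lambda> ?H \<omega>) = iexp (u * (?X n \<omega> - ?X m \<omega>))"
        using simple_integral_diff[OF F F, of n m] by eventually_elim simp
    qed auto
    have "1 - norm ((CLINT \<omega>|M. iexp (u * (?X n \<omega> - ?X m \<omega>))) - 1) \<le>
        norm (CLINT \<omega>|M. iexp (u * (?X n \<omega> - ?X m \<omega>)))"
      using norm_triangle_ineq3[of 1 "CLINT \<omega>|M. iexp (u * (?X n \<omega> - ?X m \<omega>))"]
      by (simp add: norm_minus_commute abs_le_iff del: of_real_diff of_real_mult)
    then have "exp (- \<delta>) < exp (- enn2real ?J)"
      using N[OF nm] norm_char_simple_integral(2)[OF H, of u] unfolding eq by linarith
    then have "ennreal (enn2real ?J) \<le> ennreal \<delta>" by (intro ennreal_leI) simp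
    moreover have "ennreal (enn2real ?J) = ?J"
      using norm_char_simple_integral(1)[OF H, of u] by (simp add: less_top)
    ultimately show "?J \<le> ennreal \<delta>" by (simp only:)
  qed
qed

lemma norm_char_stochastic_limit:
  assumes F: "\<And>n. simple_integrand (F n)" and Z: "random_variable borel Z"
    and lim: "tendsto_in_probability M (\<lambda>n. simple_integral \<Lambda> (F n)) Z"
    and f[measurable]: "f \<in> borel_measurable borel" and f2: "integrable lborel (\<lambda>s. (f s)\<^sup>2)"
    and Ff: "AE s in lborel. (\<lambda>n. F n s) \<longlonglongrightarrow> f s"
  shows "norm (CLINT \<omega>|M. iexp (u * Z \<omega>)) = exp (- (\<integral>s. q (u * f s) \<partial>lborel))"
proof -
  have [measurable]: "F n \<in> borel_measurable borel" for n
    using F by (rule simple_integrand_borel_measurable)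
  define a where "a = (\<integral>s. q (u * f s) \<partial>lborel)"
  define b where "b n = (\<integral>s. q (u * F n s) \<partial>lborel)" for n
  have a: "0 \<le> a" "integrable lborel (\<lambda>s. q (u * f s))"
    using integrable_jump_symbol_comp[OF f f2]
    by (auto simp: a_def jump_symbol_nonneg intro!: integral_nonneg)
  have bF: "integrable lborel (\<lambda>s. q (u * F n s))" for n
    using norm_char_simple_integral(1)[OF F, of u n]
    by (intro integrableI_nonneg) (auto simp: jump_symbol_nonneg)
  have char_F: "norm (CLINT \<omega>|M. iexp (u * simple_integral \<Lambda> (F n) \<omega>)) = exp (- b n)" for n
    using norm_char_simple_integral(2)[OF F, of u n] nn_integral_eq_integral[OF bF]
    by (simp add: b_def jump_symbol_nonneg integral_nonneg)
  have "b \<longlonglongrightarrow> a"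
  proof (rule LIMSEQ_I)
    fix \<eta> :: real assume "\<eta> > 0"
    \<comment> \<open>The error is \<open>r * a\<close> plus \<open>(1 + 1 / r) * \<delta>\<close>.
      First \<open>r\<close> makes the former smaller than \<open>\<eta> / 2\<close>, then
      \<open>\<delta>\<close> makes the latter equal to it; the 1 added to \<open>a\<close> covers
      \<open>a = 0\<close>.\<close>
    define r where "r = \<eta> / (2 * (a + 1))"
    have r: "r > 0" "r * a < \<eta> / 2"
      using \<open>\<eta> > 0\<close> a(1) by (auto simp: r_def field_simps)
    define \<delta> where "\<delta> = \<eta> / (2 * (1 + 1 / r))"
    have \<delta>: "\<delta> > 0" "(1 + 1 / r) * \<delta> = \<eta> / 2"
    proof -
      have pos: "1 + 1 / r > 0" using r(1) by (simp add: add_pos_pos)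
      then show "\<delta> > 0" unfolding \<delta>_def using \<open>\<eta> > 0\<close> by (intro divide_pos_pos) auto
      show "(1 + 1 / r) * \<delta> = \<eta> / 2"
        unfolding \<delta>_def times_divide_eq_right using mult_divide_mult_cancel_left[of "1 + 1 / r" \<eta> 2] pos
        by (simp only: mult.commute[of 2])
    qed
    obtain N where N: "\<And>n m. n \<ge> N \<Longrightarrow> m \<ge> N \<Longrightarrow>
        (\<integral>\<^sup>+ s. ennreal (q (u * (F n s - F m s))) \<partial>lborel) \<le> ennreal \<delta>"
      using jump_symbol_simple_diff_tendsto_0[OF F Z lim \<delta>(1)] by metis
    have "norm (b n - a) < \<eta>" if n: "n \<ge> N" for n
    proof -
      have J: "(\<integral>\<^sup>+ s. ennreal (q (u * (F n s - f s))) \<partial>lborel) \<le> ennreal \<delta>"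
      proof (rule nn_integral_Fatou_bound)
        show "AE s in lborel. (\<lambda>m. q (u * (F n s - F m s))) \<longlonglongrightarrow> q (u * (F n s - f s))"
          using Ff by eventually_elim (intro jump_symbol_tendsto tendsto_intros)
        show "eventually (\<lambda>m. (\<integral>\<^sup>+ s. ennreal (q (u * (F n s - F m s))) \<partial>lborel) \<le> ennreal \<delta>) sequentially"
          using N[OF n] by (auto simp: eventually_sequentially)
      qed auto
      then have int: "integrable lborel (\<lambda>s. q (u * (F n s - f s)))"
        by (intro integrableI_nonneg) (auto simp: jump_symbol_nonneg le_less_trans)
      have d: "(\<integral>s. q (u * (F n s - f s)) \<partial>lborel) \<le> \<delta>"
        using J \<delta>(1) nn_integral_eq_integral[OF int] by (simp add: jump_symbol_nonneg)
      have "norm (b n - a) = \<bar>\<integral>s. q (u * F n s) - q (u * f s) \<partial>lborel\<bar>"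
        using a(2) bF by (simp add: a_def b_def)
      also have "\<dots> \<le> (\<integral>s. \<bar>q (u * F n s) - q (u * f s)\<bar> \<partial>lborel)"
        by (rule integral_abs_bound)
      also have "\<dots> \<le> (\<integral>s. r * q (u * f s) + (1 + 1 / r) * q (u * (F n s - f s)) \<partial>lborel)"
      proof (rule integral_mono)
        show "integrable lborel (\<lambda>s. \<bar>q (u * F n s) - q (u * f s)\<bar>)"
          using a(2) bF by simp
        show "integrable lborel (\<lambda>s. r * q (u * f s) + (1 + 1 / r) * q (u * (F n s - f s)))"
          using a(2) int by (intro Bochner_Integration.integrable_add integrable_mult_right)
        show "\<bar>q (u * F n s) - q (u * f s)\<bar> \<le> r * q (u * f s) + (1 + 1 / r) * q (u * (F n s - f s))" for s
          using jump_symbol_diff_le[OF r(1), of "u * F n s" "u * f s"] by (simp add: right_diff_distrib)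
      qed
      also have "\<dots> = r * a + (1 + 1 / r) * (\<integral>s. q (u * (F n s - f s)) \<partial>lborel)"
        unfolding a_def using a(2) int
        by (subst Bochner_Integration.integral_add) (intro integrable_mult_right | simp)+
      also have "\<dots> \<le> r * a + (1 + 1 / r) * \<delta>"
        using d r(1) by (intro add_left_mono mult_left_mono) auto
      also have "\<dots> < \<eta>" using r(2) \<delta>(2) by simp
      finally show ?thesis .
    qed
    then show "\<exists>N. \<forall>n\<ge>N. norm (b n - a) < \<eta>" by blast
  qed
  then have "(\<lambda>n. norm (CLINT \<omega>|M. iexp (u * simple_integral \<Lambda> (F n) \<omega>))) \<longlonglongrightarrow> exp (- a)"
    unfolding char_F by (intro tendsto_intros)
  moreover have "(\<lambda>n. CLINT \<omega>|M. iexp (u * simple_integral \<Lambda> (F n) \<omega>)) \<longlonglongrightarrow> (CLINT \<omega>|M. iexp (u * Z \<omega>))"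
  proof (rule LIMSEQ_I)
    fix \<epsilon> :: real assume "\<epsilon> > 0"
    then show "\<exists>N. \<forall>n\<ge>N. norm ((CLINT \<omega>|M. iexp (u * simple_integral \<Lambda> (F n) \<omega>)) -
        (CLINT \<omega>|M. iexp (u * Z \<omega>))) < \<epsilon>"
      using char_tendsto_1[OF simple_integral_measurable[OF F] Z lim] by metis
  qed
  ultimately show ?thesis
    unfolding a_def using LIMSEQ_unique tendsto_norm by blast
qed

text \<open>The two integrals bring unrelated sequences, but their termwise differences are again
  simple and approximate \<open>f - g\<close>. So the difference is treated as one integral, with
  square integrability required of \<open>f - g\<close> alone.\<close>

lemma variance_stochastic_integral_diff:
  assumes Z: "has_stochastic_integral M \<Lambda> f UNIV Z" and W: "has_stochastic_integral M \<Lambda> g UNIV W"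
    and fg2: "integrable lborel (\<lambda>s. (f s - g s)\<^sup>2)"
  shows "variance (\<lambda>\<omega>. Z \<omega> - W \<omega>) = \<kappa> * (\<integral>s. (f s - g s)\<^sup>2 \<partial>lborel)"
proof -
  obtain F where F: "integral_approximation M \<Lambda> f F"
    "tendsto_in_probability M (\<lambda>n. simple_integral \<Lambda> (F n)) Z"
    using Z by (auto simp: has_stochastic_integral_def simple_integral_def)
  obtain G where G: "integral_approximation M \<Lambda> g G"
    "tendsto_in_probability M (\<lambda>n. simple_integral \<Lambda> (G n)) W"
    using W by (auto simp: has_stochastic_integral_def simple_integral_def)
  have [measurable]: "random_variable borel Z" "random_variable borel W"
    "f \<in> borel_measurable borel" "g \<in> borel_measurable borel"
    using Z W by (auto simp: has_stochastic_integral_def)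
  have FG: "simple_integrand (F n)" "simple_integrand (G n)" for n
    using F(1) G(1) by (auto simp: integral_approximation_def)
  let ?H = "\<lambda>n s. F n s - G n s" and ?h = "\<lambda>s. f s - g s"
  have H: "simple_integrand (?H n)" for n using FG by (rule simple_integrand_diff)
  have lim: "tendsto_in_probability M (\<lambda>n. simple_integral \<Lambda> (?H n)) (\<lambda>\<omega>. Z \<omega> - W \<omega>)"
    using FG H simple_integral_diff F(2) G(2)
    by (intro tendsto_in_probability_diff[where X="\<lambda>n. simple_integral \<Lambda> (F n)" and Y="\<lambda>n. simple_integral \<Lambda> (G n)"])
      (simp_all add: simple_integral_measurable)
  have Hh: "AE s in lborel. (\<lambda>n. ?H n s) \<longlonglongrightarrow> ?h s"
  proof -
    have "AE s in lborel. (\<lambda>n. F n s) \<longlonglongrightarrow> f s" "AE s in lborel. (\<lambda>n. G n s) \<longlonglongrightarrow> g s"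
      using F(1) G(1) by (auto simp: integral_approximation_def)
    then show ?thesis by eventually_elim (rule tendsto_diff)
  qed
  show ?thesis
  proof (rule variance_eq_char_limit)
    show "norm (CLINT \<omega>|M. iexp (1 / real (Suc n) * (Z \<omega> - W \<omega>))) =
        exp (- (\<integral>s. q (1 / real (Suc n) * ?h s) \<partial>lborel))" for n
      by (rule norm_char_stochastic_limit[OF H _ lim _ fg2 Hh]) auto
    have "(\<lambda>n. \<integral>s. (real (Suc n))\<^sup>2 * q (?h s / real (Suc n)) \<partial>lborel) \<longlonglongrightarrow> (\<integral>s. \<kappa> * (?h s)\<^sup>2 / 2 \<partial>lborel)"
    proof (rule integral_dominated_convergence)
      show "integrable lborel (\<lambda>s. \<kappa> * (?h s)\<^sup>2 / 2)" using fg2 by simp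
      show "AE s in lborel. (\<lambda>n. (real (Suc n))\<^sup>2 * q (?h s / real (Suc n))) \<longlonglongrightarrow> \<kappa> * (?h s)\<^sup>2 / 2"
        by (intro AE_I2 jump_symbol_scaled_limit)
      show "AE s in lborel. norm ((real (Suc n))\<^sup>2 * q (?h s / real (Suc n))) \<le> \<kappa> * (?h s)\<^sup>2 / 2" for n
      proof (rule AE_I2)
        fix s
        have "(real (Suc n))\<^sup>2 * q (?h s / real (Suc n)) \<le> (real (Suc n))\<^sup>2 * (\<kappa> * (?h s / real (Suc n))\<^sup>2 / 2)"
          by (intro mult_left_mono jump_symbol_le) simp
        also have "\<dots> = \<kappa> * (?h s)\<^sup>2 / 2" by (simp add: power_divide del: of_nat_Suc)
        finally show "norm ((real (Suc n))\<^sup>2 * q (?h s / real (Suc n))) \<le> \<kappa> * (?h s)\<^sup>2 / 2"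
          using jump_symbol_nonneg[of "?h s / real (Suc n)"] by (simp add: abs_mult del: of_nat_Suc)
      qed
    qed measurable
    then show "(\<lambda>n. (real (Suc n))\<^sup>2 * (\<integral>s. q (1 / real (Suc n) * ?h s) \<partial>lborel)) \<longlonglongrightarrow>
        \<kappa> * (\<integral>s. (?h s)\<^sup>2 \<partial>lborel) / 2"
      by (simp del: of_nat_Suc)
  qed measurable
qed

end

section \<open>Exponentially decaying functions on the half-line\<close>

text \<open>An exponential with decay to the right grows to the left. Keeping the cut-off apart from
  a function on the whole line lets shifts and derivatives act on the smooth function and never on
  the jump at 0.\<close>

definition causal_part :: "(real \<Rightarrow> real) \<Rightarrow> real \<Rightarrow> real" where
  "causal_part f x = indicator {0..} x * f x"

definition exp_decaying :: "(real \<Rightarrow> real) \<Rightarrow> bool" where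
  "exp_decaying f \<longleftrightarrow> continuous_on UNIV f \<and> (\<exists>C e. e > 0 \<and> (\<forall>x\<ge>0. \<bar>f x\<bar> \<le> C * exp (- (e * x))))"

lemma exp_decayingE:
  assumes "exp_decaying f"
  obtains C e where "C \<ge> 0" "e > 0" "\<And>x. x \<ge> 0 \<Longrightarrow> \<bar>f x\<bar> \<le> C * exp (- (e * x))"
proof -
  obtain C e where Ce: "e > 0" "\<And>x. x \<ge> 0 \<Longrightarrow> \<bar>f x\<bar> \<le> C * exp (- (e * x))"
    using assms by (auto simp: exp_decaying_def)
  have "\<bar>f 0\<bar> \<le> C" using Ce(2)[of 0] by simp
  then have "C \<ge> 0" by linarith
  then show ?thesis using Ce that by blast
qed

lemma exp_decaying_continuous: "exp_decaying f \<Longrightarrow> continuous_on UNIV f"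
  by (simp add: exp_decaying_def)

lemma exp_decaying_isCont: "exp_decaying f \<Longrightarrow> isCont f x"
  using exp_decaying_continuous continuous_on_eq_continuous_at open_UNIV by blast

lemma exp_decaying_measurable: "exp_decaying f \<Longrightarrow> f \<in> borel_measurable borel"
  by (intro borel_measurable_continuous_onI exp_decaying_continuous)

lemma exp_decaying_bounded:
  assumes "exp_decaying f"
  obtains C where "C \<ge> 0" "\<And>x. x \<ge> 0 \<Longrightarrow> \<bar>f x\<bar> \<le> C"
proof -
  obtain C e where Ce: "C \<ge> 0" "e > 0" "\<And>x. x \<ge> 0 \<Longrightarrow> \<bar>f x\<bar> \<le> C * exp (- (e * x))"
    using exp_decayingE[OF assms] by blast
  have "\<bar>f x\<bar> \<le> C" if "x \<ge> 0" for x
  proof -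
    have "\<bar>f x\<bar> \<le> C * exp (- (e * x))" using Ce(3) that by blast
    also have "\<dots> \<le> C * 1" using Ce that by (intro mult_left_mono) auto
    finally show ?thesis by simp
  qed
  then show ?thesis using that Ce(1) by blast
qed

lemma exp_decaying_tendsto_0:
  assumes "exp_decaying f"
  shows "(f \<longlongrightarrow> 0) at_top"
proof -
  obtain C e where Ce: "C \<ge> 0" "e > 0" "\<And>x. x \<ge> 0 \<Longrightarrow> \<bar>f x\<bar> \<le> C * exp (- (e * x))"
    using exp_decayingE[OF assms] by blast
  have "((\<lambda>x. C * exp (- (e * x))) \<longlongrightarrow> C * 0) at_top"
    using Ce(2) by (intro tendsto_mult tendsto_const filterlim_compose[OF exp_at_bot]
      filterlim_compose[OF filterlim_uminus_at_bot_at_top]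
      filterlim_tendsto_pos_mult_at_top[OF tendsto_const] filterlim_ident)
  then have lim: "((\<lambda>x. C * exp (- (e * x))) \<longlongrightarrow> 0) at_top" by simp
  show ?thesis
    by (rule Lim_null_comparison[OF _ lim]) (use Ce(3) in \<open>auto simp: eventually_at_top_linorder\<close>)
qed

lemma integrable_causal_part:
  assumes f: "exp_decaying f"
  shows "integrable lborel (causal_part f)"
proof -
  obtain C e where Ce: "C \<ge> 0" "e > 0" "\<And>x. x \<ge> 0 \<Longrightarrow> \<bar>f x\<bar> \<le> C * exp (- (e * x))"
    using exp_decayingE[OF f] by blast
  note [measurable] = exp_decaying_measurable[OF f]
  have "(\<integral>\<^sup>+x. ennreal (exp (- (e * x))) * indicator {0..} x \<partial>lborel) = ennreal (0 - (- (exp (- (e * 0)) / e)))"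
  proof (rule nn_integral_FTC_atLeast)
    show "((\<lambda>x. - (exp (- (e * x)) / e)) \<longlongrightarrow> 0) at_top"
    proof -
      have "((\<lambda>x. - (exp (- (e * x)) / e)) \<longlongrightarrow> - (0 / e)) at_top"
        using Ce(2) by (intro tendsto_minus tendsto_divide tendsto_const filterlim_compose[OF exp_at_bot]
          filterlim_compose[OF filterlim_uminus_at_bot_at_top]
          filterlim_tendsto_pos_mult_at_top[OF tendsto_const] filterlim_ident) auto
      then show ?thesis by simp
    qed
    show "((\<lambda>x. - (exp (- (e * x)) / e)) has_real_derivative exp (- (e * x))) (at x)" for x
      using Ce(2) by (auto intro!: derivative_eq_intros)
  qed auto
  moreover have "(\<lambda>x. ennreal (exp (- (e * x))) * indicator {0..} x) = (\<lambda>x. ennreal (exp (- (e * x)) * indicator {0..} x))"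
    by (auto simp: fun_eq_iff indicator_def)
  ultimately have "integrable lborel (\<lambda>x. exp (- (e * x)) * indicator {0..} x)"
    by (intro integrableI_nonneg) auto
  then have int: "integrable lborel (\<lambda>x. C * (exp (- (e * x)) * indicator {0..} x))"
    by (rule integrable_mult_right)
  show ?thesis
  proof (rule Bochner_Integration.integrable_bound[OF int])
    show "causal_part f \<in> borel_measurable lborel"
      unfolding causal_part_def[abs_def] by measurable
    show "AE x in lborel. norm (causal_part f x) \<le> norm (C * (exp (- (e * x)) * indicator {0..} x))"
      using Ce by (intro AE_I2) (auto simp: causal_part_def indicator_def)
  qed
qed

lemma exp_decaying_mult_bounded:
  assumes f: "exp_decaying f" and g: "continuous_on UNIV g" and C: "\<And>x. x \<ge> 0 \<Longrightarrow> \<bar>g x\<bar> \<le> C"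
  shows "exp_decaying (\<lambda>x. f x * g x)"
proof -
  obtain D e where De: "D \<ge> 0" "e > 0" "\<And>x. x \<ge> 0 \<Longrightarrow> \<bar>f x\<bar> \<le> D * exp (- (e * x))"
    using exp_decayingE[OF f] by blast
  have "\<bar>f x * g x\<bar> \<le> (D * C) * exp (- (e * x))" if "x \<ge> 0" for x
  proof -
    have "\<bar>f x * g x\<bar> \<le> (D * exp (- (e * x))) * C"
      unfolding abs_mult using De C that by (intro mult_mono) auto
    then show ?thesis by (simp add: ac_simps)
  qed
  then show ?thesis
    using De(2) g exp_decaying_continuous[OF f] unfolding exp_decaying_def
    by (blast intro: continuous_on_mult)
qed

lemma exp_decaying_mult:
  assumes f: "exp_decaying f" and g: "exp_decaying g"
  shows "exp_decaying (\<lambda>x. f x * g x)"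
  using exp_decaying_bounded[OF g] exp_decaying_mult_bounded[OF f exp_decaying_continuous[OF g]] by metis

lemma exp_decaying_linear:
  assumes f: "exp_decaying f" and g: "exp_decaying g"
  shows "exp_decaying (\<lambda>x. r * f x + s * g x)"
proof -
  obtain C e where C: "C \<ge> 0" "e > 0" "\<And>x. x \<ge> 0 \<Longrightarrow> \<bar>f x\<bar> \<le> C * exp (- (e * x))"
    using exp_decayingE[OF f] by blast
  obtain D c where D: "D \<ge> 0" "c > 0" "\<And>x. x \<ge> 0 \<Longrightarrow> \<bar>g x\<bar> \<le> D * exp (- (c * x))"
    using exp_decayingE[OF g] by blast
  have "\<bar>r * f x + s * g x\<bar> \<le> (\<bar>r\<bar> * C + \<bar>s\<bar> * D) * exp (- (min e c * x))" if "x \<ge> 0" for x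
  proof -
    have e: "exp (- (e * x)) \<le> exp (- (min e c * x))" "exp (- (c * x)) \<le> exp (- (min e c * x))"
      using that by (auto intro!: mult_right_mono)
    have "\<bar>r * f x + s * g x\<bar> \<le> \<bar>r\<bar> * \<bar>f x\<bar> + \<bar>s\<bar> * \<bar>g x\<bar>"
      by (simp add: abs_mult[symmetric] abs_triangle_ineq)
    also have "\<dots> \<le> \<bar>r\<bar> * (C * exp (- (min e c * x))) + \<bar>s\<bar> * (D * exp (- (min e c * x)))"
      using C(3)[OF that] D(3)[OF that] mult_left_mono[OF e(1) C(1)] mult_left_mono[OF e(2) D(1)]
      by (intro add_mono mult_left_mono) auto
    finally show ?thesis by (simp add: algebra_simps)
  qed
  moreover have "min e c > 0" using C(2) D(2) by simp
  moreover have "continuous_on UNIV (\<lambda>x. r * f x + s * g x)"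
    using f g by (intro continuous_intros exp_decaying_continuous)
  ultimately show ?thesis unfolding exp_decaying_def by blast
qed

lemma causal_part_mult: "causal_part f x * causal_part g x = causal_part (\<lambda>x. f x * g x) x"
  by (simp add: causal_part_def indicator_def)

text \<open>Since \<open>f\<close> may change sign, the integrals over \<open>[0, n]\<close> are
  passed to the limit by domination with \<open>\<bar>causal_part f\<bar>\<close>.\<close>

lemma integral_causal_part_FTC:
  assumes F: "\<And>x. (F has_real_derivative f x) (at x)" and f: "exp_decaying f"
    and lim: "(F \<longlongrightarrow> 0) at_top"
  shows "(\<integral>x. causal_part f x \<partial>lborel) = - F 0"
proof -
  note [measurable] = exp_decaying_measurable[OF f]
  have "(\<lambda>n. \<integral>x. f x * indicator {0..real n} x \<partial>lborel) \<longlonglongrightarrow> (\<integral>x. causal_part f x \<partial>lborel)"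
  proof (rule integral_dominated_convergence)
    show "integrable lborel (\<lambda>x. \<bar>causal_part f x\<bar>)"
      using integrable_causal_part[OF f] by simp
    show "AE x in lborel. (\<lambda>n. f x * indicator {0..real n} x) \<longlonglongrightarrow> causal_part f x"
    proof (intro AE_I2 tendsto_eventually)
      fix x :: real
      have "eventually (\<lambda>n. x \<le> real n) sequentially"
        using filterlim_real_sequentially by (simp add: filterlim_at_top)
      then show "eventually (\<lambda>n. f x * indicator {0..real n} x = causal_part f x) sequentially"
        by eventually_elim (simp add: causal_part_def indicator_def)
    qed
  qed (auto simp: causal_part_def[abs_def] indicator_def)
  moreover have "(\<integral>x. f x * indicator {0..real n} x \<partial>lborel) = F (real n) - F 0" for n
    using F exp_decaying_isCont[OF f] by (intro integral_FTC_Icc_real) auto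
  moreover have "(\<lambda>n. F (real n) - F 0) \<longlonglongrightarrow> 0 - F 0"
    by (intro tendsto_intros filterlim_compose[OF lim filterlim_real_sequentially])
  ultimately show ?thesis using LIMSEQ_unique by fastforce
qed

section \<open>Variogram of the one-dimensional causal moving average with kernel \<open>P\<close>
  and unit noise\<close>

definition increment_energy :: "(real \<Rightarrow> real) \<Rightarrow> real \<Rightarrow> real" where
  "increment_energy P \<tau> = (\<integral>s. (causal_part P (\<tau> - s) - causal_part P (- s))\<^sup>2 \<partial>lborel)"

lemma integrable_causal_part_reflect:
  "exp_decaying f \<Longrightarrow> integrable lborel (\<lambda>s. causal_part f (\<tau> - s))"
  using lborel_integrable_real_affine[OF integrable_causal_part, of f "-1" \<tau>] by simp

lemma integral_causal_part_reflect:
  "(\<integral>s. causal_part f (\<tau> - s) \<partial>lborel) = (\<integral>x. causal_part f x \<partial>lborel)"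
  using lborel_integral_real_affine[of "-1" "causal_part f" \<tau>] by simp

lemma exp_decaying_shift:
  assumes f: "exp_decaying f" and "\<tau> \<ge> 0"
  shows "exp_decaying (\<lambda>x. f (x + \<tau>))"
proof -
  obtain C e where Ce: "C \<ge> 0" "e > 0" "\<And>x. x \<ge> 0 \<Longrightarrow> \<bar>f x\<bar> \<le> C * exp (- (e * x))"
    using exp_decayingE[OF f] by blast
  have "\<bar>f (x + \<tau>)\<bar> \<le> C * exp (- (e * x))" if "x \<ge> 0" for x
  proof -
    have "\<bar>f (x + \<tau>)\<bar> \<le> C * exp (- (e * (x + \<tau>)))" using Ce(3)[of "x + \<tau>"] that \<open>\<tau> \<ge> 0\<close> by simp
    also have "\<dots> \<le> C * exp (- (e * x))" using Ce \<open>\<tau> \<ge> 0\<close> by (intro mult_left_mono) auto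
    finally show ?thesis .
  qed
  moreover have "continuous_on UNIV (\<lambda>x. f (x + \<tau>))"
    by (rule continuous_on_compose2[OF exp_decaying_continuous[OF f]]) (auto intro: continuous_intros)
  ultimately show ?thesis using Ce(2) unfolding exp_decaying_def by blast
qed

text \<open>For \<open>\<tau> \<ge> 0\<close> the condition \<open>- s \<ge> 0\<close> implies
  \<open>\<tau> - s \<ge> 0\<close>, so both mixed products carry the cut-off at \<open>- s\<close>.
  It is written \<open>0 - s\<close> to be an instance of the reflection lemmas.\<close>

lemma causal_part_increment_mult:
  assumes "\<tau> \<ge> 0"
  shows "(causal_part P (\<tau> - s) - causal_part P (- s)) * (causal_part Q (\<tau> - s) - causal_part Q (- s)) =
    causal_part (\<lambda>x. P x * Q x) (\<tau> - s) + causal_part (\<lambda>x. P x * Q x) (0 - s)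
      - causal_part (\<lambda>x. P (x + \<tau>) * Q x) (0 - s) - causal_part (\<lambda>x. P x * Q (x + \<tau>)) (0 - s)"
  using assms by (simp add: causal_part_def indicator_def algebra_simps)

lemma integrable_causal_part_increment:
  assumes P: "exp_decaying P" and Q: "exp_decaying Q" and "\<tau> \<ge> 0"
  shows "integrable lborel (\<lambda>s. (causal_part P (\<tau> - s) - causal_part P (- s)) *
    (causal_part Q (\<tau> - s) - causal_part Q (- s)))"
  unfolding causal_part_increment_mult[OF \<open>\<tau> \<ge> 0\<close>]
  by (intro Bochner_Integration.integrable_add Bochner_Integration.integrable_diff
    integrable_causal_part_reflect exp_decaying_mult exp_decaying_shift P Q \<open>\<tau> \<ge> 0\<close>)

lemma increment_energy_eq:
  assumes P: "exp_decaying P" and "\<tau> \<ge> 0"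
  shows "increment_energy P \<tau> =
    2 * (\<integral>x. causal_part (\<lambda>x. P x * P x) x \<partial>lborel) - 2 * (\<integral>x. causal_part (\<lambda>x. P (x + \<tau>) * P x) x \<partial>lborel)"
proof -
  have int: "integrable lborel (\<lambda>s. causal_part (\<lambda>x. P x * P x) (t - s))"
    "integrable lborel (\<lambda>s. causal_part (\<lambda>x. P (x + \<tau>) * P x) (t - s))"
    "integrable lborel (\<lambda>s. causal_part (\<lambda>x. P x * P (x + \<tau>)) (t - s))" for t
    by (intro integrable_causal_part_reflect exp_decaying_mult exp_decaying_shift P \<open>\<tau> \<ge> 0\<close>)+
  show ?thesis
    unfolding increment_energy_def power2_eq_square causal_part_increment_mult[OF \<open>\<tau> \<ge> 0\<close>]
    using int integral_causal_part_reflect[of "\<lambda>x. P x * P x" \<tau>] integral_causal_part_reflect[of "\<lambda>x. P x * P x" 0]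
      integral_causal_part_reflect[of "\<lambda>x. P (x + \<tau>) * P x" 0]
    by (simp add: mult.commute[of "P _" "P (_ + \<tau>)"] del: diff_0)
qed

text \<open>Only the autocovariance depends on the lag, and it dies out: the shifted factor tends to
  0 while its bound times \<open>\<bar>P\<bar>\<close> dominates.\<close>

lemma increment_energy_at_top:
  assumes P: "exp_decaying P"
  shows "(\<lambda>n. increment_energy P (real n)) \<longlonglongrightarrow> 2 * (\<integral>x. causal_part (\<lambda>x. P x * P x) x \<partial>lborel)"
proof -
  note [measurable] = exp_decaying_measurable[OF P]
  obtain C where C: "C \<ge> 0" "\<And>x. x \<ge> 0 \<Longrightarrow> \<bar>P x\<bar> \<le> C"
    using exp_decaying_bounded[OF P] by blast
  have "(\<lambda>n. \<integral>x. causal_part (\<lambda>x. P (x + real n) * P x) x \<partial>lborel) \<longlonglongrightarrow> integral\<^sup>L lborel (\<lambda>x::real. 0)"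
  proof (rule integral_dominated_convergence)
    show "integrable lborel (\<lambda>x. C * \<bar>causal_part P x\<bar>)"
      using integrable_causal_part[OF P] by simp
    show "AE x in lborel. (\<lambda>n. causal_part (\<lambda>x. P (x + real n) * P x) x) \<longlonglongrightarrow> 0"
    proof (rule AE_I2)
      fix x
      have "filterlim (\<lambda>n. x + real n) at_top sequentially"
        by (intro filterlim_tendsto_add_at_top[OF tendsto_const] filterlim_real_sequentially)
      from filterlim_compose[OF exp_decaying_tendsto_0[OF P] this]
      have "(\<lambda>n. indicator {0..} x * (P (x + real n) * P x)) \<longlonglongrightarrow> indicator {0..} x * (0 * P x)"
        by (intro tendsto_mult tendsto_const)
      then show "(\<lambda>n. causal_part (\<lambda>x. P (x + real n) * P x) x) \<longlonglongrightarrow> 0"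
        by (simp add: causal_part_def)
    qed
    show "AE x in lborel. norm (causal_part (\<lambda>x. P (x + real n) * P x) x) \<le> C * \<bar>causal_part P x\<bar>" for n
      using C by (intro AE_I2) (auto simp: causal_part_def indicator_def abs_mult intro!: mult_right_mono)
  qed (auto simp: causal_part_def[abs_def])
  then have "(\<lambda>n. 2 * (\<integral>x. causal_part (\<lambda>x. P x * P x) x \<partial>lborel) -
      2 * (\<integral>x. causal_part (\<lambda>x. P (x + real n) * P x) x \<partial>lborel)) \<longlonglongrightarrow>
      2 * (\<integral>x. causal_part (\<lambda>x. P x * P x) x \<partial>lborel) - 2 * integral\<^sup>L lborel (\<lambda>x::real. 0)"
    by (intro tendsto_intros)
  then show ?thesis by (simp add: increment_energy_eq[OF P])
qed

text \<open>The right derivative of the autocovariance at lag 0 is the integral of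
  \<open>P' * P\<close>, which is \<open>- (P 0)^2 / 2\<close>. The linear growth of the variogram
  thus comes from the jump of the causal kernel.\<close>

lemma increment_energy_at_0:
  assumes P: "exp_decaying P" and P': "exp_decaying P'"
    and deriv: "\<And>x. (P has_real_derivative P' x) (at x)"
  shows "(\<lambda>n. real (Suc n) * increment_energy P (1 / real (Suc n))) \<longlonglongrightarrow> (P 0)\<^sup>2"
proof -
  note [measurable] = exp_decaying_measurable[OF P] exp_decaying_measurable[OF P']
  obtain C where C: "C \<ge> 0" "\<And>x. x \<ge> 0 \<Longrightarrow> \<bar>P' x\<bar> \<le> C"
    using exp_decaying_bounded[OF P'] by blast
  define t where "t n = 1 / real (Suc n)" for n
  have t: "t n > 0" for n by (simp add: t_def)
  have t_lim: "t \<longlonglongrightarrow> 0" unfolding t_def using LIMSEQ_inverse_real_of_nat by (simp add: inverse_eq_divide)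
  define D where "D n x = causal_part (\<lambda>x. (P (x + t n) - P x) / t n * P x) x" for n x
  \<comment> \<open>The mean value theorem bounds all difference quotients by a bound of
    \<open>P'\<close> on the half-line, which gives the dominating function.\<close>
  have lip: "\<bar>(P (x + t n) - P x) / t n\<bar> \<le> C" if "x \<ge> 0" for x n
  proof -
    obtain z where z: "z > x" "z < x + t n" "P (x + t n) - P x = (x + t n - x) * P' z"
      using MVT2[of x "x + t n" P P'] t[of n] deriv by auto
    then have "(P (x + t n) - P x) / t n = P' z" using t[of n] by simp
    then show ?thesis using C(2)[of z] z(1) that by simp
  qed
  have "(\<lambda>n. \<integral>x. D n x \<partial>lborel) \<longlonglongrightarrow> (\<integral>x. causal_part (\<lambda>x. P' x * P x) x \<partial>lborel)"
  proof (rule integral_dominated_convergence)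
    show "integrable lborel (\<lambda>x. C * \<bar>causal_part P x\<bar>)"
      using integrable_causal_part[OF P] by simp
    show "AE x in lborel. (\<lambda>n. D n x) \<longlonglongrightarrow> causal_part (\<lambda>x. P' x * P x) x"
    proof (rule AE_I2)
      fix x
      have "((\<lambda>h. (P (x + h) - P x) / h) \<longlongrightarrow> P' x) (at 0)"
        using deriv[of x] by (simp add: DERIV_def)
      moreover have "filterlim t (at 0) sequentially"
        using t t_lim by (intro filterlim_atI) (auto simp: less_imp_neq[symmetric])
      ultimately have "(\<lambda>n. (P (x + t n) - P x) / t n) \<longlonglongrightarrow> P' x"
        by (rule filterlim_compose)
      then show "(\<lambda>n. D n x) \<longlonglongrightarrow> causal_part (\<lambda>x. P' x * P x) x"
        unfolding D_def causal_part_def by (intro tendsto_mult tendsto_const)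
    qed
    show "AE x in lborel. norm (D n x) \<le> C * \<bar>causal_part P x\<bar>" for n
    proof (rule AE_I2)
      fix x
      show "norm (D n x) \<le> C * \<bar>causal_part P x\<bar>"
      proof (cases "x \<ge> 0")
        case True
        then show ?thesis
          using mult_right_mono[OF lip[OF True, of n], of "\<bar>P x\<bar>"]
          by (simp add: D_def causal_part_def abs_mult)
      qed (simp add: D_def causal_part_def)
    qed
  qed (simp_all add: D_def[abs_def] causal_part_def[abs_def])
  moreover have "(\<integral>x. causal_part (\<lambda>x. P' x * P x) x \<partial>lborel) = - ((P 0)\<^sup>2 / 2)"
  proof (rule integral_causal_part_FTC)
    show "((\<lambda>x. (P x)\<^sup>2 / 2) has_real_derivative P' x * P x) (at x)" for x
      using deriv[of x] by (auto intro!: derivative_eq_intros)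
    have "((\<lambda>x. (P x)\<^sup>2 / 2) \<longlongrightarrow> 0\<^sup>2 / 2) at_top"
      by (intro tendsto_intros exp_decaying_tendsto_0[OF P]) simp
    then show "((\<lambda>x. (P x)\<^sup>2 / 2) \<longlongrightarrow> 0) at_top" by simp
  qed (rule exp_decaying_mult[OF P' P])
  moreover have "real (Suc n) * increment_energy P (t n) = - 2 * (\<integral>x. D n x \<partial>lborel)" for n
  proof -
    have int: "integrable lborel (causal_part (\<lambda>x. P (x + t n) * P x))" "integrable lborel (causal_part (\<lambda>x. P x * P x))"
      using t[of n] by (intro integrable_causal_part exp_decaying_mult exp_decaying_shift P; simp)+
    have "D n x = real (Suc n) * (causal_part (\<lambda>x. P (x + t n) * P x) x - causal_part (\<lambda>x. P x * P x) x)" for x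
      by (simp add: D_def causal_part_def t_def algebra_simps del: of_nat_Suc)
    then have "(\<integral>x. D n x \<partial>lborel) = real (Suc n) *
        ((\<integral>x. causal_part (\<lambda>x. P (x + t n) * P x) x \<partial>lborel) - (\<integral>x. causal_part (\<lambda>x. P x * P x) x \<partial>lborel))"
      using int by (simp only: integral_mult_right_zero Bochner_Integration.integral_diff)
    then show ?thesis
      using t[of n] by (simp add: increment_energy_eq[OF P] right_diff_distrib del: of_nat_Suc)
  qed
  ultimately have "(\<lambda>n. real (Suc n) * increment_energy P (t n)) \<longlonglongrightarrow> - 2 * (- ((P 0)\<^sup>2 / 2))"
    by (simp only:) (intro tendsto_intros)
  then show ?thesis by (simp add: t_def)
qed

section \<open>Exponentials of companion matrices\<close>

lemma sums_matrix_componentwise: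
  fixes f :: "nat \<Rightarrow> real^'m^'n"
  assumes "\<And>i j. (\<lambda>k. f k $ i $ j) sums (S $ i $ j)"
  shows "f sums S"
  using assms unfolding sums_def by (intro vec_tendstoI) simp

locale stable_companion =
  fixes p :: "real poly" and l1 l2 :: complex
  assumes distinct: "l1 \<noteq> l2"
    and trace: "l1 + l2 = - complex_of_real (coeff p 1)"
    and det: "l1 * l2 = complex_of_real (coeff p 0)"
    and stable: "Re l1 < 0" "Re l2 < 0"
begin

abbreviation "c0 \<equiv> coeff p 0"
abbreviation "c1 \<equiv> coeff p 1"

text \<open>Differentiation acts by \<open>u \<mapsto> u * l1\<close> and
  \<open>v \<mapsto> v * l2\<close>. The roots are real or conjugate, so for \<open>u\<close>,
  \<open>v\<close> equal to the same power of \<open>l1\<close>, \<open>l2\<close> the quotient is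
  already real and \<open>Re\<close> only changes the type. With both equal to 1 this is the impulse
  response of the autoregressive equation.\<close>

definition exp_comb :: "complex \<Rightarrow> complex \<Rightarrow> real \<Rightarrow> real" where
  "exp_comb u v x = Re ((u * exp (l1 * of_real x) - v * exp (l2 * of_real x)) / (l1 - l2))"

definition h :: "real \<Rightarrow> real" where "h = exp_comb 1 1"

definition dh :: "real \<Rightarrow> real" where "dh = exp_comb l1 l2"

lemma exp_comb_has_derivative:
  "(exp_comb u v has_real_derivative exp_comb (u * l1) (v * l2) x) (at x)"
proof -
  have e: "((\<lambda>x. exp (l * of_real x)) has_vector_derivative exp (l * of_real x) * l) (at x)" for l :: complex
    using exp_scaleR_has_vector_derivative_right[of l x UNIV] by (simp add: scaleR_conv_of_real mult.commute[of _ l])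
  have "((\<lambda>x. (u * exp (l1 * of_real x) - v * exp (l2 * of_real x)) / (l1 - l2)) has_vector_derivative
      (u * (exp (l1 * of_real x) * l1) - v * (exp (l2 * of_real x) * l2)) / (l1 - l2)) (at x)"
    by (intro has_vector_derivative_divide has_vector_derivative_diff has_vector_derivative_mult_right e)
  then show ?thesis
    unfolding exp_comb_def[abs_def] by (auto dest: has_field_derivative_Re simp: ac_simps)
qed

lemma exp_decaying_exp_comb: "exp_decaying (exp_comb u v)"
proof -
  define e where "e = min (- Re l1) (- Re l2)"
  define C where "C = (norm u + norm v) / norm (l1 - l2)"
  have "\<bar>exp_comb u v x\<bar> \<le> C * exp (- (e * x))" if "x \<ge> 0" for x
  proof -
    have le: "Re l1 * x \<le> - (e * x)" "Re l2 * x \<le> - (e * x)"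
      using mult_right_mono[of e "- Re l1" x] mult_right_mono[of e "- Re l2" x] that by (auto simp: e_def)
    have "\<bar>exp_comb u v x\<bar> \<le> norm ((u * exp (l1 * of_real x) - v * exp (l2 * of_real x)) / (l1 - l2))"
      unfolding exp_comb_def by (rule abs_Re_le_cmod)
    also have "\<dots> \<le> (norm u * exp (Re l1 * x) + norm v * exp (Re l2 * x)) / norm (l1 - l2)"
      unfolding norm_divide
      by (intro divide_right_mono order_trans[OF norm_triangle_ineq4]) (simp_all add: norm_mult)
    also have "\<dots> \<le> (norm u * exp (- (e * x)) + norm v * exp (- (e * x))) / norm (l1 - l2)"
      using le by (intro divide_right_mono add_mono mult_left_mono) auto
    finally show ?thesis by (simp add: C_def distrib_right add_divide_distrib)
  qed
  moreover have "e > 0" using stable by (simp add: e_def)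
  moreover have "continuous_on UNIV (exp_comb u v)"
    by (intro continuous_at_imp_continuous_on ballI DERIV_isCont[OF exp_comb_has_derivative])
  ultimately show ?thesis unfolding exp_decaying_def by blast
qed

lemma exp_decaying_h: "exp_decaying h" and exp_decaying_dh: "exp_decaying dh"
  unfolding h_def dh_def by (rule exp_decaying_exp_comb)+

lemma h_has_derivative: "(h has_real_derivative dh x) (at x)"
  unfolding h_def dh_def using exp_comb_has_derivative[of 1 1 x] by simp

lemma quadratic: "l1 * l1 = - c1 * l1 - c0" "l2 * l2 = - c1 * l2 - c0"
  using trace det by (auto simp: eq_neg_iff_add_eq_0) (algebra+)

lemma exp_comb_ode: "exp_comb (l1 * l1) (l2 * l2) x = - c1 * dh x - c0 * h x"
proof -
  have "((l1 * l1) * exp (l1 * of_real x) - (l2 * l2) * exp (l2 * of_real x)) / (l1 - l2) =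
      - of_real c1 * ((l1 * exp (l1 * of_real x) - l2 * exp (l2 * of_real x)) / (l1 - l2))
      - of_real c0 * ((1 * exp (l1 * of_real x) - 1 * exp (l2 * of_real x)) / (l1 - l2))"
    unfolding quadratic times_divide_eq_right diff_divide_distrib[symmetric]
    by (simp add: algebra_simps)
  moreover have "Re (- of_real c1 * z - of_real c0 * w) = - c1 * Re z - c0 * Re w" for z w
    by simp
  ultimately show ?thesis
    unfolding exp_comb_def h_def dh_def by (simp only:)
qed

lemma dh_has_derivative: "(dh has_real_derivative - c1 * dh x - c0 * h x) (at x)"
  using exp_comb_has_derivative[of l1 l2 x] unfolding exp_comb_ode by (simp only: dh_def)

lemma h_0: "h 0 = 0" and dh_0: "dh 0 = 1"
  using distinct by (simp_all add: h_def dh_def exp_comb_def del: Re_divide)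

lemma c1_nonzero: "c1 \<noteq> 0" and c0_nonzero: "c0 \<noteq> 0"
proof -
  have "Re (l1 + l2) = - c1" unfolding trace by simp
  then show "c1 \<noteq> 0" using stable by auto
  show "c0 \<noteq> 0" using det stable by auto
qed

text \<open>The Lucas sequence of the polynomial; \<open>u k\<close> is the \<open>k\<close>-th
  derivative of \<open>h\<close> at 0.\<close>

fun u :: "nat \<Rightarrow> real" where
  "u 0 = 0"
| "u (Suc 0) = 1"
| "u (Suc (Suc k)) = - c1 * u (Suc k) - c0 * u k"

lemma of_real_u: "complex_of_real (u k) = (l1 ^ k - l2 ^ k) / (l1 - l2)"
proof (induction k rule: u.induct)
  case (3 k)
  have "l1 ^ Suc (Suc k) - l2 ^ Suc (Suc k) = (l1 * l1) * l1 ^ k - (l2 * l2) * l2 ^ k"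
    by simp
  also have "\<dots> = - of_real c1 * (l1 ^ Suc k - l2 ^ Suc k) - of_real c0 * (l1 ^ k - l2 ^ k)"
    unfolding quadratic by (simp add: algebra_simps)
  finally have "(l1 ^ Suc (Suc k) - l2 ^ Suc (Suc k)) / (l1 - l2) =
      - of_real c1 * ((l1 ^ Suc k - l2 ^ Suc k) / (l1 - l2)) - of_real c0 * ((l1 ^ k - l2 ^ k) / (l1 - l2))"
    by (simp only: times_divide_eq_right diff_divide_distrib[symmetric])
  then show ?case
    unfolding u.simps of_real_diff of_real_mult of_real_minus 3 by (rule sym)
qed (use distinct in auto)

lemma sums_u_shift: "(\<lambda>k. x ^ k / fact k * u (k + m)) sums exp_comb (l1 ^ m) (l2 ^ m) x"
proof -
  have e: "(\<lambda>k. l ^ m * ((l * of_real x) ^ k /\<^sub>R fact k)) sums (l ^ m * exp (l * of_real x))" for l :: complex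
    by (intro sums_mult exp_converges)
  have "(\<lambda>k. (l1 ^ m * ((l1 * of_real x) ^ k /\<^sub>R fact k) - l2 ^ m * ((l2 * of_real x) ^ k /\<^sub>R fact k)) / (l1 - l2)) sums
      ((l1 ^ m * exp (l1 * of_real x) - l2 ^ m * exp (l2 * of_real x)) / (l1 - l2))"
    by (intro sums_divide sums_diff e)
  moreover have "(l1 ^ m * ((l1 * of_real x) ^ k /\<^sub>R fact k) - l2 ^ m * ((l2 * of_real x) ^ k /\<^sub>R fact k)) / (l1 - l2) =
      complex_of_real (x ^ k / fact k * u (k + m))" for k
    by (simp add: of_real_u scaleR_conv_of_real power_mult_distrib power_add field_simps)
  ultimately have "(\<lambda>k. complex_of_real (x ^ k / fact k * u (k + m))) sums
      ((l1 ^ m * exp (l1 * of_real x) - l2 ^ m * exp (l2 * of_real x)) / (l1 - l2))"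
    by (simp only:)
  from sums_Re[OF this] show ?thesis by (simp add: exp_comb_def del: of_real_mult of_real_divide Re_divide)
qed

text \<open>Cayley-Hamilton: the \<open>k\<close>-th power of the companion matrix is
  \<open>u k\<close> times the matrix plus \<open>u (Suc k) + c1 * u k\<close> times the
  identity.\<close>

lemma companion_power:
  "((**) (x *\<^sub>R companion_matrix2 p) ^^ k) (mat 1) =
    x ^ k *\<^sub>R vector [vector [u (Suc k) + c1 * u k, u k], vector [- c0 * u k, u (Suc k)]]"
proof (induction k)
  case 0
  show ?case by (simp add: vec_eq_iff forall_2 mat_def)
next
  case (Suc k)
  show ?case
    unfolding funpow.simps comp_apply Suc
    by (simp add: vec_eq_iff forall_2 matrix_matrix_mult_def sum_2 companion_matrix2_def algebra_simps)
qed

lemma matrix_exp_companion: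
  "matrix_exp (x *\<^sub>R companion_matrix2 p) =
    vector [vector [dh x + c1 * h x, h x], vector [- c0 * h x, dh x]]"
proof -
  have s0: "(\<lambda>k. x ^ k / fact k * u k) sums h x" and s1: "(\<lambda>k. x ^ k / fact k * u (Suc k)) sums dh x"
    using sums_u_shift[of x 0] sums_u_shift[of x 1] by (simp_all add: h_def dh_def)
  have s: "(\<lambda>k. x ^ k / fact k * (r * u k + t * u (Suc k))) sums (r * h x + t * dh x)" for r t
    using sums_add[OF sums_mult[OF s0, of r] sums_mult[OF s1, of t]] by (simp add: algebra_simps)
  have "(\<lambda>k. (1 / fact k) *\<^sub>R (((**) (x *\<^sub>R companion_matrix2 p) ^^ k) (mat 1))) sums
      vector [vector [dh x + c1 * h x, h x], vector [- c0 * h x, dh x]]"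
  proof (rule sums_matrix_componentwise)
    fix i j :: 2
    show "(\<lambda>k. ((1 / fact k) *\<^sub>R (((**) (x *\<^sub>R companion_matrix2 p) ^^ k) (mat 1))) $ i $ j) sums
        (vector [vector [dh x + c1 * h x, h x], vector [- c0 * h x, dh x]] :: real^2^2) $ i $ j"
      using exhaust_2[of i] exhaust_2[of j] s[of c1 1] s[of 1 0] s[of "- c0" 0] s[of 0 1]
      by (auto simp: companion_power add.commute)
  qed
  then show ?thesis unfolding matrix_exp_def by (rule sums_unique[symmetric])
qed

text \<open>Multiplying \<open>h'' + c1 h' + c0 h = 0\<close> by \<open>h\<close> and by \<open>h'\<close> and integrating by parts.\<close>

lemma gram_h_dh: "(\<integral>x. causal_part (\<lambda>x. h x * dh x) x \<partial>lborel) = 0"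
  and gram_dh_dh: "2 * c1 * (\<integral>x. causal_part (\<lambda>x. dh x * dh x) x \<partial>lborel) = 1"
  and gram_h_h: "c0 * (\<integral>x. causal_part (\<lambda>x. h x * h x) x \<partial>lborel) =
    (\<integral>x. causal_part (\<lambda>x. dh x * dh x) x \<partial>lborel)"
proof -
  let ?I = "\<lambda>f. \<integral>x. causal_part f x \<partial>lborel"
  note dec = exp_decaying_mult[OF exp_decaying_h exp_decaying_h] exp_decaying_mult[OF exp_decaying_h exp_decaying_dh]
    exp_decaying_mult[OF exp_decaying_dh exp_decaying_dh]
  have int: "integrable lborel (causal_part (\<lambda>x. h x * h x))" "integrable lborel (causal_part (\<lambda>x. h x * dh x))"
    "integrable lborel (causal_part (\<lambda>x. dh x * dh x))"
    using dec by (auto intro: integrable_causal_part)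
  have lim: "((\<lambda>x. h x * h x / 2) \<longlongrightarrow> 0) at_top" "((\<lambda>x. h x * dh x) \<longlongrightarrow> 0) at_top"
    "((\<lambda>x. dh x * dh x / 2) \<longlongrightarrow> 0) at_top"
    using dec[THEN exp_decaying_tendsto_0] by (auto intro: tendsto_divide_zero)
  have "?I (\<lambda>x. h x * dh x) = - (h 0 * h 0 / 2)"
    using lim(1) dec(2) by (intro integral_causal_part_FTC[where F="\<lambda>x. h x * h x / 2"])
      (auto intro!: derivative_eq_intros h_has_derivative)
  then show hdh: "?I (\<lambda>x. h x * dh x) = 0" by (simp add: h_0)
  \<comment> \<open>The derivative of \<open>h * dh\<close> with the second derivative eliminated,
    written as nested combinations \<open>r * f + s * g\<close> to match
    \<open>exp_decaying_linear\<close>.\<close>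
  have "?I (\<lambda>x. 1 * (dh x * dh x) + 1 * (- c1 * (h x * dh x) + - c0 * (h x * h x))) = - (h 0 * dh 0)"
    using lim(2) dec by (intro integral_causal_part_FTC[where F="\<lambda>x. h x * dh x"] exp_decaying_linear)
      (auto intro!: derivative_eq_intros h_has_derivative dh_has_derivative simp: algebra_simps)
  moreover have "causal_part (\<lambda>x. 1 * (dh x * dh x) + 1 * (- c1 * (h x * dh x) + - c0 * (h x * h x))) x =
      causal_part (\<lambda>x. dh x * dh x) x - c1 * causal_part (\<lambda>x. h x * dh x) x - c0 * causal_part (\<lambda>x. h x * h x) x" for x
    by (simp add: causal_part_def algebra_simps)
  ultimately have "?I (\<lambda>x. dh x * dh x) - c1 * ?I (\<lambda>x. h x * dh x) - c0 * ?I (\<lambda>x. h x * h x) = 0"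
    using int by (simp add: h_0)
  then show "c0 * ?I (\<lambda>x. h x * h x) = ?I (\<lambda>x. dh x * dh x)" using hdh by simp
  have "((\<lambda>x. dh x * dh x / 2) has_real_derivative - c1 * (dh x * dh x) + - c0 * (h x * dh x)) (at x)" for x
    by (rule DERIV_cong[OF DERIV_cdivide[OF DERIV_mult[OF dh_has_derivative dh_has_derivative]]])
      (simp add: field_simps)
  then have "?I (\<lambda>x. - c1 * (dh x * dh x) + - c0 * (h x * dh x)) = - (dh 0 * dh 0 / 2)"
    using lim(3) dec by (intro integral_causal_part_FTC[where F="\<lambda>x. dh x * dh x / 2"] exp_decaying_linear)
  moreover have "causal_part (\<lambda>x. - c1 * (dh x * dh x) + - c0 * (h x * dh x)) x =
      - c1 * causal_part (\<lambda>x. dh x * dh x) x - c0 * causal_part (\<lambda>x. h x * dh x) x" for x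
    by (simp add: causal_part_def algebra_simps)
  ultimately have "- c1 * ?I (\<lambda>x. dh x * dh x) - c0 * ?I (\<lambda>x. h x * dh x) = - 1 / 2"
    using int by (simp add: dh_0)
  then show "2 * c1 * ?I (\<lambda>x. dh x * dh x) = 1" using hdh by simp
qed

end

section \<open>The variogram on the axes\<close>

text \<open>Lebesgue measure on the plane is the image of the product measure indexed by the two
  basis vectors. Leaving \<open>i\<close> and \<open>j\<close> open serves both axes.\<close>

lemma has_bochner_integral_plane_product:
  fixes p q :: "real \<Rightarrow> real" and i j :: 2
  assumes p: "integrable lborel p" and q: "integrable lborel q" and "i \<noteq> j"
  shows "has_bochner_integral lborel (\<lambda>s::real^2. p (s $ i) * q (s $ j))
    ((\<integral>x. p x \<partial>lborel) * (\<integral>x. q x \<partial>lborel))"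
proof -
  interpret product_sigma_finite "\<lambda>_::real^2. lborel :: real measure" ..
  have [measurable]: "p \<in> borel_measurable borel" "q \<in> borel_measurable borel"
    using p q by auto
  let ?b = "\<lambda>i::2. axis i (1::real)"
  have UNIV: "(UNIV :: 2 set) = {i, j}"
    using exhaust_2[of i] exhaust_2[of j] \<open>i \<noteq> j\<close> by (auto simp: UNIV_2)
  have Basis: "(Basis :: (real^2) set) = {?b i, ?b j}"
    unfolding Basis_vec_def using UNIV by auto
  have bij: "?b i \<noteq> ?b j" using \<open>i \<noteq> j\<close> by (simp add: axis_eq_axis)
  define F where "F b = (if b = ?b i then p else q)" for b
  let ?T = "\<lambda>f::real^2 \<Rightarrow> real. \<Sum>b\<in>Basis. f b *\<^sub>R b"
  have T: "?T \<in> measurable (\<Pi>\<^sub>M b\<in>Basis. lborel) borel"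
    by measurable
  have comp: "?T f $ i = f (?b i)" "?T f $ j = f (?b j)" for f
    using bij \<open>i \<noteq> j\<close> unfolding Basis by (auto simp: axis_def)
  have F_int: "integrable lborel (F b)" for b
    using p q by (simp add: F_def)
  have prod: "(\<Prod>b\<in>Basis. F b (f b)) = p (?T f $ i) * q (?T f $ j)" for f
    unfolding comp using bij by (simp add: Basis F_def)
  have meas: "(\<lambda>s::real^2. p (s $ i) * q (s $ j)) \<in> borel_measurable borel" by measurable
  have "integrable lborel (\<lambda>s::real^2. p (s $ i) * q (s $ j))"
    unfolding lborel_eq[where 'a="real^2"] integrable_distr_eq[OF T meas] prod[symmetric]
    using F_int by (intro product_integrable_prod) auto
  moreover have "(\<integral>s. p ((s::real^2) $ i) * q (s $ j) \<partial>lborel) = (\<integral>x. p x \<partial>lborel) * (\<integral>x. q x \<partial>lborel)"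
  proof -
    have "(\<integral>s. p ((s::real^2) $ i) * q (s $ j) \<partial>lborel) = (\<integral>f. (\<Prod>b\<in>Basis. F b (f b)) \<partial>(\<Pi>\<^sub>M b\<in>(Basis :: (real^2) set). lborel))"
      unfolding lborel_eq[where 'a="real^2"] integral_distr[OF T meas] prod ..
    also have "\<dots> = (\<Prod>b\<in>Basis. \<integral>x. F b x \<partial>lborel)"
      using F_int by (intro product_integral_prod) auto
    also have "\<dots> = (\<integral>x. p x \<partial>lborel) * (\<integral>x. q x \<partial>lborel)"
      using bij by (simp add: Basis F_def)
    finally show ?thesis .
  qed
  ultimately show ?thesis by (simp add: has_bochner_integral_iff)
qed

text \<open>By Fubini's theorem the mixed term of the square has the integral of
  \<open>k * k'\<close> as a factor and vanishes. The coordinate \<open>j\<close> is the one in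
  which the lag is 0.\<close>

lemma plane_increment_integral:
  fixes i j :: 2
  assumes dec: "exp_decaying k" "exp_decaying k'" "exp_decaying P" "exp_decaying Q"
    and orth: "(\<integral>x. causal_part (\<lambda>x. k x * k' x) x \<partial>lborel) = 0"
    and "\<tau> \<ge> 0" "i \<noteq> j"
  defines "f \<equiv> \<lambda>s::real^2. causal_part k (0 - s $ j) * (causal_part P (\<tau> - s $ i) - causal_part P (- s $ i))
    + causal_part k' (0 - s $ j) * (causal_part Q (\<tau> - s $ i) - causal_part Q (- s $ i))"
  shows "integrable lborel (\<lambda>s. (f s)\<^sup>2)"
    and "(\<integral>s. (f s)\<^sup>2 \<partial>lborel) =
      (\<integral>x. causal_part (\<lambda>x. k x * k x) x \<partial>lborel) * increment_energy P \<tau> +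
      (\<integral>x. causal_part (\<lambda>x. k' x * k' x) x \<partial>lborel) * increment_energy Q \<tau>"
proof -
  define \<Delta> where "\<Delta> R x = causal_part R (\<tau> - x) - causal_part R (- x)" for R x
  have eq: "(f s)\<^sup>2 = (\<Delta> P (s $ i) * \<Delta> P (s $ i)) * causal_part (\<lambda>x. k x * k x) (0 - s $ j)
      + 2 * ((\<Delta> P (s $ i) * \<Delta> Q (s $ i)) * causal_part (\<lambda>x. k x * k' x) (0 - s $ j))
      + (\<Delta> Q (s $ i) * \<Delta> Q (s $ i)) * causal_part (\<lambda>x. k' x * k' x) (0 - s $ j)" for s
    unfolding f_def \<Delta>_def causal_part_mult[symmetric] by (simp add: power2_eq_square algebra_simps)
  have inc: "integrable lborel (\<lambda>x. \<Delta> R x * \<Delta> S x)" if "exp_decaying R" "exp_decaying S" for R S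
    unfolding \<Delta>_def using that \<open>\<tau> \<ge> 0\<close> by (rule integrable_causal_part_increment)
  have hb: "has_bochner_integral lborel
      (\<lambda>s::real^2. (\<Delta> R (s $ i) * \<Delta> S (s $ i)) * causal_part (\<lambda>x. g x * g' x) (0 - s $ j))
      ((\<integral>x. \<Delta> R x * \<Delta> S x \<partial>lborel) * (\<integral>x. causal_part (\<lambda>x. g x * g' x) x \<partial>lborel))"
    if "exp_decaying R" "exp_decaying S" "exp_decaying g" "exp_decaying g'" for R S g g'
    using has_bochner_integral_plane_product[OF inc[OF that(1,2)]
        integrable_causal_part_reflect[OF exp_decaying_mult[OF that(3,4)], of 0] \<open>i \<noteq> j\<close>]
    by (simp only: integral_causal_part_reflect)
  note hbs = hb[OF dec(3,3,1,1)] hb[OF dec(3,4,1,2)] hb[OF dec(4,4,2,2)]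
  have "has_bochner_integral lborel (\<lambda>s. (f s)\<^sup>2)
      ((\<integral>x. \<Delta> P x * \<Delta> P x \<partial>lborel) * (\<integral>x. causal_part (\<lambda>x. k x * k x) x \<partial>lborel)
      + 2 * ((\<integral>x. \<Delta> P x * \<Delta> Q x \<partial>lborel) * (\<integral>x. causal_part (\<lambda>x. k x * k' x) x \<partial>lborel))
      + (\<integral>x. \<Delta> Q x * \<Delta> Q x \<partial>lborel) * (\<integral>x. causal_part (\<lambda>x. k' x * k' x) x \<partial>lborel))"
    unfolding eq by (intro has_bochner_integral_add has_bochner_integral_mult_right hbs)
  then show "integrable lborel (\<lambda>s. (f s)\<^sup>2)" "(\<integral>s. (f s)\<^sup>2 \<partial>lborel) =
      (\<integral>x. causal_part (\<lambda>x. k x * k x) x \<partial>lborel) * increment_energy P \<tau> +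
      (\<integral>x. causal_part (\<lambda>x. k' x * k' x) x \<partial>lborel) * increment_energy Q \<tau>"
    unfolding has_bochner_integral_iff
    by (simp_all add: orth increment_energy_def \<Delta>_def power2_eq_square mult.commute)
qed

text \<open>The first row makes every eigenvector a multiple of \<open>(1, l)\<close>; the second
  row is then the characteristic equation.\<close>

lemma companion_eigenvalue:
  assumes "l \<in> eigenvalues (companion_matrix2 p)"
  shows "l * l + complex_of_real (coeff p 1) * l + complex_of_real (coeff p 0) = 0"
proof -
  obtain v :: "complex^2" where v: "v \<noteq> 0"
    "(\<chi> i j. complex_of_real (companion_matrix2 p $ i $ j)) *v v = l *s v"
    using assms by (auto simp: eigenvalues_def)
  have 1: "v $ 2 = l * v $ 1"
    using arg_cong[OF v(2), of "\<lambda>w. w $ 1"]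
    by (simp add: matrix_vector_mult_def sum_2 companion_matrix2_def)
  have 2: "- complex_of_real (coeff p 0) * v $ 1 - complex_of_real (coeff p 1) * v $ 2 = l * v $ 2"
    using arg_cong[OF v(2), of "\<lambda>w. w $ 2"]
    by (simp add: matrix_vector_mult_def sum_2 companion_matrix2_def)
  have "v $ 1 \<noteq> 0"
    using v(1) 1 by (auto simp: vec_eq_iff forall_2)
  moreover have "(l * l + complex_of_real (coeff p 1) * l + complex_of_real (coeff p 0)) * v $ 1 = 0"
  proof -
    have "(l * l + complex_of_real (coeff p 1) * l + complex_of_real (coeff p 0)) * v $ 1 =
        l * (l * v $ 1) - (- complex_of_real (coeff p 0) * v $ 1 - complex_of_real (coeff p 1) * (l * v $ 1))"
      by (simp add: algebra_simps)
    then show ?thesis using 2 unfolding 1 by (simp only: diff_self)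
  qed
  ultimately show ?thesis by simp
qed

lemma stable_companionI:
  assumes ev: "eigenvalues (companion_matrix2 p) = {l1, l2}" "l1 \<noteq> l2"
    and monic: "degree p = 2" "lead_coeff p = 1"
    and stable: "\<And>z::complex. poly (map_poly complex_of_real p) z = 0 \<Longrightarrow> Re z < 0"
  shows "stable_companion p l1 l2"
proof
  let ?c = "\<lambda>i. complex_of_real (coeff p i)"
  have q1: "l1 * l1 + ?c 1 * l1 + ?c 0 = 0" and q2: "l2 * l2 + ?c 1 * l2 + ?c 0 = 0"
    using ev(1) companion_eigenvalue[of l1 p] companion_eigenvalue[of l2 p] by simp_all
  have "(l1 - l2) * (l1 + l2 + ?c 1) = (l1 * l1 + ?c 1 * l1 + ?c 0) - (l2 * l2 + ?c 1 * l2 + ?c 0)"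
    by (simp add: algebra_simps)
  then have "(l1 - l2) * (l1 + l2 + ?c 1) = 0" unfolding q1 q2 by simp
  then have s: "l1 + l2 + ?c 1 = 0" using ev(2) by simp
  then show "l1 + l2 = - ?c 1" by (simp add: eq_neg_iff_add_eq_0)
  have "l1 * l2 - ?c 0 = l1 * (l1 + l2 + ?c 1) - (l1 * l1 + ?c 1 * l1 + ?c 0)"
    by (simp add: algebra_simps)
  then show "l1 * l2 = ?c 0" unfolding s q1 by simp
  have "poly (map_poly complex_of_real p) z = z * z + ?c 1 * z + ?c 0" for z
  proof -
    have "degree (map_poly complex_of_real p) = 2" using monic by (simp add: degree_map_poly)
    then show ?thesis
      using monic by (simp add: poly_altdef coeff_map_poly numeral_2_eq_2 algebra_simps)
  qed
  then show "Re l1 < 0" "Re l2 < 0" using stable q1 q2 by auto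
qed (rule ev(2))

context stable_companion
begin

abbreviation "E1 \<equiv> \<integral>x. causal_part (\<lambda>x. dh x * dh x) x \<partial>lborel"
abbreviation "E0 \<equiv> \<integral>x. causal_part (\<lambda>x. h x * h x) x \<partial>lborel"

lemma E1_eq: "E1 = 1 / (2 * c1)" and E0_eq: "E0 = 1 / (2 * c1 * c0)"
proof -
  show E1: "E1 = 1 / (2 * c1)" using gram_dh_dh c1_nonzero by (simp add: field_simps)
  show "E0 = 1 / (2 * c1 * c0)" using gram_h_h c0_nonzero c1_nonzero unfolding E1 by (simp add: field_simps)
qed

lemma exp_decaying_h_dh: "exp_decaying (\<lambda>x. r * h x + t * dh x)"
  by (intro exp_decaying_linear exp_decaying_h exp_decaying_dh)

lemma energy_h_dh:
  "(\<integral>x. causal_part (\<lambda>x. (r * h x + t * dh x) * (r * h x + t * dh x)) x \<partial>lborel) = r\<^sup>2 * E0 + t\<^sup>2 * E1"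
proof -
  have int: "integrable lborel (causal_part (\<lambda>x. h x * h x))" "integrable lborel (causal_part (\<lambda>x. h x * dh x))"
    "integrable lborel (causal_part (\<lambda>x. dh x * dh x))"
    by (intro integrable_causal_part exp_decaying_mult exp_decaying_h exp_decaying_dh)+
  have "causal_part (\<lambda>x. (r * h x + t * dh x) * (r * h x + t * dh x)) x =
      r\<^sup>2 * causal_part (\<lambda>x. h x * h x) x + (2 * r * t) * causal_part (\<lambda>x. h x * dh x) x
      + t\<^sup>2 * causal_part (\<lambda>x. dh x * dh x) x" for x
    by (simp add: causal_part_def power2_eq_square algebra_simps)
  then show ?thesis using int gram_h_dh by simp
qed

lemma increment_energy_h_dh_at_top:
  "(\<lambda>n. increment_energy (\<lambda>x. r * h x + t * dh x) (real n)) \<longlonglongrightarrow> 2 * (r\<^sup>2 * E0 + t\<^sup>2 * E1)"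
  using increment_energy_at_top[OF exp_decaying_h_dh] unfolding energy_h_dh .

lemma increment_energy_h_dh_at_0:
  "(\<lambda>n. real (Suc n) * increment_energy (\<lambda>x. r * h x + t * dh x) (1 / real (Suc n))) \<longlonglongrightarrow> t\<^sup>2"
proof -
  \<comment> \<open>These are the coefficients of the derivative of \<open>r * h + t * dh\<close>
    after the second derivative of \<open>h\<close> is replaced through the equation.\<close>
  have "exp_decaying (\<lambda>x. (- (t * c0)) * h x + (r - t * c1) * dh x)"
    by (rule exp_decaying_h_dh)
  moreover have "((\<lambda>x. r * h x + t * dh x) has_real_derivative (- (t * c0)) * h x + (r - t * c1) * dh x) (at x)" for x
    by (rule DERIV_cong[OF DERIV_add[OF DERIV_cmult[OF h_has_derivative] DERIV_cmult[OF dh_has_derivative]]])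
      (simp add: algebra_simps)
  ultimately have "(\<lambda>n. real (Suc n) * increment_energy (\<lambda>x. r * h x + t * dh x) (1 / real (Suc n)))
      \<longlonglongrightarrow> (r * h 0 + t * dh 0)\<^sup>2"
    by (rule increment_energy_at_0[OF exp_decaying_h_dh])
  then show ?thesis by (simp add: h_0 dh_0)
qed

end

section \<open>Variogram, slopes and sill of the planar field\<close>

locale planar_carma =
  S1: stable_companion "a 1" l11 l12 + S2: stable_companion "a 2" l21 l22 +
  B: square_integrable_levy_basis M \<Lambda> \<beta> \<sigma>2 \<nu>
  for a :: "2 \<Rightarrow> real poly" and l11 l12 l21 l22 :: complex
    and M :: "'w measure" and \<Lambda> :: "(real^2) set \<Rightarrow> 'w \<Rightarrow> real" and \<beta> \<sigma>2 :: real and \<nu> :: "real measure" +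
  fixes b0 b1 :: real and Y :: "real^2 \<Rightarrow> 'w \<Rightarrow> real"
  assumes field: "has_stochastic_integral M \<Lambda>
      (\<lambda>s. indicator {s. s $ 1 \<le> t $ 1 \<and> s $ 2 \<le> t $ 2} s *
        CARMA_kernel (vector [b0, b1]) (\<lambda>i. companion_matrix2 (a i)) (t - s)) UNIV (Y t)"
begin

text \<open>The coefficient of \<open>h * h\<close> when the kernel is written as a bilinear form in
  the pairs \<open>(h, dh)\<close>. The form has the symmetric matrix with rows
  \<open>(r, b0)\<close> and \<open>(b0, b1)\<close>, so both axes obey the same formulas with the
  directions exchanged.\<close>

definition r :: real where "r = b0 * S1.c1 - b1 * S1.c0"

lemma kernel_eq:
  "CARMA_kernel (vector [b0, b1]) (\<lambda>i. companion_matrix2 (a i)) x =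
    S2.h (x $ 2) * (r * S1.h (x $ 1) + b0 * S1.dh (x $ 1)) + S2.dh (x $ 2) * (b0 * S1.h (x $ 1) + b1 * S1.dh (x $ 1))"
  by (simp add: CARMA_kernel_def S1.matrix_exp_companion S2.matrix_exp_companion inner_vec_def sum_2
      matrix_vector_mult_def matrix_matrix_mult_def axis_def r_def algebra_simps)

lemma variogram_eq_integral:
  assumes "integrable lborel (\<lambda>s. (g s)\<^sup>2)"
    and "\<And>s. indicator {s. s $ 1 \<le> t $ 1 \<and> s $ 2 \<le> t $ 2} s *
        CARMA_kernel (vector [b0, b1]) (\<lambda>i. companion_matrix2 (a i)) (t - s) -
      indicator {s. s $ 1 \<le> (0::real^2) $ 1 \<and> s $ 2 \<le> (0::real^2) $ 2} s *
        CARMA_kernel (vector [b0, b1]) (\<lambda>i. companion_matrix2 (a i)) (0 - s) = g s"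
  shows "variogram M Y t = B.\<kappa> * (\<integral>s. (g s)\<^sup>2 \<partial>lborel)"
  using B.variance_stochastic_integral_diff[OF field field, of t 0] assms
  unfolding variogram_def by (simp only: assms(2))

lemma variogram_axis_1:
  assumes "\<tau> \<ge> 0"
  shows "variogram M Y (\<tau> *\<^sub>R axis 1 1) = B.\<kappa> *
    (S2.E0 * increment_energy (\<lambda>x. r * S1.h x + b0 * S1.dh x) \<tau> +
     S2.E1 * increment_energy (\<lambda>x. b0 * S1.h x + b1 * S1.dh x) \<tau>)"
proof -
  \<comment> \<open>The quadrant indicators factor into the cut-offs of the coordinates, which gives
    the increment of the whole kernel this two-term form.\<close>
  let ?g = "\<lambda>s::real^2. causal_part S2.h (0 - s $ 2) *
      (causal_part (\<lambda>x. r * S1.h x + b0 * S1.dh x) (\<tau> - s $ 1) - causal_part (\<lambda>x. r * S1.h x + b0 * S1.dh x) (- s $ 1))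
    + causal_part S2.dh (0 - s $ 2) *
      (causal_part (\<lambda>x. b0 * S1.h x + b1 * S1.dh x) (\<tau> - s $ 1) - causal_part (\<lambda>x. b0 * S1.h x + b1 * S1.dh x) (- s $ 1))"
  note integral = plane_increment_integral[OF S2.exp_decaying_h S2.exp_decaying_dh S1.exp_decaying_h_dh
      S1.exp_decaying_h_dh S2.gram_h_dh assms, of 1 2]
  have "variogram M Y (\<tau> *\<^sub>R axis 1 1) = B.\<kappa> * (\<integral>s. (?g s)\<^sup>2 \<partial>lborel)"
    using integral(1) by (rule variogram_eq_integral)
      (simp_all add: kernel_eq causal_part_def indicator_def axis_def algebra_simps)
  then show ?thesis using integral(2) by simp
qed

lemma variogram_axis_2:
  assumes "\<tau> \<ge> 0"
  shows "variogram M Y (\<tau> *\<^sub>R axis 2 1) = B.\<kappa> *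
    (S1.E0 * increment_energy (\<lambda>x. r * S2.h x + b0 * S2.dh x) \<tau> +
     S1.E1 * increment_energy (\<lambda>x. b0 * S2.h x + b1 * S2.dh x) \<tau>)"
proof -
  let ?g = "\<lambda>s::real^2. causal_part S1.h (0 - s $ 1) *
      (causal_part (\<lambda>x. r * S2.h x + b0 * S2.dh x) (\<tau> - s $ 2) - causal_part (\<lambda>x. r * S2.h x + b0 * S2.dh x) (- s $ 2))
    + causal_part S1.dh (0 - s $ 1) *
      (causal_part (\<lambda>x. b0 * S2.h x + b1 * S2.dh x) (\<tau> - s $ 2) - causal_part (\<lambda>x. b0 * S2.h x + b1 * S2.dh x) (- s $ 2))"
  note integral = plane_increment_integral[OF S1.exp_decaying_h S1.exp_decaying_dh S2.exp_decaying_h_dh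
      S2.exp_decaying_h_dh S1.gram_h_dh assms, of 2 1]
  have "variogram M Y (\<tau> *\<^sub>R axis 2 1) = B.\<kappa> * (\<integral>s. (?g s)\<^sup>2 \<partial>lborel)"
    using integral(1) by (rule variogram_eq_integral)
      (simp_all add: kernel_eq causal_part_def indicator_def axis_def algebra_simps)
  then show ?thesis using integral(2) by simp
qed

text \<open>Since \<open>h 0 = 0\<close> and \<open>dh 0 = 1\<close>, the two one-dimensional
  kernels jump by \<open>b0\<close> and \<open>b1\<close>, and \<open>r\<close> has no influence.
  The weights belong to the other direction.\<close>

lemma variogram_slope_1:
  "(\<lambda>n. real (Suc n) * variogram M Y ((1 / real (Suc n)) *\<^sub>R axis 1 1)) \<longlonglongrightarrow>
    B.\<kappa> * (S2.E0 * b0\<^sup>2 + S2.E1 * b1\<^sup>2)"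
proof -
  have "(\<lambda>n. B.\<kappa> * (S2.E0 * (real (Suc n) * increment_energy (\<lambda>x. r * S1.h x + b0 * S1.dh x) (1 / real (Suc n))) +
     S2.E1 * (real (Suc n) * increment_energy (\<lambda>x. b0 * S1.h x + b1 * S1.dh x) (1 / real (Suc n))))) \<longlonglongrightarrow>
    B.\<kappa> * (S2.E0 * b0\<^sup>2 + S2.E1 * b1\<^sup>2)"
    by (intro tendsto_intros S1.increment_energy_h_dh_at_0)
  then show ?thesis
    by (simp add: variogram_axis_1 distrib_left mult.left_commute del: of_nat_Suc)
qed

lemma variogram_slope_2:
  "(\<lambda>n. real (Suc n) * variogram M Y ((1 / real (Suc n)) *\<^sub>R axis 2 1)) \<longlonglongrightarrow>
    B.\<kappa> * (S1.E0 * b0\<^sup>2 + S1.E1 * b1\<^sup>2)"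
proof -
  have "(\<lambda>n. B.\<kappa> * (S1.E0 * (real (Suc n) * increment_energy (\<lambda>x. r * S2.h x + b0 * S2.dh x) (1 / real (Suc n))) +
     S1.E1 * (real (Suc n) * increment_energy (\<lambda>x. b0 * S2.h x + b1 * S2.dh x) (1 / real (Suc n))))) \<longlonglongrightarrow>
    B.\<kappa> * (S1.E0 * b0\<^sup>2 + S1.E1 * b1\<^sup>2)"
    by (intro tendsto_intros S2.increment_energy_h_dh_at_0)
  then show ?thesis
    by (simp add: variogram_axis_2 distrib_left mult.left_commute del: of_nat_Suc)
qed

text \<open>Here \<open>r\<close> enters, and with \<open>r^2\<close> the product of
  \<open>b0\<close> and \<open>b1\<close> that the slopes do not see.\<close>

lemma variogram_sill:
  "(\<lambda>n. variogram M Y (real n *\<^sub>R axis 1 1)) \<longlonglongrightarrow>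
    B.\<kappa> * (S2.E0 * (2 * (r\<^sup>2 * S1.E0 + b0\<^sup>2 * S1.E1)) + S2.E1 * (2 * (b0\<^sup>2 * S1.E0 + b1\<^sup>2 * S1.E1)))"
proof -
  have "(\<lambda>n. B.\<kappa> * (S2.E0 * increment_energy (\<lambda>x. r * S1.h x + b0 * S1.dh x) (real n) +
     S2.E1 * increment_energy (\<lambda>x. b0 * S1.h x + b1 * S1.dh x) (real n))) \<longlonglongrightarrow>
    B.\<kappa> * (S2.E0 * (2 * (r\<^sup>2 * S1.E0 + b0\<^sup>2 * S1.E1)) + S2.E1 * (2 * (b0\<^sup>2 * S1.E0 + b1\<^sup>2 * S1.E1)))"
    by (intro tendsto_intros S1.increment_energy_h_dh_at_top)
  then show ?thesis by (simp add: variogram_axis_1)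
qed

end

text \<open>Squares fix \<open>b0\<close> by its sign condition and \<open>b1\<close> up to sign;
  the product \<open>b0 * b1\<close> settles that sign unless \<open>b0 = 0\<close>.\<close>

lemma moving_average_unique:
  fixes b0 b1 b0' b1' c0 c1 d0 d1 :: real
  assumes nz: "c0 \<noteq> 0" "c1 \<noteq> 0" "d0 \<noteq> 0" "d1 \<noteq> 0" and "c0 \<noteq> d0" and "b0 \<ge> 0" "b0' \<ge> 0"
    and slope1: "1 / (2 * d1 * d0) * b0\<^sup>2 + 1 / (2 * d1) * b1\<^sup>2 = 1 / (2 * d1 * d0) * b0'\<^sup>2 + 1 / (2 * d1) * b1'\<^sup>2"
    and slope2: "1 / (2 * c1 * c0) * b0\<^sup>2 + 1 / (2 * c1) * b1\<^sup>2 = 1 / (2 * c1 * c0) * b0'\<^sup>2 + 1 / (2 * c1) * b1'\<^sup>2"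
    and sill: "1 / (2 * d1 * d0) * (2 * ((b0 * c1 - b1 * c0)\<^sup>2 * (1 / (2 * c1 * c0)) + b0\<^sup>2 * (1 / (2 * c1)))) +
        1 / (2 * d1) * (2 * (b0\<^sup>2 * (1 / (2 * c1 * c0)) + b1\<^sup>2 * (1 / (2 * c1)))) =
      1 / (2 * d1 * d0) * (2 * ((b0' * c1 - b1' * c0)\<^sup>2 * (1 / (2 * c1 * c0)) + b0'\<^sup>2 * (1 / (2 * c1)))) +
        1 / (2 * d1) * (2 * (b0'\<^sup>2 * (1 / (2 * c1 * c0)) + b1'\<^sup>2 * (1 / (2 * c1))))"
  shows "b0' = b0 \<and> (b1' = b1 \<or> b0 = 0 \<and> b1' = - b1)"
proof -
  have 1: "b0\<^sup>2 + d0 * b1\<^sup>2 = b0'\<^sup>2 + d0 * b1'\<^sup>2"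
    using slope1 nz by (simp add: field_simps)
  have 2: "b0\<^sup>2 + c0 * b1\<^sup>2 = b0'\<^sup>2 + c0 * b1'\<^sup>2"
    using slope2 nz by (simp add: field_simps)
  have "(c0 - d0) * (b1\<^sup>2 - b1'\<^sup>2) = 0" using 1 2 by (simp add: algebra_simps)
  then have b1: "b1\<^sup>2 = b1'\<^sup>2" using \<open>c0 \<noteq> d0\<close> by simp
  then have b0: "b0\<^sup>2 = b0'\<^sup>2" using 1 by simp
  then have b0_eq: "b0' = b0" using \<open>b0 \<ge> 0\<close> \<open>b0' \<ge> 0\<close> by (simp add: power2_eq_iff_nonneg)
  have "(b0 * c1 - b1 * c0)\<^sup>2 = (b0' * c1 - b1' * c0)\<^sup>2"
    using sill nz unfolding b0 b1 by simp
  \<comment> \<open>With both squares known, the mixed term is the only unknown left, and its factor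
    \<open>2 * c0 * c1\<close> is nonzero.\<close>
  then have "b0\<^sup>2 * c1\<^sup>2 - 2 * c0 * c1 * (b0 * b1) + b1\<^sup>2 * c0\<^sup>2 = b0\<^sup>2 * c1\<^sup>2 - 2 * c0 * c1 * (b0 * b1') + b1\<^sup>2 * c0\<^sup>2"
    unfolding b0_eq power2_diff power_mult_distrib b1[symmetric] by (simp add: ac_simps)
  then have "b0 * b1 = b0 * b1'" using nz by simp
  then show ?thesis
    using b0_eq b1 by (auto simp: power2_eq_iff)
qed

lemma admissible_planar_carma:
  assumes "admissible_CARMA_2_1 \<Delta> M \<Lambda> \<beta> \<sigma>2 \<nu> b0 b1 a Y l d"
  shows "planar_carma a (l 1 1) (l 1 2) (l 2 1) (l 2 2) M \<Lambda> \<beta> \<sigma>2 \<nu> b0 b1 Y"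
proof -
  have S: "stable_companion (a i) (l i 1) (l i 2)" for i
    by (rule stable_companionI)
      (use assms in \<open>unfold admissible_CARMA_2_1_def causal_CARMA_2_1_def, blast+\<close>)
  interpret S1: stable_companion "a 1" "l 1 1" "l 1 2" by (rule S)
  interpret S2: stable_companion "a 2" "l 2 1" "l 2 2" by (rule S)
  interpret B: homogeneous_levy_basis M \<Lambda> \<beta> \<sigma>2 \<nu>
    using assms by (simp add: admissible_CARMA_2_1_def causal_CARMA_2_1_def)
  show ?thesis
  proof
    show "integrable \<nu> (\<lambda>z. z\<^sup>2)"
      using assms by (intro B.integrable_jump_square) (simp add: admissible_CARMA_2_1_def)
  qed (use assms in \<open>simp add: admissible_CARMA_2_1_def causal_CARMA_2_1_def\<close>)
qed

text \<open>The alternative \<open>b1' = - b1\<close> for \<open>b0 = 0\<close> is the passage from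
  \<open>Y\<close> to \<open>- Y\<close>, which no variogram can detect.\<close>

theorem proposition4p7:
  fixes \<Delta> :: real
    and M :: "'w measure" and M' :: "'v measure"
    and \<Lambda> :: "(real^2) set \<Rightarrow> 'w \<Rightarrow> real" and \<Lambda>' :: "(real^2) set \<Rightarrow> 'v \<Rightarrow> real"
    and \<beta> \<beta>' \<sigma>2 \<sigma>2' :: real and \<nu> \<nu>' :: "real measure"
    and b0 b1 b0' b1' :: real and a a' :: "2 \<Rightarrow> real poly"
    and Y :: "real^2 \<Rightarrow> 'w \<Rightarrow> real" and Y' :: "real^2 \<Rightarrow> 'v \<Rightarrow> real"
    and l l' :: "2 \<Rightarrow> 2 \<Rightarrow> complex" and d d' :: "2 \<Rightarrow> complex \<Rightarrow> complex"
  assumes "\<Delta> > 0"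
    and "admissible_CARMA_2_1 \<Delta> M \<Lambda> \<beta> \<sigma>2 \<nu> b0 b1 a Y l d"
    and "admissible_CARMA_2_1 \<Delta> M' \<Lambda>' \<beta>' \<sigma>2' \<nu>' b0' b1' a' Y' l' d'"
    and "\<And>(i::2) (j::nat). j \<le> 5 \<Longrightarrow>
           variogram M Y ((real j * \<Delta>) *\<^sub>R axis i 1) = variogram M' Y' ((real j * \<Delta>) *\<^sub>R axis i 1)"
  shows "b0' = b0 \<and> (b1' = b1 \<or> (b0 = 0 \<and> b1' = - b1)) \<and>
     (\<forall>i. (l' i 1 = l i 1 \<and> l' i 2 = l i 2) \<or> (l' i 1 = l i 2 \<and> l' i 2 = l i 1))"
proof -
  interpret C: planar_carma a "l 1 1" "l 1 2" "l 2 1" "l 2 2" M \<Lambda> \<beta> \<sigma>2 \<nu> b0 b1 Y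
    using assms(2) by (rule admissible_planar_carma)
  interpret C': planar_carma a' "l' 1 1" "l' 1 2" "l' 2 1" "l' 2 2" M' \<Lambda>' \<beta>' \<sigma>2' \<nu>' b0' b1' Y'
    using assms(3) by (rule admissible_planar_carma)
  note adm = assms(2)[unfolded admissible_CARMA_2_1_def] and adm' = assms(3)[unfolded admissible_CARMA_2_1_def]
  have \<kappa>: "basis_variance \<sigma>2 \<nu> = 1" "basis_variance \<sigma>2' \<nu>' = 1"
    using adm adm' by auto
  have ev: "eigenvalues (companion_matrix2 (a i)) = {l i 1, l i 2}"
    "eigenvalues (companion_matrix2 (a' i)) = {l' i 1, l' i 2}" for i
    using adm adm' by auto
  have \<psi>: "complex_of_real (variogram M Y (\<tau> *\<^sub>R axis i 1)) =
      2 * (\<Sum>x\<in>{l i 1, l i 2}. d i x * (1 - exp (x * complex_of_real \<bar>\<tau>\<bar>)))"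
    "complex_of_real (variogram M' Y' (\<tau> *\<^sub>R axis i 1)) =
      2 * (\<Sum>x\<in>{l' i 1, l' i 2}. d' i x * (1 - exp (x * complex_of_real \<bar>\<tau>\<bar>)))" for i \<tau>
    using adm adm' unfolding variogram_coefficients_def ev \<kappa> by (simp_all del: of_real_mult)
  have stable: "Re (l i j) < 0" "Re (l' i j) < 0" for i j
    using C.S1.stable C.S2.stable C'.S1.stable C'.S2.stable exhaust_2[of i] exhaust_2[of j] by auto
  have same: "{l' i 1, l' i 2} = {l i 1, l i 2} \<and> (\<forall>x\<in>{l i 1, l i 2}. d' i x = d i x)" for i
  proof (rule exponential_sum_unique[OF \<open>\<Delta> > 0\<close>])
    show "card {l i 1, l i 2} \<le> 2" "card {l' i 1, l' i 2} \<le> 2"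
      by (simp_all add: card_insert_if)
    show "- pi / \<Delta> \<le> Im x \<and> Im x < pi / \<Delta> \<and> Re x < 0" if "x \<in> {l i 1, l i 2} \<union> {l' i 1, l' i 2}" for x
      using that adm adm' stable by auto
    show "d i x \<noteq> 0" if "x \<in> {l i 1, l i 2}" for x using that adm by auto
    show "d' i x \<noteq> 0" if "x \<in> {l' i 1, l' i 2}" for x using that adm' by auto
    show "(\<Sum>x\<in>{l i 1, l i 2}. d i x * (1 - exp (x * complex_of_real (real j * \<Delta>)))) =
        (\<Sum>x\<in>{l' i 1, l' i 2}. d' i x * (1 - exp (x * complex_of_real (real j * \<Delta>))))" if "j \<le> 5" for j
    proof -
      have "\<bar>real j * \<Delta>\<bar> = real j * \<Delta>" using \<open>\<Delta> > 0\<close> by simp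
      then show ?thesis
        using arg_cong[OF assms(4)[OF that, of i], of complex_of_real] unfolding \<psi> by (simp only: mult_cancel_left) simp
    qed
  qed simp_all
  have order: "(l' i 1 = l i 1 \<and> l' i 2 = l i 2) \<or> (l' i 1 = l i 2 \<and> l' i 2 = l i 1)" for i
    using same[of i] by (auto simp: doubleton_eq_iff)
  \<comment> \<open>Agreement at the nodes becomes agreement at all lags, so limits at 0 and at
    infinity can be compared whatever \<open>\<Delta>\<close> is.\<close>
  have \<psi>_eq: "variogram M Y (\<tau> *\<^sub>R axis i 1) = variogram M' Y' (\<tau> *\<^sub>R axis i 1)" for i \<tau>
  proof -
    have "complex_of_real (variogram M Y (\<tau> *\<^sub>R axis i 1)) = complex_of_real (variogram M' Y' (\<tau> *\<^sub>R axis i 1))"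
      unfolding \<psi> using same[of i] by (intro arg_cong[where f="(*) 2"] sum.cong) auto
    then show ?thesis by simp
  qed
  have sums: "l' i 1 + l' i 2 = l i 1 + l i 2" "l' i 1 * l' i 2 = l i 1 * l i 2" for i
    using order[of i] by (auto simp: ac_simps)
  have c: "coeff (a' 1) 1 = coeff (a 1) 1" "coeff (a' 1) 0 = coeff (a 1) 0"
    "coeff (a' 2) 1 = coeff (a 2) 1" "coeff (a' 2) 0 = coeff (a 2) 0"
    using sums[of 1] sums[of 2] C.S1.trace C.S2.trace C'.S1.trace C'.S2.trace
      C.S1.det C.S2.det C'.S1.det C'.S2.det by (simp_all del: One_nat_def)
  \<comment> \<open>The products of the eigenvalues are the constant coefficients of the two
    polynomials, so the additional assumption says that these differ.\<close>
  have "C.S1.c0 \<noteq> C.S2.c0"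
    using adm C.S1.det C.S2.det by auto
  moreover note LIMSEQ_unique[OF C.variogram_slope_1 C'.variogram_slope_1[folded \<psi>_eq], unfolded \<kappa> mult_1_left
      C.S2.E0_eq C.S2.E1_eq C'.S2.E0_eq C'.S2.E1_eq c]
    LIMSEQ_unique[OF C.variogram_slope_2 C'.variogram_slope_2[folded \<psi>_eq], unfolded \<kappa> mult_1_left
      C.S1.E0_eq C.S1.E1_eq C'.S1.E0_eq C'.S1.E1_eq c]
    LIMSEQ_unique[OF C.variogram_sill C'.variogram_sill[folded \<psi>_eq], unfolded \<kappa> mult_1_left C.r_def C'.r_def
      C.S1.E0_eq C.S1.E1_eq C'.S1.E0_eq C'.S1.E1_eq C.S2.E0_eq C.S2.E1_eq C'.S2.E0_eq C'.S2.E1_eq c]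
  moreover have "b0 \<ge> 0" "b0' \<ge> 0" using adm adm' by auto
  ultimately have "b0' = b0 \<and> (b1' = b1 \<or> b0 = 0 \<and> b1' = - b1)"
    by (intro moving_average_unique[OF C.S1.c0_nonzero C.S1.c1_nonzero C.S2.c0_nonzero C.S2.c1_nonzero])
  then show ?thesis using order by blast
qed

end
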